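(* For a strict partition $\nu=(\nu_1,\dots,\nu_r)$ of length $r\le n$, $Q^{\mathbb L}_\nu(x_1,\dots,x_n)$ is the coefficient of $u_1^{-\nu_1}\cdots u_r^{-\nu_r}$ in $$\prod_{i=1}^r\Big(\frac1{\mathscr P(u_i)}\prod_{j=1}^n\frac{u_i+_{\mathbb L}x_j}{u_i+_{\mathbb L}\bar x_j}\Big)\prod_{1\le i<j\le r}\frac{u_j+_{\mathbb L}\bar u_i}{u_j+_{\mathbb L}u_i}.$$
   Context: $\mathbb L$ is the Lazard ring, $F_{\mathbb L}(u,v)=u+v+\sum_{i,j\ge1}a_{i,j}u^iv^j$ the universal formal group law, $u+_{\mathbb L}v:=F_{\mathbb L}(u,v)$, $\bar u$ its formal inverse, $\mathscr P(z):=1+\sum_{i\ge1}a_{i,1}z^i$. $x_1,\dots,x_n$ indeterminates; $[x]^k:=(x+_{\mathbb L}x)x^{k-1}$. $Q^{\mathbb L}_\nu(x_1,\dots,x_n):=\sum_{\bar w\in S_n/(S_1)^r\times S_{n-r}}w\cdot\big[\prod_{i=1}^r[x_i]^{\nu_i}\prod_{i=1}^r\prod_{j=i+1}^n\frac{x_i+_{\mathbb L}x_j}{x_i+_{\mathbb L}\bar x_j}\big]$ ($S_n$ permuting the $x$'s, sum over coset representatives). Expansion convention: expand in powers of $x_1,\dots,x_n$ (denominators $u_i+_{\mathbb L}\bar x_j$ in powers of $x_j$); $1/\mathscr P(u_i)$ is a power series; for $i<j$, $1/(u_j+_{\mathbb L}u_i)$ is expanded in powers of $u_i$ with coefficients Laurent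 in $u_j$; the coefficient is taken in the resulting Laurent series ring in $u_1,\dots,u_r$. *)

theory Defs
  imports Main
begin

text \<open>
Two-level formal series over a coefficient ring 'a:
  a series f is a function  alpha |-> e |-> coefficient,
  alpha :: nat => nat   the exponent of the x-variables (x_{j+1} has index j),
  e     :: nat => int   the exponent of the u-variables (u_{i+1} has index i).
Following the expansion convention, such a series is a power series in the x's whose
coefficients are (iterated) Laurent series in the u's; the u-support of each
x-coefficient is required to be well ordered for the lexicographic order in which
u_1 (index 0) is the most significant variable (this is the Hahn-series ring containing
the iterated Laurent series ring ...((K((u_r)))((u_{r-1})))...((u_1)) ).
\<close>

type_synonym 'a ser = "(nat \<Rightarrow> nat) \<Rightarrow> (nat \<Rightarrow> int) \<Rightarrow> 'a"

definition lexless :: "(nat \<Rightarrow> int) \<Rightarrow> (nat \<Rightarrow> int) \<Rightarrow> bool" where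
  "lexless e e' \<longleftrightarrow> (\<exists>k. e k < e' k \<and> (\<forall>i<k. e i = e' i))"

definition lex_wo :: "(nat \<Rightarrow> int) set \<Rightarrow> bool" where
  "lex_wo S \<longleftrightarrow> (\<forall>T \<subseteq> S. T \<noteq> {} \<longrightarrow> (\<exists>m\<in>T. \<forall>t\<in>T. \<not> lexless t m))"

definition wf_ser :: "'a::zero ser \<Rightarrow> bool" where
  "wf_ser f \<longleftrightarrow>
     (\<forall>\<alpha> e. f \<alpha> e \<noteq> 0 \<longrightarrow> finite {i. \<alpha> i \<noteq> 0} \<and> finite {i. e i \<noteq> 0})
   \<and> (\<forall>\<alpha>. lex_wo {e. f \<alpha> e \<noteq> 0})"

definition szero :: "'a::zero ser" where
  "szero = (\<lambda>\<alpha> e. 0)"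

definition sone :: "'a::{zero,one} ser" where
  "sone = (\<lambda>\<alpha> e. if \<alpha> = (\<lambda>_. 0) \<and> e = (\<lambda>_. 0) then 1 else 0)"

definition sadd :: "'a::plus ser \<Rightarrow> 'a ser \<Rightarrow> 'a ser" where
  "sadd f g = (\<lambda>\<alpha> e. f \<alpha> e + g \<alpha> e)"

text \<open>Cauchy product (the inner sums are finite for well-supported series).\<close>
definition smult :: "'a::comm_ring_1 ser \<Rightarrow> 'a ser \<Rightarrow> 'a ser" where
  "smult f g = (\<lambda>\<alpha> e.
     \<Sum>\<beta>\<in>{\<beta>. \<forall>i. \<beta> i \<le> \<alpha> i}.
       \<Sum>p\<in>{p. f \<beta> p \<noteq> 0 \<and> g (\<lambda>i. \<alpha> i - \<beta> i) (\<lambda>i. e i - p i) \<noteq> 0}.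
         f \<beta> p * g (\<lambda>i. \<alpha> i - \<beta> i) (\<lambda>i. e i - p i))"

definition spow :: "'a::comm_ring_1 ser \<Rightarrow> nat \<Rightarrow> 'a ser" where
  "spow f k = (smult f ^^ k) sone"

definition sinv :: "'a::comm_ring_1 ser \<Rightarrow> 'a ser" where
  "sinv f = (THE g. wf_ser g \<and> smult f g = sone)"

definition ssum_list :: "'a::comm_ring_1 ser list \<Rightarrow> 'a ser" where
  "ssum_list fs = foldr sadd fs szero"

definition sprod_list :: "'a::comm_ring_1 ser list \<Rightarrow> 'a ser" where
  "sprod_list fs = foldr smult fs sone"

definition sprod_set :: "(nat \<Rightarrow> 'a::comm_ring_1 ser) \<Rightarrow> nat set \<Rightarrow> 'a ser" where
  "sprod_set F A = sprod_list (map F (sorted_list_of_set A))"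

definition uvar :: "nat \<Rightarrow> 'a::{zero,one} ser" where
  "uvar i = (\<lambda>\<alpha> e. if \<alpha> = (\<lambda>_. 0) \<and> e = (\<lambda>k. if k = i then 1 else 0) then 1 else 0)"

definition xvar :: "nat \<Rightarrow> 'a::{zero,one} ser" where
  "xvar j = (\<lambda>\<alpha> e. if \<alpha> = (\<lambda>k. if k = j then 1 else 0) \<and> e = (\<lambda>_. 0) then 1 else 0)"

text \<open>Substitution of a series A into a one-variable power series sum_k c_k t^k
  (coefficientwise; only finitely many terms contribute in the convergent cases used).\<close>
definition subst1 :: "(nat \<Rightarrow> 'a::comm_ring_1) \<Rightarrow> 'a ser \<Rightarrow> 'a ser" where
  "subst1 c A = (\<lambda>\<alpha> e. \<Sum>k\<in>{k. c k * spow A k \<alpha> e \<noteq> 0}. c k * spow A k \<alpha> e)"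

definition Fsub :: "(nat \<Rightarrow> nat \<Rightarrow> 'a::comm_ring_1) \<Rightarrow> 'a ser \<Rightarrow> 'a ser \<Rightarrow> 'a ser" where
  "Fsub a A B = (\<lambda>\<alpha> e. A \<alpha> e + B \<alpha> e +
     (\<Sum>kl\<in>{(k,l). 1 \<le> k \<and> 1 \<le> l \<and> a k l * smult (spow A k) (spow B l) \<alpha> e \<noteq> 0}.
        a (fst kl) (snd kl) * smult (spow A (fst kl)) (spow B (snd kl)) \<alpha> e))"

definition is_fgl :: "(nat \<Rightarrow> nat \<Rightarrow> 'a::comm_ring_1) \<Rightarrow> bool" where
  "is_fgl a \<longleftrightarrow> (\<forall>i j. a i j = a j i) \<and>
     Fsub a (Fsub a (xvar 0) (xvar 1)) (xvar 2) = Fsub a (xvar 0) (Fsub a (xvar 1) (xvar 2))"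

definition ibar :: "(nat \<Rightarrow> nat \<Rightarrow> 'a::comm_ring_1) \<Rightarrow> nat \<Rightarrow> 'a" where
  "ibar a = (THE b. b 0 = 0 \<and> Fsub a (xvar 0) (subst1 b (xvar 0)) = szero)"

definition xbar :: "(nat \<Rightarrow> nat \<Rightarrow> 'a::comm_ring_1) \<Rightarrow> nat \<Rightarrow> 'a ser" where
  "xbar a j = subst1 (ibar a) (xvar j)"

definition ubar :: "(nat \<Rightarrow> nat \<Rightarrow> 'a::comm_ring_1) \<Rightarrow> nat \<Rightarrow> 'a ser" where
  "ubar a i = subst1 (ibar a) (uvar i)"

definition Pser :: "(nat \<Rightarrow> nat \<Rightarrow> 'a::comm_ring_1) \<Rightarrow> 'a ser \<Rightarrow> 'a ser" where
  "Pser a A = subst1 (\<lambda>k. if k = 0 then 1 else a k 1) A"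

definition bracket :: "(nat \<Rightarrow> nat \<Rightarrow> 'a::comm_ring_1) \<Rightarrow> 'a ser \<Rightarrow> nat \<Rightarrow> 'a ser" where
  "bracket a A k = smult (Fsub a A A) (spow A (k - 1))"

definition strict_partition :: "nat list \<Rightarrow> bool" where
  "strict_partition \<nu> \<longleftrightarrow> sorted_wrt (>) \<nu> \<and> (\<forall>k\<in>set \<nu>. 0 < k)"

definition genfun :: "(nat \<Rightarrow> nat \<Rightarrow> 'a::comm_ring_1) \<Rightarrow> nat \<Rightarrow> nat \<Rightarrow> 'a ser" where
  "genfun a n r = smult
     (sprod_set (\<lambda>i. smult (sinv (Pser a (uvar i)))
        (sprod_set (\<lambda>j. smult (Fsub a (uvar i) (xvar j)) (sinv (Fsub a (uvar i) (xbar a j)))) {..<n}))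
      {..<r})
     (sprod_set (\<lambda>i. sprod_set (\<lambda>j.
        smult (Fsub a (uvar j) (ubar a i)) (sinv (Fsub a (uvar j) (uvar i)))) {i<..<r}) {..<r})"

text \<open>Coset representatives of S_n/(S_1^r x S_{n-r}) <-> injections sigma : {0..<r} -> {0..<n}
  (sigma i = w(i+1) - 1); the term is then invariant under the remaining choices.\<close>
definition injs :: "nat \<Rightarrow> nat \<Rightarrow> (nat \<Rightarrow> nat) set" where
  "injs n r = {\<sigma>. inj_on \<sigma> {..<r} \<and> \<sigma> ` {..<r} \<subseteq> {..<n} \<and> (\<forall>i\<ge>r. \<sigma> i = 0)}"

definition pairprod :: "(nat \<Rightarrow> nat \<Rightarrow> 'a::comm_ring_1 ser) \<Rightarrow> nat \<Rightarrow> (nat \<times> nat) set \<Rightarrow> 'a ser" where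
  "pairprod F n S = sprod_set (\<lambda>p. sprod_set (\<lambda>q. if (p, q) \<in> S then F p q else sone) {..<n}) {..<n}"

definition offdiag :: "nat \<Rightarrow> (nat \<times> nat) set" where
  "offdiag n = {(p, q). p < n \<and> q < n \<and> p \<noteq> q}"

text \<open>Denominator pairs of the term indexed by sigma: (sigma i, j) with j not in sigma{0..i}.\<close>
definition dset :: "nat \<Rightarrow> nat \<Rightarrow> (nat \<Rightarrow> nat) \<Rightarrow> (nat \<times> nat) set" where
  "dset n r \<sigma> = {(\<sigma> i, j) | i j. i < r \<and> j < n \<and> j \<notin> \<sigma> ` {..i}}"

text \<open>Numerator of the sigma-term after multiplication by the common denominator
  D = prod_{p <> q} (x_p +_L xbar_q).\<close>
definition qnum :: "(nat \<Rightarrow> nat \<Rightarrow> 'a::comm_ring_1) \<Rightarrow> nat \<Rightarrow> nat list \<Rightarrow> (nat \<Rightarrow> nat) \<Rightarrow> 'a ser" where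
  "qnum a n \<nu> \<sigma> = smult
     (sprod_set (\<lambda>i. smult (bracket a (xvar (\<sigma> i)) (\<nu> ! i))
        (sprod_set (\<lambda>j. Fsub a (xvar (\<sigma> i)) (xvar j)) ({..<n} - \<sigma> ` {..i}))) {..<length \<nu>})
     (pairprod (\<lambda>p q. Fsub a (xvar p) (xbar a q)) n (offdiag n - dset n (length \<nu>) \<sigma>))"

definition qden :: "(nat \<Rightarrow> nat \<Rightarrow> 'a::comm_ring_1) \<Rightarrow> nat \<Rightarrow> 'a ser" where
  "qden a n = pairprod (\<lambda>p q. Fsub a (xvar p) (xbar a q)) n (offdiag n)"

text \<open>Q^L_nu(x_1..x_n): the power series (no u-dependence) equal to the sum of fractions,
  i.e. the unique q with q * D = sum_sigma (numerator of sigma-term).\<close>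
definition QL :: "(nat \<Rightarrow> nat \<Rightarrow> 'a::comm_ring_1) \<Rightarrow> nat \<Rightarrow> nat list \<Rightarrow> 'a ser" where
  "QL a n \<nu> = (THE q. wf_ser q \<and> (\<forall>\<alpha> e. e \<noteq> (\<lambda>_. 0) \<longrightarrow> q \<alpha> e = 0) \<and>
      smult q (qden a n) = Finite_Set.fold (\<lambda>\<sigma> acc. sadd (qnum a n \<nu> \<sigma>) acc) szero (injs n (length \<nu>)))"

end

(*
Take the coefficients of u_1, u_2, ... one after the other. As a series in the most significant
variable u = u_1 the generating function is N(u) / prod_j (u - x_j) with N a power series in u.
Partial fractions and [u^(-k)] N(u) / (u - x) = N(x) x^(k-1) turn its coefficient of u^(-k)
into a sum over the x_s of residues at u = x_s. At u = x_s the factor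
(u_j +_L ubar) / (u_j +_L u) becomes (u_j +_L xbar_s) / (u_j +_L x_s) and cancels x_s from the
remaining generating function, so iterating yields the sum over injections that defines Q.

The residue is computed from the group law: u = x +_L (u +_L xbar) gives
u - x = (u +_L xbar) beta(x, u +_L xbar) where F(x, v) = x + v beta(x, v), and at u = x the last
factor is beta(x, 0) = P(x), which the factor 1/P(u) compensates.

Since the residues satisfy the equation that defines QL after multiplication by the common
denominator, the divisibility implicit in that definition comes for free.
*)
theory Submission
  imports Defs "HOL-Library.Function_Algebras" "HOL-Library.Product_Plus"
begin

subsection \<open>Well-ordered sets of exponents\<close>

text \<open>The series satisfying \<open>wf_ser\<close> are packed into a ring type
  \<open>hser\<close>; there an exhibited solution, together with a uniqueness argument, pins each
  described object down. Infinite sums are controlled by the total degree, x and u both having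
  weight 1: series that agree up to every order are equal. Apart from P(u), every denominator of the
  generating function is \<open>U j - B\<close> up to an invertible power series, and the expansion
  of \<open>1 / (U j - B)\<close> is the only source of negative exponents. In 1 / (u_j +_L u_i)
  with i < j these fall on u_j alone. Hence the most significant variable goes first: its only poles
  are the x's, and all other factors can be evaluated there. No field of fractions is formed.
  Identities are multiplied by the common denominator, partial fractions are stated without
  division, and cancelling rests on x_p - x_q not being a zero divisor, which is read off from
  coefficients over any commutative ring.\<close>

lemma lexless_irrefl [simp]: "\<not> lexless e e"
  by (simp add: lexless_def)

lemma lexless_trans: "lexless d e \<Longrightarrow> lexless e f \<Longrightarrow> lexless d f"
proof -
  assume "lexless d e" "lexless e f"
  then obtain k l where k: "d k < e k" "\<forall>i<k. d i = e i" and l: "e l < f l" "\<forall>i<l. e i = f i"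
    by (auto simp: lexless_def)
  show ?thesis
    unfolding lexless_def
    by (rule exI[of _ "min k l"]) (use k l in \<open>cases k l rule: linorder_cases; auto simp: min_def\<close>)
qed

lemma lexless_total: "d \<noteq> e \<Longrightarrow> lexless d e \<or> lexless e d"
proof -
  assume "d \<noteq> e"
  then have ex: "\<exists>k. d k \<noteq> e k" by auto
  define k where "k = (LEAST k. d k \<noteq> e k)"
  have "d k \<noteq> e k" unfolding k_def using ex by (rule LeastI_ex)
  moreover have "\<forall>i<k. d i = e i" unfolding k_def using not_less_Least by blast
  ultimately show ?thesis unfolding lexless_def by (metis linorder_neqE)
qed

lemma lexless_add_right [simp]: "lexless (d + f) (e + f) \<longleftrightarrow> lexless d e"
  by (simp add: lexless_def)

lemma lexless_add_left [simp]: "lexless (f + d) (f + e) \<longleftrightarrow> lexless d e"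
  by (simp add: lexless_def)

lemma lexless_diff_left: "lexless (f - d) (f - e) \<longleftrightarrow> lexless e d"
  unfolding lexless_def by (intro ex_cong1) auto

lemma lexless_add_mono: "\<not> lexless d' d \<Longrightarrow> \<not> lexless e' e \<Longrightarrow> \<not> lexless (d' + e') (d + e)"
proof
  assume *: "\<not> lexless d' d" "\<not> lexless e' e" and l: "lexless (d' + e') (d + e)"
  have "d = d' \<or> lexless d d'" using * lexless_total by blast
  moreover have "e = e' \<or> lexless e e'" using * lexless_total by blast
  ultimately show False
    using l * by (metis lexless_add_left lexless_add_right lexless_trans lexless_irrefl)
qed

lemma lex_wo_subset: "lex_wo S \<Longrightarrow> T \<subseteq> S \<Longrightarrow> lex_wo T"
  by (auto simp: lex_wo_def)

lemma lex_woD: "lex_wo S \<Longrightarrow> T \<subseteq> S \<Longrightarrow> T \<noteq> {} \<Longrightarrow> \<exists>m\<in>T. \<forall>t\<in>T. \<not> lexless t m"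
  by (auto simp: lex_wo_def)

lemma lex_wo_Un: assumes "lex_wo S" "lex_wo T" shows "lex_wo (S \<union> T)"
  unfolding lex_wo_def
proof (intro allI impI)
  fix U assume U: "U \<subseteq> S \<union> T" "U \<noteq> {}"
  show "\<exists>m\<in>U. \<forall>t\<in>U. \<not> lexless t m"
  proof (cases "U \<inter> S = {} \<or> U \<inter> T = {}")
    case True
    then have "U \<subseteq> S \<or> U \<subseteq> T" using U by auto
    then show ?thesis using lex_woD assms U by metis
  next
    case False
    obtain m where m: "m \<in> U \<inter> S" "\<forall>t\<in>U \<inter> S. \<not> lexless t m" using lex_woD[OF assms(1), of "U \<inter> S"] False by auto
    obtain k where k: "k \<in> U \<inter> T" "\<forall>t\<in>U \<inter> T. \<not> lexless t k" using lex_woD[OF assms(2), of "U \<inter> T"] False by auto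
    show ?thesis
    proof (cases "lexless k m")
      case True
      then have "\<forall>t\<in>U. \<not> lexless t k" using U m k lexless_trans by blast
      then show ?thesis using k by auto
    next
      case False
      then have "\<forall>t\<in>U. \<not> lexless t m" using U m k lexless_trans lexless_total by (metis Int_iff UnE subsetD)
      then show ?thesis using m by auto
    qed
  qed
qed

lemma lex_wo_empty [simp]: "lex_wo {}" by (simp add: lex_wo_def)

lemma lex_wo_singleton [simp]: "lex_wo {a}"
  by (auto simp: lex_wo_def subset_singleton_iff)

lemma lex_wo_UN: "finite I \<Longrightarrow> (\<And>i. i \<in> I \<Longrightarrow> lex_wo (S i)) \<Longrightarrow> lex_wo (\<Union>i\<in>I. S i)"
  by (induction rule: finite_induct) (auto intro: lex_wo_Un)

text \<open>Well-ordered for both the order and its converse implies finite: if some element had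
  infinitely many elements below it, the least such element would have a predecessor of that kind.\<close>
lemma lex_wo_finite:
  assumes "lex_wo S" and max: "\<And>T. T \<subseteq> S \<Longrightarrow> T \<noteq> {} \<Longrightarrow> \<exists>m\<in>T. \<forall>t\<in>T. \<not> lexless m t"
  shows "finite S"
proof -
  let ?B = "\<lambda>m. {q\<in>S. lexless q m}"
  have fin: "finite (?B m)" if "m \<in> S" for m
  proof (rule ccontr)
    assume "infinite (?B m)"
    then have "{m\<in>S. infinite (?B m)} \<noteq> {}" using that by auto
    then obtain m where m: "m \<in> S" "infinite (?B m)" and
      mm: "\<And>t. t \<in> S \<Longrightarrow> infinite (?B t) \<Longrightarrow> \<not> lexless t m"
      using lex_woD[OF assms(1), of "{m\<in>S. infinite (?B m)}"] by auto
    have "?B m \<noteq> {}" using m by (metis finite.emptyI)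
    then obtain q where q: "q \<in> ?B m" "\<forall>t\<in>?B m. \<not> lexless q t" using max[of "?B m"] by auto
    have "?B m \<subseteq> insert q (?B q)" using q lexless_total by auto
    then have "infinite (?B q)" using m finite_subset by blast
    then show False using mm q by auto
  qed
  show ?thesis
  proof (cases "S = {}")
    case False
    then obtain m where m: "m \<in> S" "\<forall>t\<in>S. \<not> lexless m t" using max[of S] by auto
    have "S \<subseteq> insert m (?B m)" using m lexless_total by auto
    then show ?thesis using fin[OF m(1)] finite_subset by blast
  qed simp
qed

text \<open>The reflection of \<open>p\<close> to \<open>e - p\<close> reverses
  \<open>lexless\<close>, so minima in \<open>T\<close> become maxima in the fibre and
  \<open>lex_wo_finite\<close> applies. This makes the inner sums of \<open>smult\<close>
  finite.\<close>

lemma lex_wo_fiber_finite: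
  assumes "lex_wo S" "lex_wo T"
  shows "finite {p \<in> S. e - p \<in> T}"
proof (rule lex_wo_finite)
  show "lex_wo {p \<in> S. e - p \<in> T}" by (rule lex_wo_subset[OF assms(1)]) auto
  fix U assume U: "U \<subseteq> {p \<in> S. e - p \<in> T}" "U \<noteq> {}"
  then obtain m where m: "m \<in> (\<lambda>p. e - p) ` U" "\<forall>t\<in>(\<lambda>p. e - p) ` U. \<not> lexless t m"
    using lex_woD[OF assms(2), of "(\<lambda>p. e - p) ` U"] by blast
  then obtain p where p: "p \<in> U" "m = e - p" by auto
  then show "\<exists>m\<in>U. \<forall>t\<in>U. \<not> lexless m t"
    using m by (intro bexI[of _ p]) (auto simp: lexless_diff_left)
qed

text \<open>For \<open>p \<in> S\<close> let \<open>q p\<close> be the least \<open>q \<in> T\<close> with \<open>p + q\<close> in the given set. An index \<open>p\<close> is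
  called good if every \<open>p'\<close> with \<open>p' + q p' < p + q p\<close> lies below \<open>p\<close>; the least good \<open>p\<close>
  gives the minimum.\<close>
lemma lex_wo_plus:
  assumes S: "lex_wo S" and T: "lex_wo T"
  shows "lex_wo {p + q | p q. p \<in> S \<and> q \<in> T}"
  unfolding lex_wo_def
proof (intro allI impI)
  fix U assume U: "U \<subseteq> {p + q | p q. p \<in> S \<and> q \<in> T}" "U \<noteq> {}"
  define A where "A = {p\<in>S. \<exists>q\<in>T. p + q \<in> U}"
  have "\<forall>p\<in>A. \<exists>q\<in>T. p + q \<in> U \<and> (\<forall>q'\<in>T. p + q' \<in> U \<longrightarrow> \<not> lexless q' q)"
  proof
    fix p assume "p \<in> A"
    then have "{q\<in>T. p + q \<in> U} \<noteq> {}" by (auto simp: A_def)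
    then show "\<exists>q\<in>T. p + q \<in> U \<and> (\<forall>q'\<in>T. p + q' \<in> U \<longrightarrow> \<not> lexless q' q)"
      using lex_woD[OF T, of "{q\<in>T. p + q \<in> U}"] by auto
  qed
  then obtain q where q: "\<And>p. p \<in> A \<Longrightarrow> q p \<in> T \<and> p + q p \<in> U \<and> (\<forall>q'\<in>T. p + q' \<in> U \<longrightarrow> \<not> lexless q' (q p))"
    by metis
  have sel: "\<exists>p\<in>B. \<forall>p'\<in>B. \<not> lexless (q p') (q p)" if "B \<subseteq> A" "B \<noteq> {}" for B
    using lex_woD[OF T, of "q ` B"] that q by (auto simp: image_subset_iff subset_iff)
  have low: "lexless p' p" if "lexless (p' + q p') (p + q p)" "\<not> lexless (q p') (q p)" for p p'
    using that lexless_add_mono by blast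
  define R where "R = {p\<in>A. \<forall>p'\<in>A. lexless (p' + q p') (p + q p) \<longrightarrow> lexless p' p}"
  have "A \<noteq> {}" using U by (auto simp: A_def)
  then obtain p1 where p1: "p1 \<in> A" "\<And>p'. p' \<in> A \<Longrightarrow> \<not> lexless (q p') (q p1)" using sel[of A] by auto
  \<comment> \<open>Good indices exist: where \<open>q\<close> is least, \<open>low\<close> turns
    every smaller sum into a smaller index.\<close>
  have "p1 \<in> R" unfolding R_def using low[OF _ p1(2)] p1(1) by simp
  moreover have RS: "R \<subseteq> S" by (auto simp: R_def A_def)
  ultimately obtain p where p: "p \<in> R" "\<forall>p'\<in>R. \<not> lexless p' p"
    using lex_woD[OF S RS] by auto
  have pA: "p \<in> A" using p by (auto simp: R_def)
  define A' where "A' = {p'\<in>A. lexless (p' + q p') (p + q p)}"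
  \<comment> \<open>Otherwise the member of \<open>A'\<close> with least \<open>q\<close> is again
    good, and goodness of \<open>p\<close> puts it below \<open>p\<close>, against the choice of
    \<open>p\<close>.\<close>
  have "A' = {}"
  proof (rule ccontr)
    assume "A' \<noteq> {}"
    then obtain p2 where p2: "p2 \<in> A'" "\<forall>p'\<in>A'. \<not> lexless (q p') (q p2)"
      using sel[of A'] by (auto simp: A'_def)
    have "p2 \<in> R" unfolding R_def
  proof (intro CollectI conjI ballI impI)
    show "p2 \<in> A" using p2 by (auto simp: A'_def)
    fix p' assume p': "p' \<in> A" "lexless (p' + q p') (p2 + q p2)"
    then have "p' \<in> A'" using p2(1) lexless_trans unfolding A'_def by (metis (mono_tags, lifting) mem_Collect_eq)
    then show "lexless p' p2" using low[OF p'(2)] p2(2) by simp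
  qed
    moreover have "lexless p2 p" using p2(1) p(1) by (auto simp: A'_def R_def)
    ultimately show False using p by auto
  qed
  have "\<not> lexless t (p + q p)" if tU: "t \<in> U" for t
  proof
    assume l: "lexless t (p + q p)"
    obtain p' q' where t: "t = p' + q'" "p' \<in> S" "q' \<in> T" using subsetD[OF U(1) tU] by auto
    then have "p' \<in> A" using that by (auto simp: A_def)
    moreover then have "\<not> lexless t (p' + q p')" using q[of p'] t that by auto
    ultimately have "p' \<in> A'" using l lexless_total[of t "p' + q p'"] lexless_trans[of "p' + q p'" t] unfolding A'_def by auto
    then show False using \<open>A' = {}\<close> by auto
  qed
  then show "\<exists>m\<in>U. \<forall>t\<in>U. \<not> lexless t m" using q[OF pA] by auto
qed

text \<open>Coordinatewise descent: minimise the coordinates one after the other.\<close>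
lemma lex_wo_bounded:
  fixes b :: "nat \<Rightarrow> (nat \<Rightarrow> int) \<Rightarrow> int"
  assumes zero: "\<And>e i. e \<in> S \<Longrightarrow> N \<le> i \<Longrightarrow> e i = 0"
    and bd: "\<And>e i. e \<in> S \<Longrightarrow> i < N \<Longrightarrow> b i e \<le> e i"
    and dep: "\<And>d e i. d \<in> S \<Longrightarrow> e \<in> S \<Longrightarrow> (\<And>j. j < i \<Longrightarrow> d j = e j) \<Longrightarrow> b i d = b i e"
  shows "lex_wo S"
  unfolding lex_wo_def
proof (intro allI impI)
  fix T assume T: "T \<subseteq> S" "T \<noteq> {}"
  \<comment> \<open>Invariant of the descent: whatever lies below \<open>m\<close> agrees with it in
    the first \<open>k\<close> coordinates. At \<open>k = N\<close> it must be \<open>m\<close>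
    itself.\<close>
  have "\<exists>m\<in>T. \<forall>t\<in>T. \<not> lexless t m \<or> (\<forall>i<k. t i = m i)" if "k \<le> N" for k
    using that
  proof (induction k)
    case 0
    then show ?case using T by auto
  next
    case (Suc k)
    then obtain m where m: "m \<in> T" "\<And>t. t \<in> T \<Longrightarrow> \<not> lexless t m \<or> (\<forall>i<k. t i = m i)" by auto
    define T' where "T' = {t\<in>T. \<forall>i<k. t i = m i}"
    have mT': "m \<in> T'" using m by (auto simp: T'_def)
    \<comment> \<open>The bound depends only on the coordinates before \<open>k\<close>, which are
      constant on \<open>T'\<close>. So coordinate \<open>k\<close> is bounded below there and
      attains a minimum.\<close>
    have "b k m \<le> t k" if "t \<in> T'" for t
    proof -
      have "b k m = b k t" using that T m(1) by (intro dep) (auto simp: T'_def)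
      then show ?thesis using bd[of t k] that T Suc.prems by (auto simp: T'_def)
    qed
    then have ge: "\<And>t. t \<in> T' \<Longrightarrow> 0 \<le> t k - b k m" by auto
    obtain m' where m': "m' \<in> T'" "\<And>t. t \<in> T' \<Longrightarrow> nat (m' k - b k m) \<le> nat (t k - b k m)"
      using ex_has_least_nat[of "\<lambda>t. t \<in> T'" m "\<lambda>t. nat (t k - b k m)"] mT' by auto
    have le: "m' k \<le> t k" if "t \<in> T'" for t
      using m'(2)[OF that] ge[OF that] ge[OF m'(1)] by linarith
    show ?case
    proof (intro bexI[of _ m'] ballI)
      fix t assume t: "t \<in> T"
      show "\<not> lexless t m' \<or> (\<forall>i<Suc k. t i = m' i)"
      proof (cases "t \<in> T'")
        case True
        show ?thesis
        proof (cases "t k = m' k")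
          case True
          then show ?thesis using \<open>t \<in> T'\<close> m' by (auto simp: T'_def less_Suc_eq)
        next
          case False
          then have gt: "m' k < t k" using le[OF True] by auto
          have "lexless m' t" unfolding lexless_def
            using gt True m' by (intro exI[of _ k]) (auto simp: T'_def)
          then show ?thesis using lexless_trans lexless_irrefl by blast
        qed
      next
        case False
        then have "\<not> lexless t m" "t \<noteq> m" using m(2)[OF t] t mT' by (auto simp: T'_def)
        then have "lexless m t" using lexless_total by blast
        then obtain l where l: "m l < t l" "\<forall>i<l. m i = t i" by (auto simp: lexless_def)
        have "l < k" using False t l by (auto simp: T'_def) (metis linorder_not_less order_less_le_trans)
        then have "lexless m' t" unfolding lexless_def
          using l m' by (intro exI[of _ l]) (auto simp: T'_def)
        then show ?thesis using lexless_trans lexless_irrefl by blast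
      qed
    qed (use m' in \<open>auto simp: T'_def\<close>)
  qed
  from this[of N] obtain m where m: "m \<in> T" "\<And>t. t \<in> T \<Longrightarrow> \<not> lexless t m \<or> (\<forall>i<N. t i = m i)" by auto
  have "t = m" if "t \<in> T" "\<forall>i<N. t i = m i" for t
  proof
    fix i show "t i = m i" using that zero[of t i] zero[of m i] subsetD[OF T(1)] m(1) by (cases "i < N") auto
  qed
  then show "\<exists>m\<in>T. \<forall>t\<in>T. \<not> lexless t m" using m by (metis lexless_irrefl)
qed

subsection \<open>The ring of well-supported series\<close>

type_synonym expo = "(nat \<Rightarrow> nat) \<times> (nat \<Rightarrow> int)"

definition wfset :: "expo set \<Rightarrow> bool" where
  "wfset S \<longleftrightarrow> (\<forall>\<alpha> e. (\<alpha>, e) \<in> S \<longrightarrow> finite {i. \<alpha> i \<noteq> 0} \<and> finite {i. e i \<noteq> 0})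
     \<and> (\<forall>\<alpha>. lex_wo {e. (\<alpha>, e) \<in> S})"

definition supp :: "'a::zero ser \<Rightarrow> expo set" where
  "supp f = {(\<alpha>, e). f \<alpha> e \<noteq> 0}"

definition ap :: "'a ser \<Rightarrow> expo \<Rightarrow> 'a" where
  "ap f m = f (fst m) (snd m)"

definition dec :: "expo set \<Rightarrow> expo set \<Rightarrow> expo \<Rightarrow> (expo \<times> expo) set" where
  "dec S T m = {(a, b). a \<in> S \<and> b \<in> T \<and> a + b = m}"

definition splus :: "expo set \<Rightarrow> expo set \<Rightarrow> expo set" where
  "splus S T = {a + b | a b. a \<in> S \<and> b \<in> T}"

lemma wf_ser_iff: "wf_ser f \<longleftrightarrow> wfset (supp f)"
  by (auto simp: wf_ser_def wfset_def supp_def)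

lemma wfset_subset: "wfset S \<Longrightarrow> T \<subseteq> S \<Longrightarrow> wfset T"
  unfolding wfset_def
  by (intro conjI allI impI; (blast | (rule lex_wo_subset, (elim conjE, erule spec), blast)))

lemma wfset_Un: "wfset S \<Longrightarrow> wfset T \<Longrightarrow> wfset (S \<union> T)"
  unfolding wfset_def by (auto simp: Collect_disj_eq intro: lex_wo_Un)

lemma finite_le_fun:
  fixes \<alpha> :: "nat \<Rightarrow> nat"
  assumes "finite {i. \<alpha> i \<noteq> 0}"
  shows "finite {\<beta>. \<forall>i. \<beta> i \<le> \<alpha> i}"
proof -
  let ?A = "{i. \<alpha> i \<noteq> 0}"
  have "{\<beta>. \<forall>i. \<beta> i \<le> \<alpha> i} \<subseteq> {f. \<forall>x. (x \<in> ?A \<longrightarrow> f x \<in> {..sum \<alpha> ?A}) \<and> (x \<notin> ?A \<longrightarrow> f x = 0)}"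
    using member_le_sum[of _ ?A \<alpha>] assms by (auto intro: order_trans) (metis le_zero_eq)
  then show ?thesis using finite_set_of_finite_funs[OF assms, of "{..sum \<alpha> ?A}" 0] finite_subset by blast
qed

text \<open>For \<open>\<alpha>\<close> of infinite support the outer sum of \<open>smult\<close>
  runs over an infinite set and is 0 by convention, in agreement with the absence of decompositions
  of such an exponent.\<close>

lemma infinite_le_fun:
  fixes \<alpha> :: "nat \<Rightarrow> nat"
  assumes "infinite {i. \<alpha> i \<noteq> 0}"
  shows "infinite {\<beta>. \<forall>i. \<beta> i \<le> \<alpha> i}"
proof
  assume "finite {\<beta>. \<forall>i. \<beta> i \<le> \<alpha> i}"
  moreover have "(\<lambda>k i. if i = k then \<alpha> k else 0) ` {i. \<alpha> i \<noteq> 0} \<subseteq> {\<beta>. \<forall>i. \<beta> i \<le> \<alpha> i}" by auto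
  ultimately have "finite ((\<lambda>k i. if i = k then \<alpha> k else 0) ` {i. \<alpha> i \<noteq> 0})" using finite_subset by blast
  moreover have "inj_on (\<lambda>k i. if i = k then \<alpha> k else 0) {i. \<alpha> i \<noteq> 0}"
    by (rule inj_onI) (metis (mono_tags, lifting) mem_Collect_eq)
  ultimately show False using assms finite_imageD by blast
qed

lemma add_le_fun: "\<beta> + \<gamma> = (\<alpha>::nat \<Rightarrow> nat) \<longleftrightarrow> (\<forall>i. \<beta> i \<le> \<alpha> i) \<and> \<gamma> = \<alpha> - \<beta>"
proof
  assume "\<beta> + \<gamma> = \<alpha>"
  then have "\<alpha> = (\<lambda>i. \<beta> i + \<gamma> i)" by (simp add: plus_fun_def)
  then show "(\<forall>i. \<beta> i \<le> \<alpha> i) \<and> \<gamma> = \<alpha> - \<beta>" by (simp add: fun_eq_iff)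
qed (simp add: fun_eq_iff)

text \<open>An exponent \<open>\<alpha>\<close> of finite support splits in finitely many ways, and
  each splitting contributes a sum of two well-ordered sets.\<close>

lemma wfset_plus: assumes "wfset S" "wfset T" shows "wfset (splus S T)"
  unfolding wfset_def
proof (intro conjI allI impI)
  fix \<alpha> e assume "(\<alpha>, e) \<in> splus S T"
  then obtain \<beta> p \<gamma> q where *: "(\<beta>, p) \<in> S" "(\<gamma>, q) \<in> T" "\<alpha> = \<beta> + \<gamma>" "e = p + q" by (auto simp: splus_def)
  have fin: "finite ({i. \<beta> i \<noteq> 0} \<union> {i. \<gamma> i \<noteq> 0})" "finite ({i. p i \<noteq> 0} \<union> {i. q i \<noteq> 0})"
    using * assms unfolding wfset_def by blast+
  show "finite {i. \<alpha> i \<noteq> 0}"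
    by (rule finite_subset[OF _ fin(1)]) (auto simp: *)
  show "finite {i. e i \<noteq> 0}"
    by (rule finite_subset[OF _ fin(2)]) (auto simp: *)
next
  fix \<alpha>
  show "lex_wo {e. (\<alpha>, e) \<in> splus S T}"
  proof (cases "finite {i. \<alpha> i \<noteq> 0}")
    case True
    have "lex_wo (\<Union>\<beta>\<in>{\<beta>. \<forall>i. \<beta> i \<le> \<alpha> i}. {p + q | p q. p \<in> {p. (\<beta>, p) \<in> S} \<and> q \<in> {q. (\<alpha> - \<beta>, q) \<in> T}})"
      by (intro lex_wo_UN finite_le_fun True lex_wo_plus) (use assms in \<open>auto simp: wfset_def\<close>)
    then show ?thesis
    proof (rule lex_wo_subset, intro subsetI)
      fix e assume "e \<in> {e. (\<alpha>, e) \<in> splus S T}"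
      then obtain \<beta> p \<gamma> q where *: "(\<beta>, p) \<in> S" "(\<gamma>, q) \<in> T" "\<beta> + \<gamma> = \<alpha>" "e = p + q"
        by (auto simp: splus_def)
      then have "(\<forall>i. \<beta> i \<le> \<alpha> i) \<and> \<gamma> = \<alpha> - \<beta>" using add_le_fun by blast
      then show "e \<in> (\<Union>\<beta>\<in>{\<beta>. \<forall>i. \<beta> i \<le> \<alpha> i}. {p + q | p q. p \<in> {p. (\<beta>, p) \<in> S} \<and> q \<in> {q. (\<alpha> - \<beta>, q) \<in> T}})"
        using * by (intro UN_I[of \<beta>]) auto
    qed
  next
    case False
    have "{e. (\<alpha>, e) \<in> splus S T} = {}"
    proof (rule ccontr)
      assume "{e. (\<alpha>, e) \<in> splus S T} \<noteq> {}"
      then obtain \<beta> p \<gamma> q where *: "(\<beta>, p) \<in> S" "(\<gamma>, q) \<in> T" "\<alpha> = \<beta> + \<gamma>" by (auto simp: splus_def)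
      have fin: "finite ({i. \<beta> i \<noteq> 0} \<union> {i. \<gamma> i \<noteq> 0})" using * assms unfolding wfset_def by blast
      have "finite {i. \<alpha> i \<noteq> 0}" by (rule finite_subset[OF _ fin]) (auto simp: *)
      then show False using False by simp
    qed
    then show ?thesis by simp
  qed
qed

lemma finite_dec: assumes "wfset S" "wfset T" shows "finite (dec S T m)"
proof (cases m)
  case (Pair \<alpha> e)
  show ?thesis
  proof (cases "finite {i. \<alpha> i \<noteq> 0}")
    case True
    have "dec S T m \<subseteq> (\<lambda>(\<beta>, p). ((\<beta>, p), (\<alpha> - \<beta>, e - p))) `
        (SIGMA \<beta>:{\<beta>. \<forall>i. \<beta> i \<le> \<alpha> i}. {p \<in> {p. (\<beta>, p) \<in> S}. e - p \<in> {q. (\<alpha> - \<beta>, q) \<in> T}})"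
    proof
      fix x assume "x \<in> dec S T m"
      then obtain \<beta> p \<gamma> q where *: "x = ((\<beta>, p), (\<gamma>, q))" "(\<beta>, p) \<in> S" "(\<gamma>, q) \<in> T" "\<beta> + \<gamma> = \<alpha>" "p + q = e"
        by (auto simp: dec_def Pair)
      have g: "\<gamma> = \<alpha> - \<beta>" "q = e - p" "\<forall>i. \<beta> i \<le> \<alpha> i" using *(4) *(5) add_le_fun by auto
      show "x \<in> (\<lambda>(\<beta>, p). ((\<beta>, p), (\<alpha> - \<beta>, e - p))) `
        (SIGMA \<beta>:{\<beta>. \<forall>i. \<beta> i \<le> \<alpha> i}. {p \<in> {p. (\<beta>, p) \<in> S}. e - p \<in> {q. (\<alpha> - \<beta>, q) \<in> T}})"
        by (rule image_eqI[of _ _ "(\<beta>, p)"]) (use * g in auto)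
    qed
    moreover have "finite (SIGMA \<beta>:{\<beta>. \<forall>i. \<beta> i \<le> \<alpha> i}. {p \<in> {p. (\<beta>, p) \<in> S}. e - p \<in> {q. (\<alpha> - \<beta>, q) \<in> T}})"
      by (intro finite_SigmaI finite_le_fun True lex_wo_fiber_finite) (use assms in \<open>auto simp: wfset_def\<close>)
    ultimately show ?thesis using finite_subset by blast
  next
    case False
    have "dec S T m = {}"
    proof (rule ccontr)
      assume "dec S T m \<noteq> {}"
      then obtain \<beta> p \<gamma> q where *: "(\<beta>, p) \<in> S" "(\<gamma>, q) \<in> T" "\<beta> + \<gamma> = \<alpha>" by (auto simp: dec_def Pair)
      then have "(\<alpha>, p + q) \<in> splus S T" by (auto simp: splus_def)
      then show False using wfset_plus[OF assms] False by (auto simp: wfset_def)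
    qed
    then show ?thesis by simp
  qed
qed

text \<open>The defining double sum runs over exact supports, which change under addition and
  multiplication. Allowing any well-supported supersets gives all terms of a ring identity a common
  index set.\<close>

lemma smult_dec:
  assumes "wfset S" "wfset T" "supp f \<subseteq> S" "supp g \<subseteq> T"
  shows "smult f g (fst m) (snd m) = (\<Sum>(a, b)\<in>dec S T m. ap f a * ap g b)"
proof -
  obtain \<alpha> e where m: "m = (\<alpha>, e)" by force
  have wf: "wfset (supp f)" "wfset (supp g)" using assms wfset_subset by blast+
  have fin: "finite (dec (supp f) (supp g) m)" "finite (dec S T m)" using finite_dec assms wf by blast+
  have "(\<Sum>(a, b)\<in>dec S T m. ap f a * ap g b) = (\<Sum>(a, b)\<in>dec (supp f) (supp g) m. ap f a * ap g b)"
    by (rule sum.mono_neutral_right) (use assms fin in \<open>auto simp: dec_def supp_def ap_def\<close>)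
  also have "\<dots> = smult f g \<alpha> e"
  proof (cases "finite {i. \<alpha> i \<noteq> 0}")
    case True
    let ?P = "\<lambda>\<beta>. {p. f \<beta> p \<noteq> 0 \<and> g (\<lambda>i. \<alpha> i - \<beta> i) (\<lambda>i. e i - p i) \<noteq> 0}"
    have P: "finite (?P \<beta>)" for \<beta>
    proof -
      have "?P \<beta> = {p \<in> {p. (\<beta>, p) \<in> supp f}. e - p \<in> {q. (\<alpha> - \<beta>, q) \<in> supp g}}"
        by (auto simp: supp_def fun_diff_def)
      moreover have "lex_wo {p. (\<beta>, p) \<in> supp f}" "lex_wo {q. (\<alpha> - \<beta>, q) \<in> supp g}"
        using wf by (auto simp: wfset_def)
      ultimately show ?thesis
        using lex_wo_fiber_finite[of "{p. (\<beta>, p) \<in> supp f}" "{q. (\<alpha> - \<beta>, q) \<in> supp g}" e] by simp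
    qed
    have "smult f g \<alpha> e = (\<Sum>(\<beta>, p)\<in>(SIGMA \<beta>:{\<beta>. \<forall>i. \<beta> i \<le> \<alpha> i}. ?P \<beta>). f \<beta> p * g (\<alpha> - \<beta>) (e - p))"
      unfolding smult_def by (subst sum.Sigma[symmetric]) (use finite_le_fun[OF True] P in \<open>auto simp: fun_diff_def\<close>)
    also have "\<dots> = (\<Sum>(a, b)\<in>dec (supp f) (supp g) m. ap f a * ap g b)"
    proof (rule sum.reindex_bij_witness[where j = "\<lambda>(\<beta>, p). ((\<beta>, p), (\<alpha> - \<beta>, e - p))" and i = fst])
      fix x assume "x \<in> (SIGMA \<beta>:{\<beta>. \<forall>i. \<beta> i \<le> \<alpha> i}. ?P \<beta>)"
      then obtain \<beta> p where x: "x = (\<beta>, p)" "\<forall>i. \<beta> i \<le> \<alpha> i" "f \<beta> p \<noteq> 0" "g (\<alpha> - \<beta>) (e - p) \<noteq> 0"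
        by (auto simp: fun_diff_def)
      have "\<beta> + (\<alpha> - \<beta>) = \<alpha>" using x(2) add_le_fun by blast
      then show "(case x of (\<beta>, p) \<Rightarrow> ((\<beta>, p), (\<alpha> - \<beta>, e - p))) \<in> dec (supp f) (supp g) m"
        using x by (simp add: dec_def supp_def m)
    next
      fix y assume "y \<in> dec (supp f) (supp g) m"
      then obtain \<beta> p \<gamma> q where *: "y = ((\<beta>, p), (\<gamma>, q))" "f \<beta> p \<noteq> 0" "g \<gamma> q \<noteq> 0" "\<beta> + \<gamma> = \<alpha>" "p + q = e"
        by (auto simp: dec_def m supp_def)
      have g: "\<gamma> = \<alpha> - \<beta>" "q = e - p" "\<forall>i. \<beta> i \<le> \<alpha> i" using *(4) *(5) add_le_fun by auto
      show "(case fst y of (\<beta>, p) \<Rightarrow> ((\<beta>, p), (\<alpha> - \<beta>, e - p))) = y" using * g by simp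
      show "fst y \<in> (SIGMA \<beta>:{\<beta>. \<forall>i. \<beta> i \<le> \<alpha> i}. ?P \<beta>)"
        using *(1,2,3) g by (simp add: fun_diff_def)
    qed (auto simp: ap_def)
    finally show ?thesis ..
  next
    case False
    have "dec (supp f) (supp g) m = {}"
    proof (rule ccontr)
      assume "dec (supp f) (supp g) m \<noteq> {}"
      then obtain \<beta> p \<gamma> q where *: "(\<beta>, p) \<in> supp f" "(\<gamma>, q) \<in> supp g" "\<beta> + \<gamma> = \<alpha>" by (auto simp: dec_def m)
      then have "(\<alpha>, p + q) \<in> splus (supp f) (supp g)" by (auto simp: splus_def)
      then show False using wfset_plus[OF wf] False by (auto simp: wfset_def)
    qed
    moreover have "smult f g \<alpha> e = 0" using infinite_le_fun[OF False] by (simp add: smult_def)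
    ultimately show ?thesis by simp
  qed
  finally show ?thesis by (simp add: m)
qed

lemma supp_smult: assumes "wf_ser f" "wf_ser g" shows "supp (smult f g) \<subseteq> splus (supp f) (supp g)"
proof
  fix x assume "x \<in> supp (smult f g)"
  then have "smult f g (fst x) (snd x) \<noteq> 0" by (auto simp: supp_def)
  then have "dec (supp f) (supp g) x \<noteq> {}"
    using smult_dec[of "supp f" "supp g" f g x] assms by (auto simp: wf_ser_iff)
  then show "x \<in> splus (supp f) (supp g)" by (auto simp: dec_def splus_def)
qed

lemma wf_smult: "wf_ser f \<Longrightarrow> wf_ser g \<Longrightarrow> wf_ser (smult f g)"
  unfolding wf_ser_iff[of "smult f g"]
  by (rule wfset_subset[OF _ supp_smult]) (simp_all add: wfset_plus wf_ser_iff)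

lemma ser_eqI: "(\<And>m. f (fst m) (snd m) = g (fst m) (snd m)) \<Longrightarrow> f = (g :: 'a ser)"
  by (intro ext) (metis fst_conv snd_conv)

lemma smult_assoc:
  assumes "wf_ser f" "wf_ser g" "wf_ser h"
  shows "smult (smult f g) h = smult f (smult g h)"
proof (rule ser_eqI)
  fix m
  note wf = assms[unfolded wf_ser_iff]
  let ?S = "supp f" and ?T = "supp g" and ?U = "supp h"
  have fin: "finite (dec (splus ?S ?T) ?U m)" "finite (dec ?S ?T s)" "finite (dec ?S (splus ?T ?U) m)" "finite (dec ?T ?U s)" for s
    using finite_dec wf wfset_plus by blast+
  let ?X = "SIGMA x:dec (splus ?S ?T) ?U m. dec ?S ?T (fst x)"
  let ?Y = "SIGMA x:dec ?S (splus ?T ?U) m. dec ?T ?U (snd x)"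
  \<comment> \<open>Triples \<open>a\<close>, \<open>b\<close>, \<open>c\<close> are stored as
    \<open>((a + b, c), (a, b))\<close> on one side and as \<open>((a, b + c), (b, c))\<close> on
    the other; these maps regroup them.\<close>
  let ?j = "\<lambda>x :: (expo \<times> expo) \<times> expo \<times> expo. ((fst (snd x), snd (snd x) + snd (fst x)), snd (snd x), snd (fst x))"
  let ?i = "\<lambda>y :: (expo \<times> expo) \<times> expo \<times> expo. ((fst (fst y) + fst (snd y), snd (snd y)), fst (fst y), fst (snd y))"
  have "smult (smult f g) h (fst m) (snd m) = (\<Sum>(s, c)\<in>dec (splus ?S ?T) ?U m. ap (smult f g) s * ap h c)"
    by (rule smult_dec) (use wf wfset_plus supp_smult assms in blast)+
  also have "\<dots> = (\<Sum>x\<in>dec (splus ?S ?T) ?U m. \<Sum>y\<in>dec ?S ?T (fst x). ap f (fst y) * ap g (snd y) * ap h (snd x))"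
    by (rule sum.cong[OF refl]) (use wf in \<open>auto simp: ap_def[of "smult f g"] smult_dec[of ?S ?T] sum_distrib_right case_prod_beta\<close>)
  also have "\<dots> = (\<Sum>(x, y)\<in>?X. ap f (fst y) * ap g (snd y) * ap h (snd x))"
    by (rule sum.Sigma) (use fin in auto)
  also have "\<dots> = (\<Sum>(x, y)\<in>?Y. ap f (fst x) * ap g (fst y) * ap h (snd y))"
  proof (rule sum.reindex_bij_witness[where j = ?j and i = ?i])
    fix x assume "x \<in> ?X"
    then obtain a b c where x: "x = ((a + b, c), (a, b))" "a \<in> ?S" "b \<in> ?T" "c \<in> ?U" "a + b + c = m"
      unfolding dec_def splus_def by auto
    then have "a + (b + c) = m" by (simp only: add.assoc)
    moreover have "b + c \<in> splus ?T ?U" using x by (auto simp only: splus_def)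
    ultimately show "?j x \<in> ?Y"
      using x by (simp add: dec_def)
    show "?i (?j x) = x"
      using x by simp
    show "(case ?j x of (x, y) \<Rightarrow> ap f (fst x) * ap g (fst y) * ap h (snd y)) =
      (case x of (x, y) \<Rightarrow> ap f (fst y) * ap g (snd y) * ap h (snd x))"
      using x by simp
  next
    fix y assume "y \<in> ?Y"
    then obtain a b c where y: "y = ((a, b + c), (b, c))" "a \<in> ?S" "b \<in> ?T" "c \<in> ?U" "a + (b + c) = m"
      unfolding dec_def splus_def by auto
    then have "a + b + c = m" by (simp only: add.assoc)
    moreover have "a + b \<in> splus ?S ?T" using y by (auto simp only: splus_def)
    ultimately show "?i y \<in> ?X"
      using y by (simp add: dec_def)
    show "?j (?i y) = y"
      using y by simp
  qed
  also have "\<dots> = (\<Sum>x\<in>dec ?S (splus ?T ?U) m. \<Sum>y\<in>dec ?T ?U (snd x). ap f (fst x) * ap g (fst y) * ap h (snd y))"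
    by (rule sum.Sigma[symmetric]) (use fin in auto)
  also have "\<dots> = (\<Sum>(a, t)\<in>dec ?S (splus ?T ?U) m. ap f a * ap (smult g h) t)"
    by (rule sum.cong[OF refl]) (use wf in \<open>auto simp: ap_def[of "smult g h"] smult_dec[of ?T ?U] sum_distrib_left case_prod_beta mult.assoc\<close>)
  also have "\<dots> = smult f (smult g h) (fst m) (snd m)"
    by (rule smult_dec[symmetric]) (use wf wfset_plus supp_smult assms in blast)+
  finally show "smult (smult f g) h (fst m) (snd m) = smult f (smult g h) (fst m) (snd m)" .
qed

lemma smult_commute:
  assumes "wf_ser f" "wf_ser g"
  shows "smult f g = smult g f"
proof (rule ser_eqI)
  fix m
  note wf = assms[unfolded wf_ser_iff]
  have "(\<Sum>(a, b)\<in>dec (supp f) (supp g) m. ap f a * ap g b) = (\<Sum>(a, b)\<in>dec (supp g) (supp f) m. ap g a * ap f b)"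
    by (rule sum.reindex_bij_witness[where j = prod.swap and i = prod.swap]) (auto simp: dec_def add.commute mult.commute)
  then show "smult f g (fst m) (snd m) = smult g f (fst m) (snd m)"
    using wf smult_dec[of "supp f" "supp g" f g m] smult_dec[of "supp g" "supp f" g f m] by simp
qed

lemma supp_sadd: "supp (\<lambda>\<alpha> e. f \<alpha> e + g \<alpha> e :: 'a::comm_ring_1) \<subseteq> supp f \<union> supp g"
  by (auto simp: supp_def)

lemma wf_sadd: "wf_ser f \<Longrightarrow> wf_ser g \<Longrightarrow> wf_ser (sadd f g :: 'a::comm_ring_1 ser)"
  unfolding sadd_def wf_ser_iff using supp_sadd wfset_Un wfset_subset by blast

lemma wf_uminus: "wf_ser f \<Longrightarrow> wf_ser (\<lambda>\<alpha> e. - f \<alpha> e :: 'a::comm_ring_1)"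
  by (simp add: wf_ser_def)

lemma wf_szero: "wf_ser szero"
  by (auto simp: wf_ser_def szero_def)

lemma smult_sadd_distrib:
  assumes "wf_ser f" "wf_ser g" "wf_ser h"
  shows "smult (sadd f g) h = sadd (smult f h) (smult g h)"
proof (rule ser_eqI)
  fix m
  note wf = assms[unfolded wf_ser_iff]
  let ?S = "supp f \<union> supp g"
  have "smult (sadd f g) h (fst m) (snd m) = (\<Sum>(a, b)\<in>dec ?S (supp h) m. ap (sadd f g) a * ap h b)"
    by (rule smult_dec) (use wf wfset_Un in \<open>auto simp: supp_def sadd_def\<close>)
  also have "\<dots> = (\<Sum>(a, b)\<in>dec ?S (supp h) m. ap f a * ap h b) + (\<Sum>(a, b)\<in>dec ?S (supp h) m. ap g a * ap h b)"
    by (simp add: sum.distrib[symmetric] case_prod_beta ap_def sadd_def ring_distribs)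
  also have "(\<Sum>(a, b)\<in>dec ?S (supp h) m. ap f a * ap h b) = smult f h (fst m) (snd m)"
    by (rule smult_dec[symmetric]) (use wf wfset_Un in auto)
  also have "(\<Sum>(a, b)\<in>dec ?S (supp h) m. ap g a * ap h b) = smult g h (fst m) (snd m)"
    by (rule smult_dec[symmetric]) (use wf wfset_Un in auto)
  finally show "smult (sadd f g) h (fst m) (snd m) = sadd (smult f h) (smult g h) (fst m) (snd m)"
    by (simp add: sadd_def)
qed

definition smono :: "'a::zero \<Rightarrow> (nat \<Rightarrow> nat) \<Rightarrow> (nat \<Rightarrow> int) \<Rightarrow> 'a ser" where
  "smono c \<beta> p = (\<lambda>\<alpha> e. if \<alpha> = \<beta> \<and> e = p then c else 0)"

lemma wf_smono: "finite {i. \<beta> i \<noteq> 0} \<Longrightarrow> finite {i. p i \<noteq> 0} \<Longrightarrow> wf_ser (smono c \<beta> p)"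
  unfolding wf_ser_def smono_def by (auto intro: lex_wo_subset[OF lex_wo_singleton[of p]])

lemma smult_smono:
  assumes "finite {i. \<beta> i \<noteq> 0}" "finite {i. p i \<noteq> 0}" "wf_ser f"
  shows "smult (smono c \<beta> p) f \<alpha> e = (if \<forall>i. \<beta> i \<le> \<alpha> i then c * f (\<alpha> - \<beta>) (e - p) else 0)"
proof -
  have wf: "wfset {(\<beta>, p)}"
  proof -
    have "supp (smono (1::int) \<beta> p) = {(\<beta>, p)}" by (auto simp: supp_def smono_def)
    then show ?thesis using wf_smono[OF assms(1,2), of "1::int"] by (simp add: wf_ser_iff)
  qed
  have d: "dec {(\<beta>, p)} (supp f) (\<alpha>, e) \<subseteq> {((\<beta>, p), (\<alpha> - \<beta>, e - p))}"
    by (auto simp: dec_def add_le_fun)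
  have "smult (smono c \<beta> p) f (fst (\<alpha>, e)) (snd (\<alpha>, e)) = (\<Sum>(a, b)\<in>dec {(\<beta>, p)} (supp f) (\<alpha>, e). ap (smono c \<beta> p) a * ap f b)"
    by (rule smult_dec[OF wf]) (use assms wf_ser_iff[of f] in \<open>auto simp: supp_def smono_def split: if_splits\<close>)
  also have "\<dots> = (if \<forall>i. \<beta> i \<le> \<alpha> i then c * f (\<alpha> - \<beta>) (e - p) else 0)"
  proof (cases "(\<forall>i. \<beta> i \<le> \<alpha> i) \<and> f (\<alpha> - \<beta>) (e - p) \<noteq> 0")
    case True
    then have "dec {(\<beta>, p)} (supp f) (\<alpha>, e) = {((\<beta>, p), (\<alpha> - \<beta>, e - p))}"
      by (auto simp: dec_def supp_def add_le_fun)
    then show ?thesis using True by (simp add: ap_def smono_def)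
  next
    case False
    then have "dec {(\<beta>, p)} (supp f) (\<alpha>, e) = {}"
      by (auto simp: dec_def supp_def add_le_fun)
    then show ?thesis using False by auto
  qed
  finally show ?thesis by simp
qed

text \<open>The laws of \<open>smult\<close> are established under \<open>wf_ser\<close>. Building
  the condition into a type makes finite sums, products and powers of the library available.\<close>

typedef (overloaded) 'a hser = "{f :: 'a::zero ser. wf_ser f}"
  morphisms coeff Abs_hser
  using wf_szero by auto

lemma wf_coeff [simp]: "wf_ser (coeff f)"
  using coeff by auto

lemma coeff_Abs: "wf_ser f \<Longrightarrow> coeff (Abs_hser f) = f"
  by (simp add: Abs_hser_inverse)

lemma hser_eqI: "(\<And>\<alpha> e. coeff f \<alpha> e = coeff g \<alpha> e) \<Longrightarrow> f = g"
  by (metis coeff_inject ext)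

lemma sone_smono: "sone = smono 1 (\<lambda>_. 0) (\<lambda>_. 0)"
  by (simp add: sone_def smono_def)

lemma wf_sone: "wf_ser (sone :: 'a::comm_ring_1 ser)"
  by (simp add: sone_smono wf_smono)

lemma smult_sone: "wf_ser f \<Longrightarrow> smult sone f = (f :: 'a::comm_ring_1 ser)"
  by (intro ext) (simp add: sone_smono smult_smono fun_diff_def)

instantiation hser :: (comm_ring_1) comm_ring_1
begin

definition "0 = Abs_hser szero"
definition "1 = Abs_hser sone"
definition "f + g = Abs_hser (sadd (coeff f) (coeff g))"
definition "- f = Abs_hser (\<lambda>\<alpha> e. - coeff f \<alpha> e)"
definition "f - (g :: 'a hser) = f + (- g)"
definition "f * g = Abs_hser (smult (coeff f) (coeff g))"

lemma coeff_zero': "coeff 0 = (szero :: 'a ser)"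
  by (simp add: zero_hser_def coeff_Abs wf_szero)

lemma coeff_one: "coeff 1 = (sone :: 'a ser)"
  by (simp add: one_hser_def coeff_Abs wf_sone)

lemma coeff_plus: "coeff (f + g) = sadd (coeff f) (coeff g :: 'a ser)"
  by (simp add: plus_hser_def coeff_Abs wf_sadd)

lemma coeff_uminus': "coeff (- f) = (\<lambda>\<alpha> e. - coeff f \<alpha> e :: 'a)"
  by (simp add: uminus_hser_def coeff_Abs wf_uminus)

lemma coeff_times: "coeff (f * g) = smult (coeff f) (coeff g :: 'a ser)"
  by (simp add: times_hser_def coeff_Abs wf_smult)

instance
proof
  fix a b c :: "'a hser"
  show "a * b * c = a * (b * c)" by (simp add: times_hser_def coeff_Abs wf_smult smult_assoc)
  show "a * b = b * a" unfolding times_hser_def by (subst smult_commute) simp_all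
  show "1 * a = a" by (simp add: times_hser_def coeff_one smult_sone coeff_inverse)
  show "a + b + c = a + (b + c)" by (rule hser_eqI) (simp add: coeff_plus sadd_def add.assoc)
  show "a + b = b + a" by (rule hser_eqI) (simp add: coeff_plus sadd_def add.commute)
  show "0 + a = a" by (rule hser_eqI) (simp add: coeff_plus coeff_zero' sadd_def szero_def)
  show "- a + a = 0" by (rule hser_eqI) (simp add: coeff_plus coeff_zero' coeff_uminus' sadd_def szero_def)
  show "a - b = a + - b" by (rule minus_hser_def)
  show "(a + b) * c = a * c + b * c"
    by (rule coeff_inject[THEN iffD1])
      (simp only: coeff_times coeff_plus smult_sadd_distrib wf_coeff)
  show "(0 :: 'a hser) \<noteq> 1"
  proof
    assume "(0 :: 'a hser) = 1"
    then have "(szero :: 'a ser) = sone" using coeff_zero' coeff_one by metis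
    then have "(szero :: 'a ser) (\<lambda>_. 0) (\<lambda>_. 0) = sone (\<lambda>_. 0) (\<lambda>_. 0)" by simp
    then show False by (simp add: szero_def sone_def)
  qed
qed

end

lemma coeff_add [simp]: "coeff (f + g) \<alpha> e = coeff f \<alpha> e + coeff g \<alpha> e"
  by (simp add: coeff_plus sadd_def)

lemma coeff_zero [simp]: "coeff 0 \<alpha> e = 0"
  by (simp add: coeff_zero' szero_def)

lemma coeff_uminus [simp]: "coeff (- f) \<alpha> e = - coeff f \<alpha> e"
  by (simp add: coeff_uminus')

lemma coeff_diff [simp]: "coeff (f - g) \<alpha> e = coeff f \<alpha> e - coeff g \<alpha> e"
  using coeff_add[of f "- g"] by simp

lemma coeff_sum: "coeff (\<Sum>i\<in>I. f i) \<alpha> e = (\<Sum>i\<in>I. coeff (f i) \<alpha> e)"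
  by (induction I rule: infinite_finite_induct) auto

lemma coeff_power: "coeff (f ^ k) = spow (coeff f) k"
  by (induction k) (simp_all add: coeff_one coeff_times spow_def)

lemma coeff_prod_list: "coeff (prod_list fs) = sprod_list (map coeff fs)"
  by (induction fs) (simp_all add: coeff_one coeff_times sprod_list_def)

lemma coeff_prod:
  assumes "finite A"
  shows "coeff (\<Prod>i\<in>A. f i) = sprod_set (\<lambda>i. coeff (f i)) A"
proof -
  have "(\<Prod>i\<in>A. f i) = prod_list (map f (sorted_list_of_set A))"
    using assms prod.distinct_set_conv_list[of "sorted_list_of_set A" f] by simp
  then show ?thesis by (simp add: coeff_prod_list sprod_set_def comp_def)
qed

text \<open>The description in \<open>sinv\<close> ranges over well-supported series, that is, over
  the ring, where inverses are unique. Any exhibited inverse therefore evaluates it.\<close>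

lemma sinv_coeff:
  assumes "f * g = 1"
  shows "sinv (coeff f) = coeff g"
  unfolding sinv_def
proof (rule the_equality)
  show "wf_ser (coeff g) \<and> smult (coeff f) (coeff g) = sone"
    using assms by (simp add: coeff_times[symmetric] coeff_one)
  fix h assume h: "wf_ser h \<and> smult (coeff f) h = sone"
  then have "coeff (f * Abs_hser h) = coeff 1"
    by (simp add: coeff_Abs coeff_times coeff_one)
  then have "f * Abs_hser h = 1" by (simp only: coeff_inject)
  then have "g * (f * Abs_hser h) = g" by simp
  then have "Abs_hser h = g" using assms by (simp add: mult.assoc[symmetric] mult.commute[of g])
  then have "coeff (Abs_hser h) = coeff g" by (rule arg_cong)
  then show "h = coeff g" using h by (simp add: coeff_Abs)
qed

subsection \<open>Support conditions\<close>

lemma coeff_mult_nonzero: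
  assumes "coeff (f * g) \<alpha> e \<noteq> 0"
  obtains \<beta> p \<gamma> q where "coeff f \<beta> p \<noteq> 0" "coeff g \<gamma> q \<noteq> 0" "\<alpha> = \<beta> + \<gamma>" "e = p + q"
proof -
  have "(\<alpha>, e) \<in> supp (smult (coeff f) (coeff g))" using assms by (simp add: supp_def coeff_times)
  then have "(\<alpha>, e) \<in> splus (supp (coeff f)) (supp (coeff g))" using supp_smult wf_coeff by blast
  then show ?thesis using that by (auto simp: splus_def supp_def)
qed

definition suppIn :: "((nat \<Rightarrow> nat) \<Rightarrow> (nat \<Rightarrow> int) \<Rightarrow> bool) \<Rightarrow> 'a::comm_ring_1 hser \<Rightarrow> bool" where
  "suppIn Q f \<longleftrightarrow> (\<forall>\<alpha> e. coeff f \<alpha> e \<noteq> 0 \<longrightarrow> Q \<alpha> e)"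

lemma suppInD: "suppIn Q f \<Longrightarrow> coeff f \<alpha> e \<noteq> 0 \<Longrightarrow> Q \<alpha> e"
  by (simp add: suppIn_def)

lemma suppIn_coeff_zero: "suppIn Q f \<Longrightarrow> \<not> Q \<alpha> e \<Longrightarrow> coeff f \<alpha> e = 0"
  by (auto simp: suppIn_def)

lemma suppIn_mono: "suppIn Q f \<Longrightarrow> (\<And>\<alpha> e. Q \<alpha> e \<Longrightarrow> R \<alpha> e) \<Longrightarrow> suppIn R f"
  by (auto simp: suppIn_def)

lemma suppIn_mult:
  assumes "suppIn Q f" "suppIn R g" "\<And>\<alpha> e \<beta> p. Q \<alpha> e \<Longrightarrow> R \<beta> p \<Longrightarrow> S (\<alpha> + \<beta>) (e + p)"
  shows "suppIn S (f * g)"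
  unfolding suppIn_def
proof (intro allI impI)
  fix \<alpha> e assume "coeff (f * g) \<alpha> e \<noteq> 0"
  then obtain \<beta> p \<gamma> q where "coeff f \<beta> p \<noteq> 0" "coeff g \<gamma> q \<noteq> 0" "\<alpha> = \<beta> + \<gamma>" "e = p + q"
    by (rule coeff_mult_nonzero)
  then show "S \<alpha> e" using assms by (auto simp: suppIn_def)
qed

lemma suppIn_0 [simp]: "suppIn Q 0" by (simp add: suppIn_def)

lemma suppIn_add: "suppIn Q f \<Longrightarrow> suppIn Q g \<Longrightarrow> suppIn Q (f + g)"
  by (auto simp: suppIn_def) (metis add_0)

lemma suppIn_uminus: "suppIn Q f \<Longrightarrow> suppIn Q (- f)"
  by (auto simp: suppIn_def)

lemma suppIn_diff: "suppIn Q f \<Longrightarrow> suppIn Q g \<Longrightarrow> suppIn Q (f - g)"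
  using suppIn_add[of Q f "- g"] suppIn_uminus[of Q g] by simp

lemma suppIn_sum: "(\<And>i. i \<in> I \<Longrightarrow> suppIn Q (f i)) \<Longrightarrow> suppIn Q (\<Sum>i\<in>I. f i)"
  by (induction I rule: infinite_finite_induct) (auto intro: suppIn_add)

text \<open>For such an exponent condition the series supported in it form a subring containing the
  constants. Absence of a variable, absence of its negative powers and similar conditions are all
  treated this way.\<close>

definition submon :: "((nat \<Rightarrow> nat) \<Rightarrow> (nat \<Rightarrow> int) \<Rightarrow> bool) \<Rightarrow> bool" where
  "submon Q \<longleftrightarrow> Q 0 0 \<and> (\<forall>\<alpha> e \<beta> p. Q \<alpha> e \<longrightarrow> Q \<beta> p \<longrightarrow> Q (\<alpha> + \<beta>) (e + p))"

lemma submon_mult: "submon Q \<Longrightarrow> suppIn Q f \<Longrightarrow> suppIn Q g \<Longrightarrow> suppIn Q (f * g)"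
  by (erule (1) suppIn_mult) (simp add: submon_def)

section \<open>Constants and variables of the ring\<close>

definition hconst :: "'a::comm_ring_1 \<Rightarrow> 'a hser" where
  "hconst c = Abs_hser (smono c 0 0)"

definition X :: "nat \<Rightarrow> 'a::comm_ring_1 hser" where "X j = Abs_hser (xvar j)"

definition U :: "nat \<Rightarrow> 'a::comm_ring_1 hser" where "U j = Abs_hser (uvar j)"

definition unit_at :: "nat \<Rightarrow> nat \<Rightarrow> 'b::zero_neq_one" where
  "unit_at j = (\<lambda>k. if k = j then 1 else 0)"

lemma unit_at_same [simp]: "unit_at j j = 1" by (simp add: unit_at_def)

lemma unit_at_other [simp]: "i \<noteq> j \<Longrightarrow> unit_at j i = 0" by (simp add: unit_at_def)

lemma finite_unit_at [simp]: "finite {i. unit_at j i \<noteq> 0}"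
  by (rule finite_subset[of _ "{j}"]) (auto simp: unit_at_def)

lemma xvar_smono: "xvar j = smono 1 (unit_at j) 0"
  by (simp add: xvar_def smono_def unit_at_def zero_fun_def)

lemma uvar_smono: "uvar j = smono 1 0 (unit_at j)"
  by (simp add: uvar_def smono_def unit_at_def zero_fun_def)

lemma finite_supp_zero [simp]: "finite {i. (0::nat \<Rightarrow> 'b::zero) i \<noteq> 0}"
  by simp

lemma coeff_hconst: "coeff (hconst c) = smono c 0 0"
  unfolding hconst_def by (rule coeff_Abs, rule wf_smono) (rule finite_supp_zero)+

lemma coeff_X: "coeff (X j) = xvar j"
  unfolding X_def xvar_smono by (rule coeff_Abs, rule wf_smono) (rule finite_supp_zero finite_unit_at)+

lemma coeff_U: "coeff (U j) = uvar j"
  unfolding U_def uvar_smono by (rule coeff_Abs, rule wf_smono) (rule finite_supp_zero finite_unit_at)+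

lemma coeff_hconst_mult [simp]: "coeff (hconst c * f) \<alpha> e = c * coeff f \<alpha> e"
  unfolding coeff_times coeff_hconst
  by (subst smult_smono) (rule finite_supp_zero wf_coeff | simp add: fun_diff_def)+

lemma coeff_X_mult: "coeff (X j * f) \<alpha> e = (if \<alpha> j = 0 then 0 else coeff f (\<alpha>(j := \<alpha> j - 1)) e)"
proof -
  have 1: "(\<forall>i. unit_at j i \<le> \<alpha> i) \<longleftrightarrow> \<alpha> j \<noteq> 0" by (auto simp: unit_at_def Suc_le_eq)
  have 2: "\<alpha> - unit_at j = \<alpha>(j := \<alpha> j - 1)" by (auto simp: fun_eq_iff unit_at_def)
  have 3: "e - 0 = e" by (auto simp: fun_eq_iff)
  show ?thesis
    unfolding coeff_times coeff_X xvar_smono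
    by (subst smult_smono) (rule finite_supp_zero finite_unit_at wf_coeff | simp only: 1 2 3 mult_1 if_not_P if_P split: if_splits | simp)+
qed

lemma coeff_U_mult: "coeff (U j * f) \<alpha> e = coeff f \<alpha> (e(j := e j - 1))"
proof -
  have 2: "e - unit_at j = e(j := e j - 1)" by (auto simp: fun_eq_iff unit_at_def)
  have 3: "\<alpha> - 0 = \<alpha>" by (auto simp: fun_eq_iff)
  show ?thesis
    unfolding coeff_times coeff_U uvar_smono
    by (subst smult_smono) (rule finite_supp_zero finite_unit_at wf_coeff | simp only: 2 3 mult_1 | simp)+
qed

lemma hconst_1: "hconst 1 = 1"
  by (rule hser_eqI) (simp add: coeff_hconst coeff_one sone_smono zero_fun_def)

lemma hconst_0 [simp]: "hconst 0 = 0"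
  by (rule hser_eqI) (simp add: coeff_hconst smono_def)

lemma hconst_mult: "hconst c * hconst d = hconst (c * d)"
  by (rule hser_eqI) (simp add: coeff_hconst smono_def)

lemma suppIn_hconst: "Q 0 0 \<Longrightarrow> suppIn Q (hconst c)"
  by (auto simp: suppIn_def coeff_hconst smono_def split: if_splits)

lemma suppIn_1: "Q 0 0 \<Longrightarrow> suppIn Q 1"
  using suppIn_hconst[of Q 1] by (simp add: hconst_1)

lemma suppIn_X: "Q (unit_at j) 0 \<Longrightarrow> suppIn Q (X j)"
  by (auto simp: suppIn_def coeff_X xvar_smono smono_def split: if_splits)

lemma suppIn_U: "Q 0 (unit_at j) \<Longrightarrow> suppIn Q (U j)"
  by (auto simp: suppIn_def coeff_U uvar_smono smono_def split: if_splits)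

lemma submon_1: "submon Q \<Longrightarrow> suppIn Q 1"
  by (rule suppIn_1) (auto simp: submon_def)

lemma submon_hconst: "submon Q \<Longrightarrow> suppIn Q (hconst c)"
  by (rule suppIn_hconst) (auto simp: submon_def)

lemma submon_power: "submon Q \<Longrightarrow> suppIn Q f \<Longrightarrow> suppIn Q (f ^ k)"
  by (induction k) (auto intro: submon_1 submon_mult)

lemma submon_prod: "submon Q \<Longrightarrow> (\<And>i. i \<in> I \<Longrightarrow> suppIn Q (f i)) \<Longrightarrow> suppIn Q (\<Prod>i\<in>I. f i)"
  by (induction I rule: infinite_finite_induct) (auto intro: submon_1 submon_mult)

text \<open>If \<open>X p * f = X q * f\<close>, a coefficient of \<open>f\<close> equals the one
  whose exponent at \<open>q\<close> is lowered and at \<open>p\<close> raised by one. Descending to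
  exponent 0 at \<open>q\<close>, where the coefficient vanishes, shows that all are 0.\<close>

lemma X_diff_cancel:
  assumes "p \<noteq> q" "(X p - X q) * f = 0"
  shows "f = 0"
proof (rule hser_eqI)
  have eq: "X p * f = X q * f" using assms(2) by (simp add: algebra_simps)
  have "coeff f \<alpha> e = 0" if "\<alpha> q = m" for \<alpha> e m
    using that
  proof (induction m arbitrary: \<alpha>)
    case 0
    have "coeff (X p * f) (\<alpha>(p := Suc (\<alpha> p))) e = coeff (X q * f) (\<alpha>(p := Suc (\<alpha> p))) e" using eq by simp
    then show ?case using 0 assms(1) by (simp add: coeff_X_mult)
  next
    case (Suc m)
    have "coeff (X p * f) (\<alpha>(p := Suc (\<alpha> p))) e = coeff (X q * f) (\<alpha>(p := Suc (\<alpha> p))) e" using eq by simp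
    then have "coeff f \<alpha> e = coeff f (\<alpha>(p := Suc (\<alpha> p), q := m)) e" using Suc assms(1) by (simp add: coeff_X_mult)
    also have "\<dots> = 0" by (rule Suc.IH) simp
    finally show ?case .
  qed
  then show "\<And>\<alpha> e. coeff f \<alpha> e = coeff 0 \<alpha> e" by simp
qed

subsection \<open>Coefficients with respect to one of the variables u\<close>

abbreviation ufree :: "nat \<Rightarrow> 'a::comm_ring_1 hser \<Rightarrow> bool" where
  "ufree j \<equiv> suppIn (\<lambda>\<alpha> e. e j = 0)"

abbreviation upos :: "nat \<Rightarrow> 'a::comm_ring_1 hser \<Rightarrow> bool" where
  "upos j \<equiv> suppIn (\<lambda>\<alpha> e. 0 \<le> e j)"

lemma submon_ufree: "submon (\<lambda>\<alpha> e. e j = 0)"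
  by (simp add: submon_def)

lemma submon_upos: "submon (\<lambda>\<alpha> e. 0 \<le> e j)"
  by (simp add: submon_def)

lemma ufree_upos: "ufree j f \<Longrightarrow> upos j f"
  by (erule suppIn_mono) auto

text \<open>The coefficient of the \<open>k\<close>-th power of \<open>U j\<close>. It is kept in
  the same ring, as a series free of \<open>U j\<close>, so that extraction can be iterated.\<close>

definition ucf :: "nat \<Rightarrow> int \<Rightarrow> 'a::comm_ring_1 hser \<Rightarrow> 'a hser" where
  "ucf j k f = Abs_hser (\<lambda>\<alpha> e. if e j = 0 then coeff f \<alpha> (e(j := k)) else 0)"

lemma lexless_upd: "d j = e j \<Longrightarrow> lexless (d(j := k)) (e(j := k)) \<longleftrightarrow> lexless d e"
  unfolding lexless_def by (intro ex_cong1) auto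

lemma coeff_ucf: "coeff (ucf j k f) \<alpha> e = (if e j = 0 then coeff f \<alpha> (e(j := k)) else 0)"
proof -
  have "wf_ser (\<lambda>\<alpha> e. if e j = 0 then coeff f \<alpha> (e(j := k)) else 0)"
    unfolding wf_ser_def
  proof (intro conjI allI impI)
    fix \<alpha> e assume "(if e j = 0 then coeff f \<alpha> (e(j := k)) else 0) \<noteq> 0"
    then have nz: "coeff f \<alpha> (e(j := k)) \<noteq> 0" by (auto split: if_splits)
    then have fin: "finite {i. \<alpha> i \<noteq> 0}" "finite {i. (e(j := k)) i \<noteq> 0}"
      using wf_coeff[of f] unfolding wf_ser_def by blast+
    show "finite {i. \<alpha> i \<noteq> 0}" by fact
    have "{i. e i \<noteq> 0} \<subseteq> insert j {i. (e(j := k)) i \<noteq> 0}" by auto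
    then show "finite {i. e i \<noteq> 0}" using fin(2) finite_subset by blast
  next
    fix \<alpha>
    have wo: "lex_wo {e. coeff f \<alpha> e \<noteq> 0}" using wf_coeff[of f] unfolding wf_ser_def by blast
    show "lex_wo {e. (if e j = 0 then coeff f \<alpha> (e(j := k)) else 0) \<noteq> 0}"
      unfolding lex_wo_def
    proof (intro allI impI)
      fix T assume T: "T \<subseteq> {e. (if e j = 0 then coeff f \<alpha> (e(j := k)) else 0) \<noteq> 0}" "T \<noteq> {}"
      have T0: "e j = 0 \<and> coeff f \<alpha> (e(j := k)) \<noteq> 0" if "e \<in> T" for e using subsetD[OF T(1) that] by (auto split: if_splits)
      let ?T = "(\<lambda>e. e(j := k)) ` T"
      have "?T \<subseteq> {e. coeff f \<alpha> e \<noteq> 0}" using T0 by auto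
      then have "\<exists>m\<in>?T. \<forall>t\<in>?T. \<not> lexless t m" by (rule lex_woD[OF wo]) (use T(2) in simp)
      then obtain m' where m': "m' \<in> T" "\<forall>t\<in>T. \<not> lexless (t(j := k)) (m'(j := k))" by auto
      have "\<not> lexless t m'" if "t \<in> T" for t
        using m' that T0[OF that] T0[OF m'(1)] lexless_upd[of t j m' k] by simp
      then show "\<exists>m\<in>T. \<forall>t\<in>T. \<not> lexless t m" using m' by auto
    qed
  qed
  then show ?thesis unfolding ucf_def by (simp add: coeff_Abs)
qed

lemma ucf_add: "ucf j k (f + g) = ucf j k f + ucf j k g"
  by (rule hser_eqI) (simp add: coeff_ucf)

lemma ucf_0 [simp]: "ucf j k 0 = 0"
  by (rule hser_eqI) (simp add: coeff_ucf)

lemma ucf_diff: "ucf j k (f - g) = ucf j k f - ucf j k g"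
  by (rule hser_eqI) (simp add: coeff_ucf)

lemma ucf_sum: "ucf j k (\<Sum>i\<in>I. f i) = (\<Sum>i\<in>I. ucf j k (f i))"
  by (induction I rule: infinite_finite_induct) (auto simp: ucf_add)

lemma ucf_U_mult: "ucf j k (U j * f) = ucf j (k - 1) f"
  by (rule hser_eqI) (simp add: coeff_ucf coeff_U_mult)

lemma coeff_eq_ucf: "coeff f \<alpha> e = coeff (ucf j (e j) f) \<alpha> (e(j := 0))"
  by (simp add: coeff_ucf)

lemma ucf_eqI: "(\<And>k. ucf j k f = ucf j k g) \<Longrightarrow> f = g"
  by (rule hser_eqI) (metis coeff_eq_ucf)

lemma ufree_ucf: "ufree j (ucf j k f)"
  by (auto simp: suppIn_def coeff_ucf)

lemma ufree_ucf_other: "ufree i f \<Longrightarrow> ufree i (ucf j k f)"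
  unfolding suppIn_def coeff_ucf
  by (cases "i = j") (auto split: if_splits dest!: spec[where x = "_(j := k)"])

lemma ucf_ufree: "ufree j f \<Longrightarrow> ucf j k f = (if k = 0 then f else 0)"
proof (rule hser_eqI)
  fix \<alpha> e assume f: "ufree j f"
  show "coeff (ucf j k f) \<alpha> e = coeff (if k = 0 then f else 0) \<alpha> e"
    using suppInD[OF f, of \<alpha> e] suppInD[OF f, of \<alpha> "e(j := k)"] by (auto simp: coeff_ucf fun_upd_idem)
qed

lemma ucf_upos: "upos j f \<Longrightarrow> k < 0 \<Longrightarrow> ucf j k f = 0"
  by (rule hser_eqI) (auto simp: coeff_ucf dest: suppInD)

text \<open>Exponents in the support of \<open>g\<close> are 0 at \<open>j\<close>, so selecting a
  power of \<open>U j\<close> affects the factor \<open>f\<close> alone; the two Cauchy sums then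
  have the same index sets and terms.\<close>

lemma ucf_mult:
  assumes "ufree j g"
  shows "ucf j k (g * f) = g * ucf j k f"
proof (rule hser_eqI)
  fix \<alpha> e
  show "coeff (ucf j k (g * f)) \<alpha> e = coeff (g * ucf j k f) \<alpha> e"
  proof (cases "e j = 0")
    case True
    have eq: "coeff (ucf j k f) (\<lambda>i. \<alpha> i - \<beta> i) (\<lambda>i. e i - p i) = coeff f (\<lambda>i. \<alpha> i - \<beta> i) (\<lambda>i. (e(j := k)) i - p i)"
      if "coeff g \<beta> p \<noteq> 0" for \<beta> p
    proof -
      have "p j = 0" using assms that by (auto simp: suppIn_def)
      then have "(\<lambda>i. (e(j := k)) i - p i) = (\<lambda>i. e i - p i)(j := k)" by auto
      then show ?thesis using True \<open>p j = 0\<close> by (simp add: coeff_ucf)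
    qed
    have "coeff (ucf j k (g * f)) \<alpha> e = smult (coeff g) (coeff f) \<alpha> (e(j := k))"
      using True by (simp add: coeff_ucf coeff_times)
    also have "\<dots> = smult (coeff g) (coeff (ucf j k f)) \<alpha> e"
      unfolding smult_def
      by (intro sum.cong refl Collect_cong) (use eq in auto)
    finally show ?thesis by (simp add: coeff_times)
  next
    case False
    have "coeff (g * ucf j k f) \<alpha> e = 0"
      using submon_mult[OF submon_ufree assms ufree_ucf[of j k f]] False by (rule suppIn_coeff_zero)
    then show ?thesis using False by (simp add: coeff_ucf)
  qed
qed

subsection \<open>Degree and infinite sums\<close>

text \<open>Only the first \<open>N\<close> variables of either kind count for the degree; \<open>N\<close> is chosen larger than
  the index of every variable in use.\<close>
definition deg :: "nat \<Rightarrow> (nat \<Rightarrow> nat) \<Rightarrow> (nat \<Rightarrow> int) \<Rightarrow> int" where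
  "deg N \<alpha> e = (\<Sum>i<N. int (\<alpha> i) + e i)"

lemma deg_add: "deg N (\<alpha> + \<beta>) (e + p) = deg N \<alpha> e + deg N \<beta> p"
  by (simp add: deg_def sum.distrib[symmetric] algebra_simps)

lemma deg_0 [simp]: "deg N 0 0 = 0"
  by (simp add: deg_def)

lemma sum_unit_at: "j < N \<Longrightarrow> (\<Sum>i<N. unit_at j i) = (1::int)"
  unfolding unit_at_def by (subst sum.delta) auto

lemma int_unit_at: "int (unit_at j i) = unit_at j i"
  by (simp add: unit_at_def)

lemma deg_unit_x: "j < N \<Longrightarrow> deg N (unit_at j) 0 = 1"
  by (simp add: deg_def int_unit_at sum_unit_at)

lemma deg_unit_u: "j < N \<Longrightarrow> deg N 0 (unit_at j) = 1"
  by (simp add: deg_def sum_unit_at)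

abbreviation odeg :: "nat \<Rightarrow> int \<Rightarrow> 'a::comm_ring_1 hser \<Rightarrow> bool" where
  "odeg N d \<equiv> suppIn (\<lambda>\<alpha> e. d \<le> deg N \<alpha> e)"

abbreviation upow :: "nat \<Rightarrow> 'a::comm_ring_1 hser \<Rightarrow> bool" where
  "upow N \<equiv> suppIn (\<lambda>\<alpha> e. (\<forall>i. 0 \<le> e i) \<and> (\<forall>i\<ge>N. e i = 0))"

lemma submon_upow: "submon (\<lambda>\<alpha> e. (\<forall>i. 0 \<le> e i) \<and> (\<forall>i\<ge>N. e i = (0::int)))"
  by (auto simp: submon_def)

lemma upow_odeg_0: "upow N f \<Longrightarrow> odeg N 0 f"
  by (erule suppIn_mono) (auto simp: deg_def intro!: sum_nonneg)

lemma odeg_mono: "odeg N d f \<Longrightarrow> c \<le> d \<Longrightarrow> odeg N c f"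
  by (erule suppIn_mono) auto

lemma odeg_mult: "odeg N c f \<Longrightarrow> odeg N d g \<Longrightarrow> odeg N (c + d) (f * g)"
  by (erule (1) suppIn_mult) (simp add: deg_add)

lemma odeg_mult_left: "upow N f \<Longrightarrow> odeg N d g \<Longrightarrow> odeg N d (f * g)"
  using odeg_mult[where N = N and c = 0 and d = d and f = f and g = g] by (simp add: upow_odeg_0)

lemma odeg_mult_right: "upow N f \<Longrightarrow> odeg N d g \<Longrightarrow> odeg N d (g * f)"
  unfolding mult.commute[of g] by (rule odeg_mult_left)

lemma odeg_power: "odeg N 1 f \<Longrightarrow> odeg N (int k) (f ^ k)"
proof (induction k)
  case 0
  then show ?case by (simp add: suppIn_1)
next
  case (Suc k)
  then show ?case using odeg_mult[OF Suc.prems Suc.IH[OF Suc.prems]] by simp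
qed

text \<open>A nonzero coefficient sits at one fixed degree and violates the bound for any larger
  \<open>d\<close>. Equalities between infinite sums are reduced to this.\<close>

lemma odeg_separated: "(\<And>d. odeg N (int d) f) \<Longrightarrow> f = 0"
proof (rule hser_eqI)
  fix \<alpha> e assume *: "\<And>d. odeg N (int d) f"
  have "coeff f \<alpha> e \<noteq> 0 \<Longrightarrow> int (nat (deg N \<alpha> e) + 1) \<le> deg N \<alpha> e"
    using *[of "nat (deg N \<alpha> e) + 1"] unfolding suppIn_def by blast
  then show "coeff f \<alpha> e = coeff 0 \<alpha> e" by (cases "coeff f \<alpha> e = 0") (simp, linarith)
qed

text \<open>Cutting off by the weight \<open>w\<close> makes every coefficient a finite sum; for
  summable families the omitted terms vanish at that exponent anyway.\<close>

definition hsum :: "nat \<Rightarrow> ('i \<Rightarrow> nat) \<Rightarrow> ('i \<Rightarrow> 'a::comm_ring_1 hser) \<Rightarrow> 'a hser" where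
  "hsum N w t = Abs_hser (\<lambda>\<alpha> e. \<Sum>i | int (w i) \<le> deg N \<alpha> e. coeff (t i) \<alpha> e)"

text \<open>Summable families, \<open>w\<close> bounding the order of the terms from below.\<close>
definition fam :: "nat \<Rightarrow> ('i \<Rightarrow> nat) \<Rightarrow> ('i \<Rightarrow> 'a::comm_ring_1 hser) \<Rightarrow> bool" where
  "fam N w t \<longleftrightarrow> (\<forall>d. finite {i. w i \<le> d}) \<and> (\<forall>i. upow N (t i) \<and> odeg N (int (w i)) (t i))"

lemma fam_finite_int: "fam N w t \<Longrightarrow> finite {i. int (w i) \<le> d}"
  by (rule finite_subset[of _ "{i. w i \<le> nat d}"]) (simp_all add: fam_def subset_iff nat_le_iff le_nat_iff, linarith?)

lemma fam_finite: "fam N w t \<Longrightarrow> finite {i. w i < d}"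
  by (rule finite_subset[of _ "{i. w i \<le> d}"]) (simp_all add: fam_def subset_iff)

lemma coeff_hsum:
  assumes "fam N w t"
  shows "coeff (hsum N w t) \<alpha> e = (\<Sum>i | int (w i) \<le> deg N \<alpha> e. coeff (t i) \<alpha> e)"
proof -
  have nz: "\<exists>i. coeff (t i) \<alpha> e \<noteq> 0" if "(\<Sum>i | int (w i) \<le> deg N \<alpha> e. coeff (t i) \<alpha> e) \<noteq> 0" for \<alpha> e
    using that by (metis (no_types, lifting) sum.neutral)
  have "wf_ser (\<lambda>\<alpha> e. \<Sum>i | int (w i) \<le> deg N \<alpha> e. coeff (t i) \<alpha> e)"
    unfolding wf_ser_def
  proof (intro conjI allI impI)
    fix \<alpha> e assume "(\<Sum>i | int (w i) \<le> deg N \<alpha> e. coeff (t i) \<alpha> e) \<noteq> 0"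
    then obtain i where "coeff (t i) \<alpha> e \<noteq> 0" using nz by blast
    then show "finite {i. \<alpha> i \<noteq> 0}" "finite {i. e i \<noteq> 0}"
      using wf_coeff[of "t i"] unfolding wf_ser_def by blast+
  next
    fix \<alpha>
    have *: "(\<forall>i. 0 \<le> e i) \<and> (\<forall>i\<ge>N. e i = 0)" if e: "e \<in> {e. (\<Sum>i | int (w i) \<le> deg N \<alpha> e. coeff (t i) \<alpha> e) \<noteq> 0}" for e
    proof -
      obtain i where "coeff (t i) \<alpha> e \<noteq> 0" using e nz[of \<alpha> e] by blast
      moreover have "upow N (t i)" using assms by (simp add: fam_def)
      ultimately show ?thesis by (simp add: suppIn_def)
    qed
    \<comment> \<open>Infinitely many supports are united here. The bounds from \<open>upow\<close>,
      common to all terms, keep the union well ordered.\<close>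
    show "lex_wo {e. (\<Sum>i | int (w i) \<le> deg N \<alpha> e. coeff (t i) \<alpha> e) \<noteq> 0}"
    proof (rule lex_wo_bounded[where b = "\<lambda>_ _. 0" and N = N])
      fix e i assume "e \<in> {e. (\<Sum>i | int (w i) \<le> deg N \<alpha> e. coeff (t i) \<alpha> e) \<noteq> 0}"
      from *[OF this] show "N \<le> i \<Longrightarrow> e i = 0" "0 \<le> e i" by simp_all
    qed simp
  qed
  then show ?thesis unfolding hsum_def by (simp add: coeff_Abs)
qed

lemma suppIn_hsum:
  assumes "fam N w t" "\<And>i. suppIn Q (t i)"
  shows "suppIn Q (hsum N w t)"
  unfolding suppIn_def
proof (intro allI impI)
  fix \<alpha> e assume "coeff (hsum N w t) \<alpha> e \<noteq> 0"
  then obtain i where "coeff (t i) \<alpha> e \<noteq> 0"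
    unfolding coeff_hsum[OF assms(1)] by (metis (no_types, lifting) sum.neutral)
  then show "Q \<alpha> e" using assms(2) by (auto simp: suppIn_def)
qed

lemma upow_hsum: "fam N w t \<Longrightarrow> upow N (hsum N w t)"
  by (rule suppIn_hsum) (auto simp: fam_def)

lemma fam_coeff_zero:
  assumes "fam N w t" "deg N \<alpha> e < int (w i)"
  shows "coeff (t i) \<alpha> e = 0"
proof -
  have "odeg N (int (w i)) (t i)" using assms by (simp add: fam_def)
  then show ?thesis using assms(2) unfolding suppIn_def by (metis linorder_not_less)
qed

lemma coeff_hsum_superset:
  assumes "fam N w t" "finite I" "\<And>i. coeff (t i) \<alpha> e \<noteq> 0 \<Longrightarrow> i \<in> I"
  shows "coeff (hsum N w t) \<alpha> e = (\<Sum>i\<in>I. coeff (t i) \<alpha> e)"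
proof -
  have "(\<Sum>i | int (w i) \<le> deg N \<alpha> e. coeff (t i) \<alpha> e) = (\<Sum>i | coeff (t i) \<alpha> e \<noteq> 0. coeff (t i) \<alpha> e)"
    by (rule sum.mono_neutral_right) (use fam_finite_int[OF assms(1)] fam_coeff_zero[OF assms(1)] in \<open>auto simp: not_le[symmetric]\<close>)
  also have "\<dots> = (\<Sum>i\<in>I. coeff (t i) \<alpha> e)"
    by (rule sum.mono_neutral_left) (use assms in auto)
  finally show ?thesis by (simp add: coeff_hsum[OF assms(1)])
qed

lemma coeff_hsum_support:
  assumes "fam N w t"
  shows "coeff (hsum N w t) \<alpha> e = (\<Sum>i | coeff (t i) \<alpha> e \<noteq> 0. coeff (t i) \<alpha> e)"
proof (rule coeff_hsum_superset[OF assms])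
  have "{i. coeff (t i) \<alpha> e \<noteq> 0} \<subseteq> {i. int (w i) \<le> deg N \<alpha> e}"
    using fam_coeff_zero[OF assms] by (auto simp: not_le[symmetric])
  then show "finite {i. coeff (t i) \<alpha> e \<noteq> 0}" using fam_finite_int[OF assms] finite_subset by blast
qed auto

lemma hsum_approx:
  assumes "fam N w t"
  shows "odeg N (int d) (hsum N w t - (\<Sum>i | w i < d. t i))"
  unfolding suppIn_def
proof (intro allI impI, rule ccontr)
  fix \<alpha> e assume nz: "coeff (hsum N w t - (\<Sum>i | w i < d. t i)) \<alpha> e \<noteq> 0" and "\<not> int d \<le> deg N \<alpha> e"
  then have "w i < d" if "coeff (t i) \<alpha> e \<noteq> 0" for i
    using fam_coeff_zero[OF assms, of \<alpha> e i] that by force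
  then have "coeff (hsum N w t) \<alpha> e = (\<Sum>i | w i < d. coeff (t i) \<alpha> e)"
    by (intro coeff_hsum_superset[OF assms] fam_finite[OF assms]) auto
  then show False using nz by (simp add: coeff_sum)
qed

text \<open>Two limits of the same partial sums differ by a series of arbitrarily high
  order.\<close>

lemma hsum_unique:
  assumes "fam N w t" "\<And>d. odeg N (int d) (g - (\<Sum>i | w i < d. t i))"
  shows "hsum N w t = g"
proof -
  have "odeg N (int d) (hsum N w t - g)" for d
    using suppIn_diff[OF hsum_approx[OF assms(1), of d] assms(2)[of d]] by simp
  then have "hsum N w t - g = 0" by (rule odeg_separated)
  then show ?thesis by simp
qed

lemma fam_mult: "fam N w t \<Longrightarrow> upow N g \<Longrightarrow> fam N w (\<lambda>i. g * t i)"
  unfolding fam_def by (auto intro: submon_mult[OF submon_upow] odeg_mult_left)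

lemma hsum_mult:
  assumes "fam N w t" "upow N g"
  shows "hsum N w (\<lambda>i. g * t i) = g * hsum N w t"
proof (rule hsum_unique[OF fam_mult[OF assms]])
  fix d
  show "odeg N (int d) (g * hsum N w t - (\<Sum>i | w i < d. g * t i))"
    using odeg_mult_left[OF assms(2) hsum_approx[OF assms(1), of d]]
    by (simp add: right_diff_distrib sum_distrib_left)
qed

text \<open>A map that respects differences and does not lower the order commutes with partial sums
  up to a high-order error, and \<open>hsum_unique\<close> passes to the limit.\<close>

lemma hsum_hom:
  assumes t: "fam N w t" and \<phi>t: "fam N w (\<lambda>i. \<phi> (t i))" and Q: "\<And>i. suppIn Q (t i)"
    and diff: "\<And>f g. suppIn Q f \<Longrightarrow> suppIn Q g \<Longrightarrow> \<phi> (f - g) = \<phi> f - \<phi> g"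
    and cont: "\<And>f d. suppIn Q f \<Longrightarrow> odeg N (int d) f \<Longrightarrow> odeg N (int d) (\<phi> f)"
  shows "\<phi> (hsum N w t) = hsum N w (\<lambda>i. \<phi> (t i))"
proof (rule sym, rule hsum_unique[OF \<phi>t])
  fix d
  have 0: "\<phi> 0 = 0" using diff[of 0 0] by simp
  have neg: "\<phi> (- f) = - \<phi> f" if "suppIn Q f" for f using diff[of 0 f] that 0 by simp
  have add: "\<phi> (f + g) = \<phi> f + \<phi> g" if "suppIn Q f" "suppIn Q g" for f g
    using diff[of f "- g"] that neg by (simp add: suppIn_uminus)
  have sum: "\<phi> (\<Sum>i\<in>I. t i) = (\<Sum>i\<in>I. \<phi> (t i))" for I
    by (induction I rule: infinite_finite_induct) (simp_all add: 0 add Q suppIn_sum)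
  have "odeg N (int d) (\<phi> (hsum N w t - (\<Sum>i | w i < d. t i)))"
    by (intro cont suppIn_diff suppIn_hsum suppIn_sum t Q hsum_approx)
  then show "odeg N (int d) (\<phi> (hsum N w t) - (\<Sum>i | w i < d. \<phi> (t i)))"
    by (simp add: diff sum suppIn_hsum suppIn_sum t Q)
qed

subsection \<open>Substitution into power series\<close>

text \<open>These series may be substituted into any power series, since the order of their powers
  grows.\<close>

definition small :: "nat \<Rightarrow> 'a::comm_ring_1 hser \<Rightarrow> bool" where
  "small N A \<longleftrightarrow> upow N A \<and> odeg N 1 A"

lemma small_upow: "small N A \<Longrightarrow> upow N A" by (simp add: small_def)

lemma small_odeg: "small N A \<Longrightarrow> odeg N 1 A" by (simp add: small_def)

lemma small_0 [simp]: "small N 0" by (simp add: small_def)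

lemma small_add: "small N A \<Longrightarrow> small N B \<Longrightarrow> small N (A + B)"
  by (simp add: small_def suppIn_add)

lemma small_diff: "small N A \<Longrightarrow> small N B \<Longrightarrow> small N (A - B)"
  by (simp add: small_def suppIn_diff)

lemma small_mult: "upow N g \<Longrightarrow> small N A \<Longrightarrow> small N (A * g)"
  by (simp add: small_def submon_mult[OF submon_upow] odeg_mult_right)

lemma small_X: "j < N \<Longrightarrow> small N (X j)"
  by (simp add: small_def suppIn_X deg_unit_x)

lemma small_U: "j < N \<Longrightarrow> small N (U j)"
  unfolding small_def by (intro conjI suppIn_U) (simp_all add: deg_unit_u, simp_all add: unit_at_def)

lemma upow_hconst: "upow N (hconst c)" by (rule submon_hconst[OF submon_upow])

lemma upow_1: "upow N 1" by (rule submon_1[OF submon_upow])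

lemma upow_mult: "upow N f \<Longrightarrow> upow N g \<Longrightarrow> upow N (f * g)" by (rule submon_mult[OF submon_upow])

lemma upow_power: "upow N f \<Longrightarrow> upow N (f ^ k)" by (rule submon_power[OF submon_upow])

lemma odeg_hconst_mult: "odeg N d f \<Longrightarrow> odeg N d (hconst c * f)"
  by (rule odeg_mult_left[OF upow_hconst])

lemma small_odeg_power: "small N A \<Longrightarrow> odeg N (int k) (A ^ k)"
  by (rule odeg_power[OF small_odeg])

lemma small_upow_power: "small N A \<Longrightarrow> upow N (A ^ k)"
  by (rule upow_power[OF small_upow])

lemma fam1: "small N A \<Longrightarrow> fam N (\<lambda>k. k) (\<lambda>k. hconst (c k) * A ^ k)"
  unfolding fam_def by (intro conjI allI upow_mult upow_hconst small_upow_power odeg_hconst_mult small_odeg_power) simp_all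

definition mono2 :: "'a::comm_ring_1 hser \<Rightarrow> 'a hser \<Rightarrow> nat \<times> nat \<Rightarrow> 'a hser" where
  "mono2 A B = (\<lambda>(k, l). A ^ k * B ^ l)"

definition wt2 :: "nat \<times> nat \<Rightarrow> nat" where "wt2 = (\<lambda>(k, l). k + l)"

definition mono3 :: "'a::comm_ring_1 hser \<Rightarrow> 'a hser \<Rightarrow> 'a hser \<Rightarrow> nat \<times> nat \<times> nat \<Rightarrow> 'a hser" where
  "mono3 A B C = (\<lambda>(i, j, k). A ^ i * (B ^ j * C ^ k))"

definition wt3 :: "nat \<times> nat \<times> nat \<Rightarrow> nat" where "wt3 = (\<lambda>(i, j, k). i + j + k)"

lemma mono2_bounds:
  assumes "small N A" "small N B"
  shows "upow N (mono2 A B p)" "odeg N (int (wt2 p)) (mono2 A B p)"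
  using assms odeg_mult[OF small_odeg_power small_odeg_power, of N A B "fst p" "snd p"]
  by (auto simp: mono2_def wt2_def case_prod_beta intro: upow_mult small_upow_power)

lemma mono3_bounds:
  assumes "small N A" "small N B" "small N C"
  shows "upow N (mono3 A B C p)" "odeg N (int (wt3 p)) (mono3 A B C p)"
proof -
  obtain i j k where p: "p = (i, j, k)" by (cases p)
  show "upow N (mono3 A B C p)"
    using assms by (simp add: p mono3_def upow_mult small_upow_power)
  show "odeg N (int (wt3 p)) (mono3 A B C p)"
    using odeg_mult[OF small_odeg_power[OF assms(1)] odeg_mult[OF small_odeg_power[OF assms(2)] small_odeg_power[OF assms(3)]], of i j k]
    by (simp add: p mono3_def wt3_def add.assoc)
qed

lemma fam2:
  assumes "small N A" "small N B"
  shows "fam N wt2 (\<lambda>p. hconst (c p) * mono2 A B p)"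
  unfolding fam_def
proof (intro conjI allI)
  fix d show "finite {p. wt2 p \<le> d}"
    by (rule finite_subset[of _ "{..d} \<times> {..d}"]) (auto simp: wt2_def)
qed (simp_all add: upow_mult upow_hconst odeg_hconst_mult mono2_bounds[OF assms])

lemma fam3:
  assumes "small N A" "small N B" "small N C"
  shows "fam N wt3 (\<lambda>p. hconst (c p) * mono3 A B C p)"
  unfolding fam_def
proof (intro conjI allI)
  fix d show "finite {p. wt3 p \<le> d}"
    by (rule finite_subset[of _ "{..d} \<times> {..d} \<times> {..d}"]) (auto simp: wt3_def)
qed (simp_all add: upow_mult upow_hconst odeg_hconst_mult mono3_bounds[OF assms])

definition S1 :: "nat \<Rightarrow> (nat \<Rightarrow> 'a) \<Rightarrow> 'a::comm_ring_1 hser \<Rightarrow> 'a hser" where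
  "S1 N c A = hsum N (\<lambda>k. k) (\<lambda>k. hconst (c k) * A ^ k)"

definition S2 :: "nat \<Rightarrow> (nat \<times> nat \<Rightarrow> 'a) \<Rightarrow> 'a::comm_ring_1 hser \<Rightarrow> 'a hser \<Rightarrow> 'a hser" where
  "S2 N c A B = hsum N wt2 (\<lambda>p. hconst (c p) * mono2 A B p)"

lemma hsum_reindex:
  assumes "fam N w t" "fam N w' t'" "inj h" "\<And>i. t (h i) = t' i" "\<And>i. i \<notin> range h \<Longrightarrow> t i = 0"
  shows "hsum N w t = hsum N w' t'"
proof (rule hser_eqI)
  fix \<alpha> e
  have "{i. coeff (t i) \<alpha> e \<noteq> 0} = h ` {i. coeff (t' i) \<alpha> e \<noteq> 0}"
    using assms(4,5) by (auto simp: image_iff) (metis coeff_zero rangeE)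
  then show "coeff (hsum N w t) \<alpha> e = coeff (hsum N w' t') \<alpha> e"
    using assms(3,4) by (simp add: coeff_hsum_support assms(1,2) sum.reindex inj_on_subset)
qed

lemma hsum_single:
  assumes "fam N w t" "\<And>i. i \<noteq> j \<Longrightarrow> t i = 0"
  shows "hsum N w t = t j"
proof (rule hser_eqI)
  fix \<alpha> e
  have "i \<in> {j}" if "coeff (t i) \<alpha> e \<noteq> 0" for i
    using that assms(2)[of i] by (cases "i = j") auto
  then have "coeff (hsum N w t) \<alpha> e = (\<Sum>i\<in>{j}. coeff (t i) \<alpha> e)"
    by (intro coeff_hsum_superset[OF assms(1)]) auto
  then show "coeff (hsum N w t) \<alpha> e = coeff (t j) \<alpha> e" by simp
qed

lemma upow_S1: "small N A \<Longrightarrow> upow N (S1 N c A)"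
  unfolding S1_def by (rule upow_hsum[OF fam1])

lemma upow_S2: "small N A \<Longrightarrow> small N B \<Longrightarrow> upow N (S2 N c A B)"
  unfolding S2_def by (rule upow_hsum[OF fam2])

lemma suppIn_S1: "submon Q \<Longrightarrow> small N A \<Longrightarrow> suppIn Q A \<Longrightarrow> suppIn Q (S1 N c A)"
  unfolding S1_def by (intro suppIn_hsum[OF fam1] submon_mult submon_hconst submon_power)

lemma suppIn_mono2: "submon Q \<Longrightarrow> suppIn Q A \<Longrightarrow> suppIn Q B \<Longrightarrow> suppIn Q (mono2 A B p)"
  by (simp add: mono2_def case_prod_beta submon_mult submon_power)

lemma suppIn_mono3: "submon Q \<Longrightarrow> suppIn Q A \<Longrightarrow> suppIn Q B \<Longrightarrow> suppIn Q C \<Longrightarrow> suppIn Q (mono3 A B C p)"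
  by (simp add: mono3_def case_prod_beta submon_mult submon_power)

lemma suppIn_S2: "submon Q \<Longrightarrow> small N A \<Longrightarrow> small N B \<Longrightarrow> suppIn Q A \<Longrightarrow> suppIn Q B \<Longrightarrow> suppIn Q (S2 N c A B)"
  unfolding S2_def by (intro suppIn_hsum[OF fam2] submon_mult submon_hconst suppIn_mono2)

lemma small_S1:
  assumes "small N A" "c 0 = 0"
  shows "small N (S1 N c A)"
  unfolding small_def
proof
  show "odeg N 1 (S1 N c A)" unfolding S1_def
  proof (rule suppIn_hsum[OF fam1[OF assms(1)]])
    fix k show "odeg N 1 (hconst (c k) * A ^ k)"
      using assms odeg_mono[OF odeg_hconst_mult[OF small_odeg_power[OF assms(1), of k]]]
      by (cases k) auto
  qed
qed (rule upow_S1[OF assms(1)])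

lemma subst1_coeff: "small N A \<Longrightarrow> subst1 c (coeff A) = coeff (S1 N c A)"
  by (intro ext) (simp add: subst1_def S1_def coeff_hsum_support[OF fam1] coeff_power[symmetric])

lemma S2_approx:
  assumes "small N A" "small N B" "c (0,0) = 1"
  shows "odeg N 1 (S2 N c A B - 1)"
proof -
  have "{p. wt2 p < 1} = {(0, 0)}" by (auto simp: wt2_def)
  then show ?thesis
    using hsum_approx[OF fam2[OF assms(1,2)], of 1 c] assms(3) by (simp add: S2_def mono2_def hconst_1)
qed

text \<open>Geometric series in \<open>1 - f\<close>. It stays in the subring given by
  \<open>Q\<close>, so information on the variables occurring in \<open>f\<close> passes to the
  inverse.\<close>

lemma inverse_exists:
  assumes f: "upow N f" "odeg N 1 (f - 1)" and Q: "submon Q" "suppIn Q f"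
  shows "\<exists>g. upow N g \<and> suppIn Q g \<and> f * g = 1"
proof -
  define A where "A = 1 - f"
  have A: "small N A" "suppIn Q A"
    using f suppIn_uminus[OF f(2)] Q by (auto simp: A_def small_def suppIn_diff upow_1 submon_1)
  define g where "g = S1 N (\<lambda>_. 1) A"
  have "odeg N (int d) (f * g - 1)" for d
  proof -
    have "odeg N (int d) (g - (\<Sum>i<d. A ^ i))"
      using hsum_approx[OF fam1[OF A(1)], of d "\<lambda>_. 1"] by (simp add: g_def S1_def hconst_1 lessThan_def)
    then have "odeg N (int d) (f * (g - (\<Sum>i<d. A ^ i)) - A ^ d)"
      by (rule suppIn_diff[OF odeg_mult_left[OF f(1)] small_odeg_power[OF A(1)]])
    moreover have "f * (\<Sum>i<d. A ^ i) = 1 - A ^ d"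
      using one_diff_power_eq[of A d] by (simp add: A_def)
    ultimately show ?thesis by (simp add: algebra_simps)
  qed
  then have "f * g - 1 = 0" by (rule odeg_separated)
  then show ?thesis using upow_S1[OF A(1)] suppIn_S1[OF Q(1) A] by (auto simp: g_def)
qed

definition hinv :: "'a::comm_ring_1 hser \<Rightarrow> 'a hser" where
  "hinv f = (THE g. f * g = 1)"

lemma hinv_eqI:
  assumes "f * g = 1" shows "hinv f = g"
  unfolding hinv_def
proof (rule the_equality)
  show "f * g = 1" by fact
  fix h assume "f * h = 1"
  have "h = (f * g) * h" using assms by simp
  also have "\<dots> = g * (f * h)" by (simp only: mult_ac)
  finally show "h = g" using \<open>f * h = 1\<close> by simp
qed

subsection \<open>The formal group law\<close>

text \<open>\<open>bet\<close> is the power series \<open>\<beta>\<close> in \<open>F(u, v) = u + v \<beta>(u, v)\<close>; thus \<open>\<beta>(u, 0)\<close> is the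
  series \<open>P(u)\<close> of the statement.\<close>
definition bc :: "(nat \<Rightarrow> nat \<Rightarrow> 'a::comm_ring_1) \<Rightarrow> nat \<times> nat \<Rightarrow> 'a" where
  "bc a = (\<lambda>(k, l). if k = 0 then if l = 0 then 1 else 0 else a k (Suc l))"

definition bet :: "nat \<Rightarrow> (nat \<Rightarrow> nat \<Rightarrow> 'a::comm_ring_1) \<Rightarrow> 'a hser \<Rightarrow> 'a hser \<Rightarrow> 'a hser" where
  "bet N a A B = S2 N (bc a) A B"

text \<open>The asymmetric form exhibits the factor \<open>B\<close> explicitly; splitting it off is
  what turns a difference of arguments into a multiple of a group-law difference. Symmetry is
  recovered through \<open>Fsub\<close>.\<close>

definition FF :: "nat \<Rightarrow> (nat \<Rightarrow> nat \<Rightarrow> 'a::comm_ring_1) \<Rightarrow> 'a hser \<Rightarrow> 'a hser \<Rightarrow> 'a hser" where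
  "FF N a A B = A + B * bet N a A B"

lemma upow_bet: "small N A \<Longrightarrow> small N B \<Longrightarrow> upow N (bet N a A B)"
  unfolding bet_def by (rule upow_S2)

lemma small_FF: "small N A \<Longrightarrow> small N B \<Longrightarrow> small N (FF N a A B)"
  unfolding FF_def by (intro small_add small_mult upow_bet)

lemma suppIn_bet: "submon Q \<Longrightarrow> small N A \<Longrightarrow> small N B \<Longrightarrow> suppIn Q A \<Longrightarrow> suppIn Q B \<Longrightarrow> suppIn Q (bet N a A B)"
  unfolding bet_def by (rule suppIn_S2)

lemma suppIn_FF: "submon Q \<Longrightarrow> small N A \<Longrightarrow> small N B \<Longrightarrow> suppIn Q A \<Longrightarrow> suppIn Q B \<Longrightarrow> suppIn Q (FF N a A B)"
  unfolding FF_def by (intro suppIn_add submon_mult suppIn_bet)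

lemma odeg_bet: "small N A \<Longrightarrow> small N B \<Longrightarrow> odeg N 1 (bet N a A B - 1)"
  unfolding bet_def by (rule S2_approx) (simp_all add: bc_def)

lemma FF_0_right [simp]: "FF N a A 0 = A"
  by (simp add: FF_def)

lemma Fsub_coeff_sum:
  fixes A B :: "'a::comm_ring_1 hser" and a :: "nat \<Rightarrow> nat \<Rightarrow> 'a"
  defines "v \<equiv> \<lambda>\<alpha> e p. coeff (hconst (a (fst p) (snd p)) * (A ^ fst p * B ^ snd p)) \<alpha> e"
  shows "Fsub a (coeff A) (coeff B) \<alpha> e = coeff A \<alpha> e + coeff B \<alpha> e +
    (\<Sum>p\<in>{p. 1 \<le> fst p \<and> 1 \<le> snd p \<and> v \<alpha> e p \<noteq> 0}. v \<alpha> e p)"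
  unfolding Fsub_def v_def coeff_power[symmetric] coeff_times[symmetric] coeff_hconst_mult
  by (intro arg_cong2[where f = "(+)"] refl sum.cong) auto

lemma Fsub_coeff:
  assumes A: "small N A" and B: "small N B"
  shows "Fsub a (coeff A) (coeff B) = coeff (FF N a A B)"
proof (intro ext)
  fix \<alpha> e
  let ?t = "\<lambda>p. B * (hconst (bc a p) * mono2 A B p)"
  let ?v = "\<lambda>p. coeff (hconst (a (fst p) (snd p)) * (A ^ fst p * B ^ snd p)) \<alpha> e"
  let ?Z = "{p. 1 \<le> fst p \<and> 1 \<le> snd p \<and> ?v p \<noteq> 0}"
  let ?Z' = "{p. coeff (?t p) \<alpha> e \<noteq> 0} - {(0, 0)}"
  have fam: "fam N wt2 ?t" by (rule fam_mult[OF fam2[OF A B] small_upow[OF B]])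
  \<comment> \<open>After multiplication by \<open>B\<close> the index \<open>(0, 0)\<close> carries
    the linear term \<open>B\<close>, the index \<open>(k, l)\<close> with \<open>k > 0\<close>
    carries the monomial of \<open>a k (Suc l)\<close>, and all other terms vanish. The shift in the
    second index explains the reindexing below.\<close>
  have t0: "?t (0, 0) = B" by (simp add: bc_def mono2_def hconst_1)
  have t1: "coeff (?t (k, l)) \<alpha> e = ?v (k, Suc l)" if "k \<noteq> 0" for k l
    using that by (simp add: bc_def mono2_def mult.left_commute[of B] del: coeff_hconst_mult)
  have t2: "?t (0, l) = 0" if "l \<noteq> 0" for l using that by (simp add: bc_def)
  have "{p. coeff (?t p) \<alpha> e \<noteq> 0} \<subseteq> {p. int (wt2 p) \<le> deg N \<alpha> e}"
    using fam_coeff_zero[OF fam] by (auto simp: not_le[symmetric] simp del: coeff_hconst_mult)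
  then have fin: "finite {p. coeff (?t p) \<alpha> e \<noteq> 0}" using fam_finite_int[OF fam] finite_subset by blast
  have "coeff (B * bet N a A B) \<alpha> e = coeff (hsum N wt2 ?t) \<alpha> e"
    unfolding bet_def S2_def by (subst hsum_mult[OF fam2[OF A B] small_upow[OF B]]) (rule refl)
  also have "\<dots> = (\<Sum>p\<in>insert (0, 0) ?Z'. coeff (?t p) \<alpha> e)"
    by (rule coeff_hsum_superset[OF fam]) (use fin in auto)
  also have "\<dots> = coeff B \<alpha> e + (\<Sum>p\<in>?Z'. coeff (?t p) \<alpha> e)"
    using fin t0 by (subst sum.insert) auto
  also have "(\<Sum>p\<in>?Z'. coeff (?t p) \<alpha> e) = (\<Sum>p\<in>?Z. ?v p)"
  proof (rule sum.reindex_bij_witness[where i = "\<lambda>p. (fst p, snd p - 1)" and j = "\<lambda>p. (fst p, Suc (snd p))"])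
    fix p assume p: "p \<in> ?Z'"
    obtain k l where kl: "p = (k, l)" by (cases p)
    have k: "k \<noteq> 0"
    proof
      assume "k = 0"
      then have "?t p = 0" using t2[of l] p kl by simp
      then show False using p by simp
    qed
    show "(fst p, Suc (snd p)) \<in> ?Z" using p k kl t1[OF k, of l] by simp
    show "?v (fst p, Suc (snd p)) = coeff (?t p) \<alpha> e" using k kl t1[OF k, of l] by simp
  next
    fix p assume p: "p \<in> ?Z"
    obtain k l where kl: "p = (k, Suc l)" using p by (cases p, cases "snd p") auto
    have k: "k \<noteq> 0" using p kl by auto
    show "(fst p, snd p - 1) \<in> ?Z'" using p k kl t1[OF k, of l] by simp
  qed auto
  finally have "coeff (B * bet N a A B) \<alpha> e = coeff B \<alpha> e + (\<Sum>p\<in>?Z. ?v p)" .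
  then show "Fsub a (coeff A) (coeff B) \<alpha> e = coeff (FF N a A B) \<alpha> e"
    by (simp only: Fsub_coeff_sum FF_def coeff_add add.assoc)
qed

text \<open>Symmetry is invisible in the form of \<open>FF\<close> and is read off from the double
  sum of \<open>Fsub\<close> by swapping indices.\<close>

lemma FF_commute:
  assumes "small N A" "small N B" "\<And>i j. a i j = a j i"
  shows "FF N a A B = FF N a B A"
proof (rule hser_eqI)
  fix \<alpha> e
  let ?v = "\<lambda>A B p. coeff (hconst (a (fst p) (snd p)) * (A ^ fst p * B ^ snd p)) \<alpha> e"
  have "(\<Sum>p\<in>{p. 1 \<le> fst p \<and> 1 \<le> snd p \<and> ?v A B p \<noteq> 0}. ?v A B p) =
    (\<Sum>p\<in>{p. 1 \<le> fst p \<and> 1 \<le> snd p \<and> ?v B A p \<noteq> 0}. ?v B A p)"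
    by (rule sum.reindex_bij_witness[where i = prod.swap and j = prod.swap])
       (use assms(3) in \<open>auto simp: mult.commute\<close>)
  then have "Fsub a (coeff A) (coeff B) \<alpha> e = Fsub a (coeff B) (coeff A) \<alpha> e"
    by (simp only: Fsub_coeff_sum add.commute[of "coeff A \<alpha> e"])
  then show "coeff (FF N a A B) \<alpha> e = coeff (FF N a B A) \<alpha> e"
    using assms by (simp add: Fsub_coeff)
qed

text \<open>Continuous ring homomorphisms over the constants; such maps commute with substitution
  into power series. Two instances occur: inserting small series for three variables x, and
  evaluating a variable u at some x. The subring \<open>Q\<close> is part of the notion because
  multiplicativity of the evaluation is established on series without negative powers of that
  u.\<close>

definition chom :: "nat \<Rightarrow> ((nat \<Rightarrow> nat) \<Rightarrow> (nat \<Rightarrow> int) \<Rightarrow> bool) \<Rightarrow> ('a::comm_ring_1 hser \<Rightarrow> 'a hser) \<Rightarrow> bool" where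
  "chom N Q \<phi> \<longleftrightarrow> submon Q \<and>
    (\<forall>f g. suppIn Q f \<longrightarrow> suppIn Q g \<longrightarrow> \<phi> (f - g) = \<phi> f - \<phi> g \<and> \<phi> (f * g) = \<phi> f * \<phi> g) \<and>
    (\<forall>c. \<phi> (hconst c) = hconst c) \<and>
    (\<forall>f d. suppIn Q f \<longrightarrow> odeg N (int d) f \<longrightarrow> odeg N (int d) (\<phi> f))"

context
  fixes N Q and \<phi> :: "'a::comm_ring_1 hser \<Rightarrow> 'a hser"
  assumes chom: "chom N Q \<phi>"
begin

lemma chom_submon: "submon Q" using chom by (simp add: chom_def)

lemma chom_diff: "suppIn Q f \<Longrightarrow> suppIn Q g \<Longrightarrow> \<phi> (f - g) = \<phi> f - \<phi> g"
  using chom by (simp add: chom_def)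

lemma chom_mult: "suppIn Q f \<Longrightarrow> suppIn Q g \<Longrightarrow> \<phi> (f * g) = \<phi> f * \<phi> g"
  using chom by (simp add: chom_def)

lemma chom_hconst: "\<phi> (hconst c) = hconst c"
  using chom by (simp add: chom_def)

lemma chom_cont: "suppIn Q f \<Longrightarrow> odeg N (int d) f \<Longrightarrow> odeg N (int d) (\<phi> f)"
  using chom by (simp add: chom_def)

lemma chom_0: "\<phi> 0 = 0" using chom_hconst[of 0] by simp

lemma chom_1: "\<phi> 1 = 1" using chom_hconst[of 1] by (simp add: hconst_1)

lemma chom_add: "suppIn Q f \<Longrightarrow> suppIn Q g \<Longrightarrow> \<phi> (f + g) = \<phi> f + \<phi> g"
  using chom_diff[of f "0 - g"] chom_diff[of 0 g] by (simp add: suppIn_uminus chom_0)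

lemma chom_power: "suppIn Q f \<Longrightarrow> \<phi> (f ^ k) = \<phi> f ^ k"
  by (induction k) (simp_all add: chom_1 chom_mult submon_power[OF chom_submon])

lemma chom_prod: "(\<And>i. i \<in> I \<Longrightarrow> suppIn Q (f i)) \<Longrightarrow> \<phi> (\<Prod>i\<in>I. f i) = (\<Prod>i\<in>I. \<phi> (f i))"
  by (induction I rule: infinite_finite_induct) (simp_all add: chom_1 chom_mult submon_prod[OF chom_submon])

lemma chom_mono2: "suppIn Q A \<Longrightarrow> suppIn Q B \<Longrightarrow> \<phi> (mono2 A B p) = mono2 (\<phi> A) (\<phi> B) p"
  by (simp add: mono2_def case_prod_beta chom_mult chom_power submon_power[OF chom_submon])

lemma chom_hsum:
  assumes "fam N w t" "\<And>i. suppIn Q (t i)" "fam N w (\<lambda>i. \<phi> (t i))"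
  shows "\<phi> (hsum N w t) = hsum N w (\<lambda>i. \<phi> (t i))"
  by (rule hsum_hom[where Q = Q]) (simp_all add: assms chom_diff chom_cont)

lemma chom_S1:
  assumes "small N A" "suppIn Q A" "small N (\<phi> A)"
  shows "\<phi> (S1 N c A) = S1 N c (\<phi> A)"
proof -
  have *: "\<phi> (hconst (c k) * A ^ k) = hconst (c k) * \<phi> A ^ k" for k
    using assms by (simp add: chom_mult chom_hconst chom_power submon_hconst[OF chom_submon] submon_power[OF chom_submon])
  show ?thesis
    unfolding S1_def
    by (subst chom_hsum) (simp_all add: * fam1 assms submon_mult[OF chom_submon] submon_hconst[OF chom_submon] submon_power[OF chom_submon])
qed

lemma chom_S2:
  assumes "small N A" "suppIn Q A" "small N (\<phi> A)" "small N B" "suppIn Q B" "small N (\<phi> B)"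
  shows "\<phi> (S2 N c A B) = S2 N c (\<phi> A) (\<phi> B)"
proof -
  have *: "\<phi> (hconst (c p) * mono2 A B p) = hconst (c p) * mono2 (\<phi> A) (\<phi> B) p" for p
    using assms by (simp add: chom_mult chom_hconst chom_mono2 submon_hconst[OF chom_submon] suppIn_mono2[OF chom_submon])
  show ?thesis
    unfolding S2_def
    by (subst chom_hsum) (simp_all add: * fam2 assms submon_mult[OF chom_submon] submon_hconst[OF chom_submon] suppIn_mono2[OF chom_submon])
qed

lemma chom_bet:
  assumes "small N A" "suppIn Q A" "small N (\<phi> A)" "small N B" "suppIn Q B" "small N (\<phi> B)"
  shows "\<phi> (bet N a A B) = bet N a (\<phi> A) (\<phi> B)"
  unfolding bet_def by (rule chom_S2[OF assms])

lemma chom_FF: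
  assumes "small N A" "suppIn Q A" "small N (\<phi> A)" "small N B" "suppIn Q B" "small N (\<phi> B)"
  shows "\<phi> (FF N a A B) = FF N a (\<phi> A) (\<phi> B)"
  using assms by (simp add: FF_def chom_add chom_mult chom_bet suppIn_bet[OF chom_submon] submon_mult[OF chom_submon])

end

lemma bet_0_right:
  assumes "small N A"
  shows "bet N a A 0 = S1 N (\<lambda>k. if k = 0 then 1 else a k 1) A"
  unfolding bet_def S2_def S1_def
proof (rule hsum_reindex[where h = "\<lambda>k. (k, 0)"])
  show "fam N wt2 (\<lambda>p. hconst (bc a p) * mono2 A 0 p)" by (rule fam2) (simp_all add: assms)
  show "fam N (\<lambda>k. k) (\<lambda>k. hconst (if k = 0 then 1 else a k 1) * A ^ k)" by (rule fam1[OF assms])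
  show "inj (\<lambda>k. (k, 0::nat))" by (auto simp: inj_on_def)
  fix p :: "nat \<times> nat" assume "p \<notin> range (\<lambda>k. (k, 0))"
  then have "snd p \<noteq> 0" by (cases p) auto
  then show "hconst (bc a p) * mono2 A 0 p = 0" by (simp add: mono2_def case_prod_beta power_0_left)
qed (auto simp: bc_def mono2_def)

text \<open>Associativity is assumed for the variables \<open>x\<^sub>0, x\<^sub>1, x\<^sub>2\<close> only; substituting small series
  for them carries it over to all small arguments.\<close>

abbreviation Q3 :: "(nat \<Rightarrow> nat) \<Rightarrow> (nat \<Rightarrow> int) \<Rightarrow> bool" where
  "Q3 \<equiv> \<lambda>\<alpha> e. e = 0 \<and> (\<forall>i\<ge>3. \<alpha> i = 0)"

lemma submon_Q3: "submon Q3"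
  by (auto simp: submon_def)

definition mexp :: "nat \<times> nat \<times> nat \<Rightarrow> nat \<Rightarrow> nat" where
  "mexp = (\<lambda>(i, j, k). (\<lambda>_. 0)(0 := i, Suc 0 := j, 2 := k))"

text \<open>Only coefficients of monomials in the x's of index 0, 1, 2 are read, which makes the map
  total and additive everywhere; it is a ring homomorphism on the series supported in
  \<open>Q3\<close>.\<close>

definition subst3 :: "nat \<Rightarrow> 'a::comm_ring_1 hser \<Rightarrow> 'a hser \<Rightarrow> 'a hser \<Rightarrow> 'a hser \<Rightarrow> 'a hser" where
  "subst3 N A B C f = hsum N wt3 (\<lambda>p. hconst (coeff f (mexp p) 0) * mono3 A B C p)"

lemma sum_lessThan_3:
  assumes "3 \<le> (N::nat)" "\<And>i. 3 \<le> i \<Longrightarrow> f i = (0::int)"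
  shows "(\<Sum>i<N. f i) = f 0 + f 1 + f 2"
proof -
  have "(\<Sum>i<N. f i) = (\<Sum>i<3. f i)"
    by (rule sum.mono_neutral_right) (use assms in auto)
  then show ?thesis by (simp add: eval_nat_numeral)
qed

lemma deg_mexp: "3 \<le> N \<Longrightarrow> deg N (mexp p) 0 = int (wt3 p)"
  unfolding deg_def by (subst sum_lessThan_3) (auto simp: mexp_def wt3_def case_prod_beta)

lemma Q3_mexp: "Q3 \<alpha> e \<Longrightarrow> \<alpha> = mexp (\<alpha> 0, \<alpha> 1, \<alpha> 2)"
proof (rule ext)
  fix i :: nat assume Q: "Q3 \<alpha> e"
  consider "i = 0" | "i = 1" | "i = 2" | "3 \<le> i" by linarith
  then show "\<alpha> i = mexp (\<alpha> 0, \<alpha> 1, \<alpha> 2) i" by cases (use Q in \<open>auto simp: mexp_def\<close>)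
qed

lemma mexp_inject: "mexp p = mexp q \<longleftrightarrow> p = q"
proof
  assume "mexp p = mexp q"
  then have "mexp p 0 = mexp q 0" "mexp p 1 = mexp q 1" "mexp p 2 = mexp q 2" by simp_all
  then show "p = q" by (cases p; cases q) (simp add: mexp_def)
qed simp

lemma coeff_X_power_mult:
  "coeff (X j ^ k * f) \<alpha> e = (if \<alpha> j < k then 0 else coeff f (\<alpha>(j := \<alpha> j - k)) e)"
  by (induction k arbitrary: \<alpha>) (auto simp: mult.assoc coeff_X_mult)

lemma coeff_mono3_X: "coeff (mono3 (X 0) (X 1) (X 2) p) \<alpha> e = (if \<alpha> = mexp p \<and> e = 0 then 1 else 0)"
proof -
  obtain i j k where p: "p = (i, j, k)" by (cases p)
  have "coeff (X 0 ^ i * (X 1 ^ j * (X 2 ^ k * 1))) \<alpha> e =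
    (if \<alpha> 0 < i \<or> \<alpha> 1 < j \<or> \<alpha> 2 < k then 0 else coeff 1 (\<alpha>(0 := \<alpha> 0 - i, 1 := \<alpha> 1 - j, 2 := \<alpha> 2 - k)) e)"
    by (simp add: coeff_X_power_mult del: mult_1_right)
  also have "\<dots> = (if \<alpha> = mexp p \<and> e = 0 then 1 else 0)"
  proof (cases "\<alpha> = mexp p")
    case True
    then have "\<alpha>(0 := \<alpha> 0 - i, 1 := \<alpha> 1 - j, 2 := \<alpha> 2 - k) = (\<lambda>_. 0)" by (auto simp: p mexp_def fun_eq_iff)
    moreover have "\<not> (\<alpha> 0 < i \<or> \<alpha> 1 < j \<or> \<alpha> 2 < k)" using True by (auto simp: p mexp_def)
    ultimately show ?thesis using True by (simp add: coeff_one sone_def zero_fun_def)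
  next
    case False
    have "\<alpha>(0 := \<alpha> 0 - i, 1 := \<alpha> 1 - j, 2 := \<alpha> 2 - k) \<noteq> (\<lambda>_. 0)" if "\<not> (\<alpha> 0 < i \<or> \<alpha> 1 < j \<or> \<alpha> 2 < k)"
    proof
      assume z: "\<alpha>(0 := \<alpha> 0 - i, 1 := \<alpha> 1 - j, 2 := \<alpha> 2 - k) = (\<lambda>_. 0)"
      have "\<alpha> m = mexp p m" for m
        using fun_cong[OF z, of m] that by (auto simp: p mexp_def split: if_splits)
      then show False using False by auto
    qed
    then show ?thesis using False by (auto simp: coeff_one sone_def)
  qed
  finally show ?thesis by (simp add: p mono3_def)
qed

context
  fixes N :: nat and A B C :: "'a::comm_ring_1 hser"
  assumes N: "3 \<le> N" and A: "small N A" and B: "small N B" and C: "small N C"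
begin

lemma fam_subst3: "fam N wt3 (\<lambda>p. hconst (c p) * mono3 A B C p)"
  by (rule fam3[OF A B C])

lemma subst3_diff: "subst3 N A B C (f - g) = subst3 N A B C f - subst3 N A B C g"
  unfolding subst3_def
  by (rule hser_eqI) (simp add: coeff_hsum[OF fam_subst3] sum_subtractf left_diff_distrib)

lemma subst3_cont:
  assumes "odeg N (int d) f"
  shows "odeg N (int d) (subst3 N A B C f)"
  unfolding subst3_def
proof (rule suppIn_hsum[OF fam_subst3])
  fix p
  show "odeg N (int d) (hconst (coeff f (mexp p) 0) * mono3 A B C p)"
  proof (cases "coeff f (mexp p) 0 = 0")
    case False
    then have "int d \<le> int (wt3 p)" using suppInD[OF assms False] deg_mexp[OF N] by simp
    then show ?thesis using odeg_mono[OF mono3_bounds(2)[OF A B C]] odeg_hconst_mult by blast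
  qed simp
qed

lemma upow_subst3: "upow N (subst3 N A B C f)"
  unfolding subst3_def by (rule upow_hsum[OF fam_subst3])

lemma subst3_hconst_mult: "subst3 N A B C (hconst c * f) = hconst c * subst3 N A B C f"
  unfolding subst3_def
  by (subst hsum_mult[OF fam_subst3 upow_hconst, symmetric]) (simp add: hconst_mult[symmetric] mult.assoc)

lemma subst3_X_mult:
  assumes "(m, D) \<in> {(0, A), (1, B), (2, C)}"
  shows "subst3 N A B C (X m * f) = D * subst3 N A B C f"
proof -
  have D: "upow N D" using assms A B C by (auto simp: small_def)
  \<comment> \<open>\<open>h\<close> multiplies the monomial \<open>p\<close> by the variable of
    index \<open>m\<close>. Monomials outside its range do not contain that variable, so
    \<open>X m * f\<close> has coefficient 0 there.\<close>
  define h where "h = (\<lambda>(i, j, k). if m = 0 then (Suc i, j, k) else if m = 1 then (i, Suc j, k) else (i, j, Suc k :: nat))"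
  have m: "m < 3" using assms by auto
  have h1: "mexp (h p) m \<noteq> 0" "(mexp (h p))(m := mexp (h p) m - 1) = mexp p" for p
    using m by (auto simp: h_def mexp_def case_prod_beta fun_eq_iff)
  have h2: "mono3 A B C (h p) = D * mono3 A B C p" for p
    using assms by (auto simp: h_def mono3_def case_prod_beta algebra_simps)
  have h3: "mexp p m = 0" if "p \<notin> range h" for p
  proof (rule ccontr)
    assume nz: "mexp p m \<noteq> 0"
    obtain i j k where p: "p = (i, j, k)" by (cases p)
    have "p = h (if m = 0 then (i - 1, j, k) else if m = 1 then (i, j - 1, k) else (i, j, k - 1))"
      using nz m by (auto simp: p h_def mexp_def split: if_splits)
    then show False using that by blast
  qed
  show ?thesis
    unfolding subst3_def
  proof (subst hsum_mult[OF fam_subst3 D, symmetric], rule hsum_reindex[where h = h])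
    show "fam N wt3 (\<lambda>p. D * (hconst (coeff f (mexp p) 0) * mono3 A B C p))" by (rule fam_mult[OF fam_subst3 D])
    show "inj h" by (rule injI) (auto simp: h_def split: if_splits)
    show "hconst (coeff (X m * f) (mexp (h p)) 0) * mono3 A B C (h p) = D * (hconst (coeff f (mexp p) 0) * mono3 A B C p)" for p
      using h1[of p] h2[of p] by (simp add: coeff_X_mult mult.left_commute)
    show "hconst (coeff (X m * f) (mexp p) 0) * mono3 A B C p = 0" if "p \<notin> range h" for p
      using h3[OF that] by (simp add: coeff_X_mult)
  qed (rule fam_subst3)
qed

lemma subst3_X_power_mult:
  assumes "(m, D) \<in> {(0, A), (1, B), (2, C)}"
  shows "subst3 N A B C (X m ^ k * f) = D ^ k * subst3 N A B C f"
  by (induction k) (simp_all add: subst3_X_mult[OF assms] mult.assoc)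

lemma subst3_mono3_mult:
  "subst3 N A B C (mono3 (X 0) (X 1) (X 2) p * f) = mono3 A B C p * subst3 N A B C f"
  by (simp add: mono3_def case_prod_beta mult.assoc subst3_X_power_mult)

lemma subst3_hconst: "subst3 N A B C (hconst c) = hconst c"
proof -
  have "coeff (hconst c) (mexp p) 0 = 0" if "p \<noteq> (0, 0, 0)" for p
  proof -
    have "mexp p \<noteq> mexp (0, 0, 0)" using that by (simp only: mexp_inject not_False_eq_True)
    then have "mexp p \<noteq> 0" by (simp add: mexp_def zero_fun_def fun_upd_idem)
    then show ?thesis by (simp add: coeff_hconst smono_def)
  qed
  moreover have "mexp (0, 0, 0) = 0" by (simp add: mexp_def zero_fun_def fun_upd_idem)
  ultimately show ?thesis
    unfolding subst3_def
    by (subst hsum_single[OF fam_subst3, of "(0, 0, 0)"]) (auto simp: coeff_hconst smono_def mono3_def)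
qed

end

lemma subst3_X_id:
  assumes "3 \<le> N" "suppIn Q3 f"
  shows "hsum N wt3 (\<lambda>p. hconst (coeff f (mexp p) 0) * mono3 (X 0) (X 1) (X 2) p) = f"
proof (rule hser_eqI)
  fix \<alpha> e
  have fam: "fam N wt3 (\<lambda>p. hconst (coeff f (mexp p) 0) * mono3 (X 0) (X 1) (X 2) p)"
    using assms(1) by (intro fam3 small_X) auto
  show "coeff (hsum N wt3 (\<lambda>p. hconst (coeff f (mexp p) 0) * mono3 (X 0) (X 1) (X 2) p)) \<alpha> e = coeff f \<alpha> e"
  proof (cases "Q3 \<alpha> e")
    case True
    let ?p = "(\<alpha> 0, \<alpha> 1, \<alpha> 2)"
    have a: "\<alpha> = mexp ?p" using Q3_mexp[OF True] .
    have "coeff (hsum N wt3 (\<lambda>p. hconst (coeff f (mexp p) 0) * mono3 (X 0) (X 1) (X 2) p)) \<alpha> e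
      = (\<Sum>p\<in>{?p}. coeff (hconst (coeff f (mexp p) 0) * mono3 (X 0) (X 1) (X 2) p) \<alpha> e)"
    proof (rule coeff_hsum_superset[OF fam])
      fix p assume "coeff (hconst (coeff f (mexp p) 0) * mono3 (X 0) (X 1) (X 2) p) \<alpha> e \<noteq> 0"
      then have "\<alpha> = mexp p" by (auto simp: coeff_mono3_X split: if_splits simp del: One_nat_def)
      then have "mexp p = mexp ?p" using a by simp
      then show "p \<in> {?p}" by (simp only: mexp_inject singleton_iff)
    qed simp
    also have "\<dots> = coeff f \<alpha> e" using True a[symmetric] by (simp add: coeff_mono3_X del: One_nat_def)
    finally show ?thesis .
  next
    case False
    have "suppIn Q3 (hsum N wt3 (\<lambda>p. hconst (coeff f (mexp p) 0) * mono3 (X 0) (X 1) (X 2) p))"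
      by (intro suppIn_hsum[OF fam] submon_mult submon_hconst suppIn_mono3 submon_Q3 suppIn_X) (auto simp: unit_at_def)
    then have "coeff (hsum N wt3 (\<lambda>p. hconst (coeff f (mexp p) 0) * mono3 (X 0) (X 1) (X 2) p)) \<alpha> e = 0"
      using False unfolding suppIn_def by blast
    moreover have "coeff f \<alpha> e = 0" using assms(2) False unfolding suppIn_def by blast
    ultimately show ?thesis by simp
  qed
qed

text \<open>Multiplicativity is exact when \<open>f\<close> is a finite combination of monomials. A
  general \<open>f\<close> is replaced by its truncations, and the defect of multiplicativity then
  has arbitrarily high order.\<close>

lemma chom_subst3:
  assumes N: "3 \<le> N" and A: "small N A" and B: "small N B" and C: "small N C"
  shows "chom N Q3 (subst3 N A B C)"
  unfolding chom_def
proof (intro conjI allI impI)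
  fix f g :: "'a hser" assume f: "suppIn Q3 f"
  let ?\<theta> = "subst3 N A B C"
  have famX: "fam N wt3 (\<lambda>p. hconst (coeff f (mexp p) 0) * mono3 (X 0) (X 1) (X 2) p)"
    using N by (intro fam3 small_X) auto
  have add: "?\<theta> (h + k) = ?\<theta> h + ?\<theta> k" for h k
    using subst3_diff[OF N A B C, of "h + k" k] by simp
  have zero: "?\<theta> 0 = 0" using subst3_diff[OF N A B C, of 0 0] by simp
  have sum: "?\<theta> (\<Sum>i\<in>I. h i) = (\<Sum>i\<in>I. ?\<theta> (h i))" for I and h :: "'i \<Rightarrow> 'a hser"
    by (induction I rule: infinite_finite_induct) (simp_all add: zero add)
  assume g: "suppIn Q3 g"
  then have gu: "upow N g" by (rule suppIn_mono) auto
  have "odeg N (int d) (?\<theta> (f * g) - ?\<theta> f * ?\<theta> g)" for d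
  proof -
    let ?P = "{p. wt3 p < d}"
    let ?f = "\<Sum>p\<in>?P. hconst (coeff f (mexp p) 0) * mono3 (X 0) (X 1) (X 2) p"
    let ?f' = "\<Sum>p\<in>?P. hconst (coeff f (mexp p) 0) * mono3 A B C p"
    have 1: "odeg N (int d) (f - ?f)"
      using hsum_approx[OF famX, of d] by (simp only: subst3_X_id[OF N f])
    have 2: "odeg N (int d) (?\<theta> f - ?f')"
      unfolding subst3_def by (rule hsum_approx[OF fam3[OF A B C]])
    have 3: "?\<theta> (?f * g) = ?f' * ?\<theta> g"
      by (simp add: sum_distrib_right sum mult.assoc subst3_hconst_mult[OF N A B C] subst3_mono3_mult[OF N A B C] del: One_nat_def)
    have "?\<theta> (f * g) - ?\<theta> f * ?\<theta> g = ?\<theta> ((f - ?f) * g) - (?\<theta> f - ?f') * ?\<theta> g"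
      using 3 by (simp add: left_diff_distrib subst3_diff[OF N A B C])
    then show ?thesis
      using suppIn_diff[OF subst3_cont[OF N A B C odeg_mult_right[OF gu 1]] odeg_mult_right[OF upow_subst3[OF N A B C, of g] 2]]
      by simp
  qed
  then have "?\<theta> (f * g) - ?\<theta> f * ?\<theta> g = 0" by (rule odeg_separated)
  then show "?\<theta> (f * g) = ?\<theta> f * ?\<theta> g" by simp
qed (simp_all add: submon_Q3 subst3_diff[OF assms] subst3_hconst[OF assms] subst3_cont[OF assms])

lemma subst3_X:
  assumes "3 \<le> N" "small N A" "small N B" "small N C"
  shows "subst3 N A B C (X 0) = A" "subst3 N A B C (X 1) = B" "subst3 N A B C (X 2) = C"
  using subst3_X_mult[OF assms, of _ _ 1] subst3_hconst[OF assms, of 1] by (simp_all add: hconst_1)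

subsection \<open>Associativity and the formal inverse\<close>

text \<open>One order is gained because every nonconstant term of \<open>bet\<close> contains
  \<open>A\<close>: the coefficients \<open>bc a (0, l)\<close> with \<open>l > 0\<close>
  vanish.\<close>

lemma bet_diff:
  assumes A: "small N A" and B: "small N B" and B': "small N B'" and d: "odeg N (int d) (B' - B)"
  shows "odeg N (int (Suc d)) (bet N a A B' - bet N a A B)"
proof -
  let ?P = "{p. wt2 p < Suc d}"
  let ?s = "\<lambda>B. \<Sum>p\<in>?P. hconst (bc a p) * mono2 A B p"
  have pow: "odeg N (int d) (B' ^ l - B ^ l)" for l
    unfolding power_diff_sumr2
    by (rule odeg_mult_right[OF _ d]) (intro suppIn_sum upow_mult small_upow_power B B')
  have "odeg N (int (Suc d)) (hconst (bc a p) * mono2 A B' p - hconst (bc a p) * mono2 A B p)" for p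
  proof (cases "fst p = 0")
    case True
    then show ?thesis by (cases p) (auto simp: bc_def mono2_def)
  next
    case False
    have "odeg N (int (fst p) + int d) (A ^ fst p * (B' ^ snd p - B ^ snd p))"
      by (rule odeg_mult[OF small_odeg_power[OF A] pow])
    then have "odeg N (int (Suc d)) (A ^ fst p * (B' ^ snd p - B ^ snd p))"
      by (rule odeg_mono) (use False in simp)
    then have "odeg N (int (Suc d)) (hconst (bc a p) * (A ^ fst p * (B' ^ snd p - B ^ snd p)))"
      by (rule odeg_hconst_mult)
    then show ?thesis by (simp add: mono2_def case_prod_beta right_diff_distrib)
  qed
  then have "odeg N (int (Suc d)) (?s B' - ?s B)"
    unfolding sum_subtractf[symmetric] by (rule suppIn_sum)
  moreover have "odeg N (int (Suc d)) (bet N a A B' - ?s B')" "odeg N (int (Suc d)) (bet N a A B - ?s B)"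
    unfolding bet_def S2_def using hsum_approx[OF fam2] A B B' by blast+
  ultimately have "odeg N (int (Suc d)) (((bet N a A B' - ?s B') - (bet N a A B - ?s B)) + (?s B' - ?s B))"
    by (rule suppIn_add[OF suppIn_diff, rotated -1])
  then show ?thesis by (simp add: algebra_simps)
qed

text \<open>To first order the group law is addition, so subtracting \<open>w\<close> from the
  second argument subtracts \<open>w\<close> from the value up to one higher order. This drives the
  successive approximation of the formal inverse.\<close>

lemma FF_diff:
  assumes A: "small N A" and B: "small N B" and w: "upow N w" "odeg N (int d) w" and B': "small N (B - w)"
  shows "odeg N (int (Suc d)) (FF N a A (B - w) - FF N a A B + w)"
proof -
  let ?B' = "B - w"
  have 1: "odeg N (int (Suc d)) (?B' * (bet N a A ?B' - bet N a A B))"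
    by (intro odeg_mult_left[OF small_upow[OF B']] bet_diff[OF A B B']) (use suppIn_uminus[OF w(2)] in simp)
  have 2: "odeg N (int (Suc d)) (w * (bet N a A B - 1))"
    using odeg_mult[OF w(2) odeg_bet[OF A B, of a]] by (simp add: add.commute)
  have "FF N a A ?B' - FF N a A B + w = ?B' * (bet N a A ?B' - bet N a A B) - w * (bet N a A B - 1)"
    by (simp add: FF_def algebra_simps)
  then show ?thesis using suppIn_diff[OF 1 2] by simp
qed

section \<open>The formal inverse by successive approximation\<close>

definition Q1 :: "(nat \<Rightarrow> nat) \<Rightarrow> (nat \<Rightarrow> int) \<Rightarrow> bool" where
  "Q1 \<alpha> e \<longleftrightarrow> e = 0 \<and> (\<forall>i>0. \<alpha> i = 0)"

lemma submon_Q1: "submon Q1"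
  by (auto simp: submon_def Q1_def)

lemma Q1_iff: "Q1 \<alpha> e \<longleftrightarrow> \<alpha> = (\<lambda>_. 0)(0 := \<alpha> 0) \<and> e = 0"
  unfolding Q1_def fun_eq_iff[of \<alpha>] by auto

lemma suppIn_Q1_X: "suppIn Q1 (X 0)"
  by (rule suppIn_X) (simp add: Q1_def unit_at_def)

text \<open>Each step subtracts the current defect \<open>F(x, s)\<close> from \<open>s\<close>; by
  \<open>FF_diff\<close> the new defect has order at least one higher.\<close>

primrec iseq :: "nat \<Rightarrow> (nat \<Rightarrow> nat \<Rightarrow> 'a::comm_ring_1) \<Rightarrow> nat \<Rightarrow> 'a hser" where
  "iseq N a 0 = 0"
| "iseq N a (Suc d) = iseq N a d - FF N a (X 0) (iseq N a d)"

lemma iseq: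
  assumes "0 < N"
  shows "small N (iseq N a d) \<and> suppIn Q1 (iseq N a d) \<and> odeg N (int (Suc d)) (FF N a (X 0) (iseq N a d))"
proof (induction d)
  case 0
  show ?case using small_X[OF assms, where 'a = 'a] by (simp add: small_def)
next
  case (Suc d)
  let ?s = "iseq N a d" and ?f = "FF N a (X 0) (iseq N a d)"
  have X: "small N (X 0)" "suppIn Q1 (X 0)"
    using small_X[OF assms] suppIn_Q1_X by auto
  have s: "small N ?s" "suppIn Q1 ?s" "odeg N (int (Suc d)) ?f" using Suc by auto
  have f: "small N ?f" "suppIn Q1 ?f" using s X by (auto intro: small_FF suppIn_FF submon_Q1)
  have sm: "small N (?s - ?f)" using s f by (simp add: small_diff)
  have "odeg N (int (Suc (Suc d))) (FF N a (X 0) (?s - ?f) - ?f + ?f)"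
    by (rule FF_diff[OF X(1) s(1) small_upow[OF f(1)] s(3) sm])
  then show ?case using sm suppIn_diff[OF s(2) f(2)] by simp
qed

text \<open>The corrections of \<open>iseq\<close> form a summable family. Its sum is close to every
  iterate, so its defect has arbitrarily high order.\<close>

lemma inverse_series_exists:
  assumes N: "0 < N"
  shows "\<exists>C. small N C \<and> suppIn Q1 C \<and> FF N a (X 0) C = 0"
proof -
  define t where "t d = - FF N a (X 0) (iseq N a d)" for d
  have X: "small N (X 0)" "suppIn Q1 (X 0)"
    using small_X[OF N] suppIn_Q1_X by auto
  have t: "upow N (t d)" "suppIn Q1 (t d)" "odeg N (int (Suc d)) (t d)" for d
    using iseq[OF N, of a d] X
    by (auto simp: t_def intro!: suppIn_uminus small_upow[OF small_FF] suppIn_FF submon_Q1)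
  have fam: "fam N (\<lambda>d. d) t"
    unfolding fam_def using t odeg_mono[OF t(3)] by simp
  define C where "C = hsum N (\<lambda>d. d) t"
  have "iseq N a d = (\<Sum>i<d. t i)" for d by (induction d) (simp_all add: t_def)
  then have approx: "odeg N (int d) (C - iseq N a d)" for d
    using hsum_approx[OF fam, of d] by (simp add: C_def lessThan_def)
  have up: "upow N C" unfolding C_def by (rule upow_hsum[OF fam])
  have "odeg N 1 (C - iseq N a 1 + iseq N a 1)"
    by (rule suppIn_add) (use approx[of 1] iseq[OF N, of a 1] in \<open>simp_all add: small_def\<close>)
  then have C: "small N C" using up by (simp add: small_def)
  have "odeg N (int d) (FF N a (X 0) C)" for d
  proof -
    let ?s = "iseq N a d"
    have s: "small N ?s" "odeg N (int d) (FF N a (X 0) ?s)"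
      using iseq[OF N, of a d] odeg_mono[where N = N and d = "int (Suc d)" and c = "int d"] by auto
    have w: "upow N (?s - C)" "odeg N (int d) (?s - C)"
      using s up suppIn_uminus[OF approx[of d]] by (auto simp: small_def suppIn_diff)
    have "odeg N (int (Suc d)) (FF N a (X 0) (?s - (?s - C)) - FF N a (X 0) ?s + (?s - C))"
      by (rule FF_diff[OF X(1) s(1) w]) (use C in simp)
    then have "odeg N (int d) (FF N a (X 0) C - FF N a (X 0) ?s + (?s - C))"
      using odeg_mono[where N = N and d = "int (Suc d)" and c = "int d"] by simp
    then have "odeg N (int d) ((FF N a (X 0) C - FF N a (X 0) ?s + (?s - C)) - (?s - C) + FF N a (X 0) ?s)"
      by (rule suppIn_add[OF suppIn_diff[OF _ w(2)] s(2)])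
    then show ?thesis by simp
  qed
  then have "FF N a (X 0) C = 0" by (rule odeg_separated)
  moreover have "suppIn Q1 C" unfolding C_def by (rule suppIn_hsum[OF fam t(2)])
  ultimately show ?thesis using C by blast
qed

lemma coeff_X_power: "coeff (X 0 ^ k) \<alpha> e = (if \<alpha> = (\<lambda>_. 0)(0 := k) \<and> e = 0 then 1 else 0)"
  using coeff_mono3_X[of "(k, 0, 0)" \<alpha> e] by (simp add: mono3_def mexp_def fun_upd_idem)

lemma coeff_S1_X:
  assumes "0 < N"
  shows "coeff (S1 N c (X 0)) \<alpha> e = (if Q1 \<alpha> e then c (\<alpha> 0) else 0)"
proof -
  have "coeff (S1 N c (X 0)) \<alpha> e = (\<Sum>k\<in>{\<alpha> 0}. coeff (hconst (c k) * X 0 ^ k) \<alpha> e)"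
    unfolding S1_def
  proof (rule coeff_hsum_superset[OF fam1[OF small_X[OF assms]]])
    fix k assume "coeff (hconst (c k) * X 0 ^ k) \<alpha> e \<noteq> 0"
    then have "\<alpha> = (\<lambda>_. 0)(0 := k)" by (auto simp: coeff_X_power split: if_splits)
    then show "k \<in> {\<alpha> 0}" by simp
  qed simp
  also have "\<dots> = (if Q1 \<alpha> e then c (\<alpha> 0) else 0)"
    unfolding Q1_iff by (simp add: coeff_X_power)
  finally show ?thesis .
qed

locale fgl =
  fixes a :: "nat \<Rightarrow> nat \<Rightarrow> 'a::comm_ring_1" and N :: nat
  assumes is_fgl: "is_fgl a" and N: "3 \<le> N"
begin

abbreviation F :: "'a hser \<Rightarrow> 'a hser \<Rightarrow> 'a hser" where "F \<equiv> FF N a"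
abbreviation beta :: "'a hser \<Rightarrow> 'a hser \<Rightarrow> 'a hser" where "beta \<equiv> bet N a"
abbreviation smallN :: "'a hser \<Rightarrow> bool" where "smallN \<equiv> small N"

lemma F_commute: "smallN A \<Longrightarrow> smallN B \<Longrightarrow> F A B = F B A"
  using is_fgl by (intro FF_commute) (auto simp: is_fgl_def)

lemma F_0_left: "smallN A \<Longrightarrow> F 0 A = A"
  by (simp add: F_commute[of 0])

lemma F_assoc:
  assumes A: "smallN A" and B: "smallN B" and C: "smallN C"
  shows "F (F A B) C = F A (F B C)"
proof -
  have X: "smallN (X 0)" "smallN (X 1)" "smallN (X 2)" using N by (auto intro: small_X)
  have QX: "suppIn Q3 (X 0)" "suppIn Q3 (X 1)" "suppIn Q3 (X 2)"
    by (auto intro!: suppIn_X simp: unit_at_def)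
  have "coeff (F (F (X 0) (X 1)) (X 2)) = coeff (F (X 0) (F (X 1) (X 2)))"
    using is_fgl X unfolding is_fgl_def
    by (simp add: coeff_X[symmetric] Fsub_coeff[of N] small_FF del: One_nat_def)
  then have eq: "F (F (X 0) (X 1)) (X 2) = F (X 0) (F (X 1) (X 2))" by (simp only: coeff_inject)
  let ?\<theta> = "subst3 N A B C"
  note ch = chom_subst3[OF N A B C]
  note sX = subst3_X[OF N A B C]
  note S = A B C X QX sX small_FF[OF A B] small_FF[OF B C] small_FF[OF X(1,2)] small_FF[OF X(2,3)]
    suppIn_FF[OF submon_Q3 X(1,2) QX(1,2)] suppIn_FF[OF submon_Q3 X(2,3) QX(2,3)]
  have 1: "?\<theta> (F (X 0) (X 1)) = F A B"
    by (subst chom_FF[OF ch]) (simp_all only: S)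
  have 2: "?\<theta> (F (X 1) (X 2)) = F B C"
    by (subst chom_FF[OF ch]) (simp_all only: S)
  have 3: "?\<theta> (F (F (X 0) (X 1)) (X 2)) = F (F A B) C"
    by (subst chom_FF[OF ch]) (simp_all only: S 1)
  have 4: "?\<theta> (F (X 0) (F (X 1) (X 2))) = F A (F B C)"
    by (subst chom_FF[OF ch]) (simp_all only: S 2)
  show ?thesis using eq 3 4 by simp
qed

lemma inverse_unique:
  assumes "smallN A" "smallN C" "smallN C'" "F A C = 0" "F A C' = 0"
  shows "C = C'"
proof -
  have "C = F (F C' A) C" using assms by (simp add: F_0_left F_commute[of C' A])
  also have "\<dots> = F C' (F A C)" using assms by (intro F_assoc)
  finally show ?thesis using assms by simp
qed

definition inv :: "'a hser \<Rightarrow> 'a hser" where "inv A = S1 N (ibar a) A"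

text \<open>Existence for this definite description is the limit just constructed, with coefficients
  \<open>b\<close> in the first variable. Uniqueness combines uniqueness of inverses in the group
  law with comparison of coefficients.\<close>

lemma ibar: "ibar a 0 = 0 \<and> F (X 0) (S1 N (ibar a) (X 0)) = 0"
proof -
  have X: "smallN (X 0)" using N by (auto intro: small_X)
  have N0: "0 < N" using N by simp
  \<comment> \<open>\<open>b 0 = 0\<close> makes the substituted series small, so the equation
    between bare functions becomes one in the ring.\<close>
  have conv: "Fsub a (xvar 0) (subst1 b (xvar 0)) = szero \<longleftrightarrow> F (X 0) (S1 N b (X 0)) = 0" if "b 0 = 0" for b
  proof -
    have "Fsub a (xvar 0) (subst1 b (xvar 0)) = coeff (F (X 0) (S1 N b (X 0)))"
      using X that by (simp add: coeff_X[symmetric] subst1_coeff[of N] Fsub_coeff[of N] small_S1)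
    then show ?thesis by (simp only: coeff_zero'[symmetric] coeff_inject)
  qed
  obtain C where C: "smallN C" "suppIn Q1 C" "F (X 0) C = 0" using inverse_series_exists[OF N0] by blast
  define b where "b k = coeff C ((\<lambda>_. 0)(0 := k)) 0" for k
  have b0: "b 0 = 0"
  proof -
    have "\<not> 1 \<le> deg N ((\<lambda>_. 0)(0 := 0)) 0" by (simp add: deg_def fun_upd_idem)
    then show ?thesis using small_odeg[OF C(1)] unfolding b_def suppIn_def by blast
  qed
  have SC: "S1 N b (X 0) = C"
  proof (rule hser_eqI)
    fix \<alpha> e
    show "coeff (S1 N b (X 0)) \<alpha> e = coeff C \<alpha> e"
    proof (cases "Q1 \<alpha> e")
      case True
      then have "b (\<alpha> 0) = coeff C \<alpha> e" using Q1_iff[of \<alpha> e] by (simp add: b_def)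
      then show ?thesis using True by (simp add: coeff_S1_X[OF N0])
    next
      case False
      then have "coeff C \<alpha> e = 0" using C(2) unfolding suppIn_def by blast
      then show ?thesis using False by (simp add: coeff_S1_X[OF N0])
    qed
  qed
  have "ibar a = b"
    unfolding ibar_def
  proof (rule the_equality)
    show "b 0 = 0 \<and> Fsub a (xvar 0) (subst1 b (xvar 0)) = szero" using b0 conv[of b] SC C by simp
    fix b' assume b': "b' 0 = 0 \<and> Fsub a (xvar 0) (subst1 b' (xvar 0)) = szero"
    then have F0: "F (X 0) (S1 N b' (X 0)) = 0" using conv[of b'] by blast
    have "smallN (S1 N b' (X 0))" using small_S1[OF X, of b'] b' by blast
    then have "S1 N b' (X 0) = C" by (rule inverse_unique[OF X _ C(1) F0 C(3)])
    then have eq: "S1 N b' (X 0) = S1 N b (X 0)" using SC by simp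
    show "b' = b"
    proof
      fix k
      have "coeff (S1 N b' (X 0)) ((\<lambda>_. 0)(0 := k)) 0 = coeff (S1 N b (X 0)) ((\<lambda>_. 0)(0 := k)) 0" using eq by simp
      then show "b' k = b k" by (simp add: coeff_S1_X[OF N0] Q1_def)
    qed
  qed
  then show ?thesis using b0 SC C by simp
qed

lemma small_inv: "smallN A \<Longrightarrow> smallN (inv A)"
  unfolding inv_def using ibar by (intro small_S1) auto

text \<open>The identity is known for the variable \<open>X 0\<close>; substituting \<open>A\<close>
  for it, and 0 for the other two variables, gives the general case.\<close>

lemma F_inv:
  assumes A: "smallN A"
  shows "F A (inv A) = 0"
proof -
  have X: "smallN (X 0)" using N by (auto intro: small_X)
  have QX: "suppIn Q3 (X 0)" by (auto intro!: suppIn_X simp: unit_at_def)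
  note ch = chom_subst3[OF N A small_0 small_0]
  note sX = subst3_X(1)[OF N A small_0 small_0]
  have i: "smallN (S1 N (ibar a) (X 0))" "smallN (S1 N (ibar a) A)" "suppIn Q3 (S1 N (ibar a) (X 0))"
    using ibar X A QX by (auto intro: small_S1 suppIn_S1 submon_Q3)
  have 1: "subst3 N A 0 0 (S1 N (ibar a) (X 0)) = S1 N (ibar a) A"
    by (subst chom_S1[OF ch]) (simp_all only: X A QX sX)
  have "subst3 N A 0 0 (F (X 0) (S1 N (ibar a) (X 0))) = F A (S1 N (ibar a) A)"
    by (subst chom_FF[OF ch]) (simp_all only: X A QX sX i 1)
  then show ?thesis using ibar chom_0[OF ch] by (simp add: inv_def)
qed

text \<open>\<open>A = B +\<^sub>L (A +\<^sub>L C)\<close> when \<open>C\<close> is the inverse of \<open>B\<close>.\<close>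
lemma diff_eq_F_mult:
  assumes A: "smallN A" and B: "smallN B" and C: "smallN C" and BC: "F B C = 0"
  shows "A - B = F A C * beta B (F A C)"
proof -
  have "F B (F A C) = F (F B C) A"
    unfolding F_assoc[OF B C A] by (simp only: F_commute[OF A C])
  then have "F B (F A C) = A" using BC A by (simp add: F_0_left)
  then show ?thesis by (simp add: FF_def[of N a B] algebra_simps)
qed

lemma beta_unit:
  assumes "smallN A" "smallN B" "submon Q" "suppIn Q A" "suppIn Q B"
  shows "\<exists>g. upow N g \<and> suppIn Q g \<and> beta A B * g = 1"
  using assms by (intro inverse_exists upow_bet odeg_bet suppIn_bet)

end

subsection \<open>Inverses of differences and evaluation of a variable\<close>

lemma deg_upd: "j < N \<Longrightarrow> deg N \<alpha> (e(j := k)) = deg N \<alpha> e - e j + k"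
proof -
  assume j: "j < N"
  have "(\<Sum>i<N. int (\<alpha> i) + (e(j := k)) i) = (\<Sum>i<N. int (\<alpha> i) + e i) + (\<Sum>i<N. if i = j then k - e j else 0)"
    unfolding sum.distrib[symmetric] by (rule sum.cong) auto
  then show ?thesis using j by (simp add: deg_def)
qed

text \<open>The series \<open>\<Sum>\<^sub>m B\<^sup>m u\<^sub>j\<^sup>-\<^sup>1\<^sup>-\<^sup>m\<close>, the inverse of \<open>u\<^sub>j - B\<close> when \<open>B\<close> involves only
  more significant variables u than \<open>u\<^sub>j\<close>.\<close>
definition uinv :: "nat \<Rightarrow> 'a::comm_ring_1 hser \<Rightarrow> 'a hser" where
  "uinv j B = Abs_hser (\<lambda>\<alpha> e. if e j \<le> - 1 then coeff (B ^ nat (- 1 - e j)) \<alpha> (e(j := 0)) else 0)"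

abbreviation ubelow :: "nat \<Rightarrow> 'a::comm_ring_1 hser \<Rightarrow> bool" where
  "ubelow j \<equiv> suppIn (\<lambda>\<alpha> e. \<forall>k\<ge>j. e k = 0)"

lemma submon_ubelow: "submon (\<lambda>\<alpha> e. \<forall>k\<ge>j. e k = (0::int))"
  by (simp add: submon_def)

lemma ubelow_ufree: "ubelow j B \<Longrightarrow> j \<le> k \<Longrightarrow> ufree k B"
  by (erule suppIn_mono) auto

lemma coeff_uinv:
  assumes B: "small N B" "ubelow j B"
  shows "coeff (uinv j B) \<alpha> e = (if e j \<le> - 1 then coeff (B ^ nat (- 1 - e j)) \<alpha> (e(j := 0)) else 0)"
proof -
  let ?g = "\<lambda>\<alpha> e. if e j \<le> - 1 then coeff (B ^ nat (- 1 - e j)) \<alpha> (e(j := 0)) else 0"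
  have "wf_ser ?g"
    unfolding wf_ser_def
  proof (intro conjI allI impI)
    fix \<alpha> e assume "?g \<alpha> e \<noteq> 0"
    then have nz: "coeff (B ^ nat (- 1 - e j)) \<alpha> (e(j := 0)) \<noteq> 0" by (auto split: if_splits)
    then have fin: "finite {i. \<alpha> i \<noteq> 0}" "finite {i. (e(j := 0)) i \<noteq> 0}"
      using wf_coeff[of "B ^ nat (- 1 - e j)"] unfolding wf_ser_def by blast+
    show "finite {i. \<alpha> i \<noteq> 0}" by fact
    have "{i. e i \<noteq> 0} \<subseteq> insert j {i. (e(j := 0)) i \<noteq> 0}" by auto
    then show "finite {i. e i \<noteq> 0}" using fin(2) finite_subset by blast
  next
    fix \<alpha>
    have supp: "e j \<le> - 1 \<and> (\<forall>i>j. e i = 0) \<and> (\<forall>i<j. 0 \<le> e i) \<and> - 1 - deg N \<alpha> (\<lambda>i. if i < j then e i else 0) \<le> e j"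
      if e: "e \<in> {e. ?g \<alpha> e \<noteq> 0}" for e
    proof -
      let ?m = "nat (- 1 - e j)"
      have ej: "e j \<le> - 1" and nz: "coeff (B ^ ?m) \<alpha> (e(j := 0)) \<noteq> 0" using e by (auto split: if_splits)
      have 1: "\<forall>k\<ge>j. (e(j := 0)) k = 0"
        using suppInD[OF submon_power[OF submon_ubelow B(2), of ?m] nz] .
      have 2: "\<forall>k. 0 \<le> (e(j := 0)) k"
        using suppInD[OF small_upow_power[OF B(1), of ?m] nz] by blast
      have 3: "int ?m \<le> deg N \<alpha> (e(j := 0))"
        using suppInD[OF small_odeg_power[OF B(1), of ?m] nz] .
      have 4: "e(j := 0) = (\<lambda>i. if i < j then e i else 0)" using 1 by (auto simp: fun_eq_iff not_less split: if_splits)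
      have 5: "\<forall>i>j. e i = 0"
      proof (intro allI impI)
        fix i assume "j < i" then show "e i = 0" using spec[OF 1, of i] by (auto split: if_splits)
      qed
      have 6: "\<forall>i<j. 0 \<le> e i"
      proof (intro allI impI)
        fix i assume "i < j" then show "0 \<le> e i" using spec[OF 2, of i] by (auto split: if_splits)
      qed
      show ?thesis using ej 3 5 6 unfolding 4 by auto
    qed
    show "lex_wo {e. ?g \<alpha> e \<noteq> 0}"
    \<comment> \<open>The exponent of \<open>U j\<close> has no uniform lower bound. But
      \<open>B ^ m\<close> has order at least \<open>m\<close>, so for fixed \<open>\<alpha>\<close>
      the exponent \<open>- 1 - m\<close> is bounded below in terms of the exponents of the more
      significant variables, which a lexicographic well-order permits.\<close>
    proof (rule lex_wo_bounded[where N = "Suc j" and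
          b = "\<lambda>k e. if k < j then 0 else - 1 - deg N \<alpha> (\<lambda>i. if i < j then e i else 0)"])
      fix e i assume e: "e \<in> {e. ?g \<alpha> e \<noteq> 0}"
      note s = supp[OF e]
      show "Suc j \<le> i \<Longrightarrow> e i = 0" using s by simp
      show "i < Suc j \<Longrightarrow> (if i < j then 0 else - 1 - deg N \<alpha> (\<lambda>i. if i < j then e i else 0)) \<le> e i"
        using s by (auto simp: less_Suc_eq)
    next
      fix d e :: "nat \<Rightarrow> int" and i assume "\<And>k. k < i \<Longrightarrow> d k = e k"
      then show "(if i < j then 0 else - 1 - deg N \<alpha> (\<lambda>i. if i < j then d i else 0)) =
        (if i < j then 0 else - 1 - deg N \<alpha> (\<lambda>i. if i < j then e i else 0))"
        by (auto intro!: arg_cong[where f = "deg N \<alpha>"])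
    qed
  qed
  then show ?thesis unfolding uinv_def by (simp add: coeff_Abs)
qed

lemma ucf_uinv:
  assumes B: "small N B" "ubelow j B"
  shows "ucf j k (uinv j B) = (if k \<le> - 1 then B ^ nat (- 1 - k) else 0)"
proof (rule hser_eqI)
  fix \<alpha> e
  have "ufree j (B ^ nat (- 1 - k))" by (intro submon_power submon_ufree ubelow_ufree[OF B(2)]) simp
  then have "e j \<noteq> 0 \<Longrightarrow> coeff (B ^ nat (- 1 - k)) \<alpha> e = 0" unfolding suppIn_def by blast
  then show "coeff (ucf j k (uinv j B)) \<alpha> e = coeff (if k \<le> - 1 then B ^ nat (- 1 - k) else 0) \<alpha> e"
    by (simp add: coeff_ucf coeff_uinv[OF B] fun_upd_idem)
qed

lemma uinv:
  assumes B: "small N B" "ubelow j B"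
  shows "(U j - B) * uinv j B = 1"
proof (rule ucf_eqI)
  fix k
  have f: "ufree j B" using B(2) by (rule ubelow_ufree) simp
  have e: "nat (- k) = Suc (nat (- 1 - k))" if "k \<le> - 1" using that by simp
  show "ucf j k ((U j - B) * uinv j B) = ucf j k 1"
    by (auto simp: left_diff_distrib ucf_diff ucf_U_mult ucf_mult[OF f] ucf_uinv[OF B]
        ucf_ufree[OF submon_1[OF submon_ufree]] e)
qed

lemma suppIn_uinv:
  assumes B: "small N B" "ubelow j B" and Q: "submon Q" "suppIn Q B"
    and R: "\<And>\<alpha> e. Q \<alpha> (e(j := 0)) \<Longrightarrow> e j \<le> - 1 \<Longrightarrow> R \<alpha> e"
  shows "suppIn R (uinv j B)"
  unfolding suppIn_def
proof (intro allI impI)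
  fix \<alpha> e assume "coeff (uinv j B) \<alpha> e \<noteq> 0"
  then have "e j \<le> - 1" "coeff (B ^ nat (- 1 - e j)) \<alpha> (e(j := 0)) \<noteq> 0"
    by (auto simp: coeff_uinv[OF B] split: if_splits)
  then show "R \<alpha> e" using R suppInD[OF submon_power[OF Q]] by blast
qed

lemma odeg_uinv:
  assumes B: "small N B" "ubelow j B" and j: "j < N"
  shows "odeg N (- 1) (uinv j B)"
  unfolding suppIn_def
proof (intro allI impI)
  fix \<alpha> e assume "coeff (uinv j B) \<alpha> e \<noteq> 0"
  then have "e j \<le> - 1" "coeff (B ^ nat (- 1 - e j)) \<alpha> (e(j := 0)) \<noteq> 0"
    by (auto simp: coeff_uinv[OF B] split: if_splits)
  then have "int (nat (- 1 - e j)) \<le> deg N \<alpha> (e(j := 0))"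
    using suppInD[OF small_odeg_power[OF B(1)]] by blast
  then show "- 1 \<le> deg N \<alpha> e" using \<open>e j \<le> - 1\<close> by (simp add: deg_upd[OF j])
qed

section \<open>Division with remainder by u_i - x_s and evaluation at u_i = x_s\<close>

lemma ufree_X: "ufree i (X s)" by (simp add: suppIn_X)

lemma ubelow_X: "ubelow i (X s)" by (simp add: suppIn_X)

lemma upos_U: "upos i (U j)" by (rule suppIn_U) (simp add: unit_at_def)

lemma ufree_U: "i \<noteq> j \<Longrightarrow> ufree i (U j)" by (rule suppIn_U) simp

text \<open>The part without negative powers of \<open>U i\<close>. Applied to
  \<open>f / (U i - X s)\<close> it yields the quotient in the division of \<open>f\<close> by
  \<open>U i - X s\<close>.\<close>

definition upart :: "nat \<Rightarrow> 'a::comm_ring_1 hser \<Rightarrow> 'a hser" where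
  "upart i f = Abs_hser (\<lambda>\<alpha> e. if 0 \<le> e i then coeff f \<alpha> e else 0)"

lemma coeff_upart: "coeff (upart i f) \<alpha> e = (if 0 \<le> e i then coeff f \<alpha> e else 0)"
proof -
  have "wf_ser (\<lambda>\<alpha> e. if 0 \<le> e i then coeff f \<alpha> e else 0)"
    unfolding wf_ser_iff
    by (rule wfset_subset[of "supp (coeff f)"], simp only: wf_ser_iff[symmetric] wf_coeff)
       (auto simp: supp_def split: if_splits)
  then show ?thesis unfolding upart_def by (simp add: coeff_Abs)
qed

lemma upos_upart: "upos i (upart i f)"
  by (auto simp: suppIn_def coeff_upart split: if_splits)

lemma ucf_upart: "ucf i k (upart i f) = (if 0 \<le> k then ucf i k f else 0)"
  by (rule hser_eqI) (simp add: coeff_ucf coeff_upart)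

text \<open>Evaluation at \<open>u\<^sub>i = x\<^sub>s\<close>, written as the residue of \<open>f / (u\<^sub>i - x\<^sub>s)\<close>.\<close>
definition uev :: "nat \<Rightarrow> nat \<Rightarrow> 'a::comm_ring_1 hser \<Rightarrow> 'a hser" where
  "uev i s f = ucf i (- 1) (f * uinv i (X s))"

context
  fixes N i s :: nat
  assumes i: "i < N" and s: "s < N"
begin

lemma uinv_X: "(U i - X s) * uinv i (X s) = 1"
  using small_X[OF s] ubelow_X by (rule uinv)

lemma ucf_uinv_X: "ucf i k (uinv i (X s)) = (if k \<le> - 1 then X s ^ nat (- 1 - k) else 0)"
  using small_X[OF s] ubelow_X by (rule ucf_uinv)

lemma uev_diff: "uev i s (f - g) = uev i s f - uev i s g"
  by (simp add: uev_def left_diff_distrib ucf_diff)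

lemma uev_add: "uev i s (f + g) = uev i s f + uev i s g"
  by (simp add: uev_def distrib_right ucf_add)

lemma uev_ufree: "ufree i f \<Longrightarrow> uev i s f = f"
  by (simp add: uev_def ucf_mult ucf_uinv_X)

lemma ufree_uev: "ufree i (uev i s f)"
  unfolding uev_def by (rule ufree_ucf)

lemma uev_multiple: "upos i g \<Longrightarrow> uev i s ((U i - X s) * g) = 0"
proof -
  assume g: "upos i g"
  have "(U i - X s) * g * uinv i (X s) = (U i - X s) * uinv i (X s) * g" by (simp only: mult_ac)
  then show ?thesis using g by (simp add: uev_def uinv_X ucf_upos)
qed

text \<open>Division with remainder: the quotient is the part of \<open>f / (U i - X s)\<close>
  without negative powers, and the remainder is the residue.\<close>

lemma uev_remainder:
  assumes f: "upos i f"
  obtains g where "upos i g" "f = uev i s f + (U i - X s) * g"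
proof
  let ?q = "f * uinv i (X s)" and ?g = "upart i (f * uinv i (X s))"
  show "upos i ?g" by (rule upos_upart)
  have fX: "ufree i (X s :: 'a hser)" by (rule ufree_X)
  have "f = f * ((U i - X s) * uinv i (X s))" by (simp add: uinv_X)
  also have "\<dots> = U i * ?q - X s * ?q" by (simp only: left_diff_distrib right_diff_distrib mult_ac)
  finally have "f = U i * ?q - X s * ?q" .
  then have q: "ucf i k f = ucf i (k - 1) ?q - X s * ucf i k ?q" for k
    by (metis ucf_diff ucf_U_mult ucf_mult[OF fX])
  have "f - uev i s f = (U i - X s) * ?g"
  proof (rule ucf_eqI)
    fix k
    have r: "ucf i k ((U i - X s) * ?g) = ucf i (k - 1) ?g - X s * ucf i k ?g"
      by (simp only: left_diff_distrib ucf_diff ucf_U_mult ucf_mult[OF fX])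
    \<comment> \<open>Truncating the quotient matters only at \<open>k = 0\<close>: there the lost
      coefficient of exponent -1 is exactly the remainder. For \<open>k > 0\<close> the recurrence
      \<open>q\<close> is unchanged, and for \<open>k < 0\<close> both sides vanish.\<close>
    consider "k < 0" | "k = 0" | "0 < k" by linarith
    then show "ucf i k (f - uev i s f) = ucf i k ((U i - X s) * ?g)"
    proof cases
      case 1
      then show ?thesis unfolding r ucf_upart by (simp add: ucf_diff ucf_ufree[OF ufree_uev] ucf_upos[OF f])
    next
      case 2
      then show ?thesis unfolding r ucf_upart ucf_diff q[of k] by (simp add: ucf_ufree[OF ufree_uev], simp add: uev_def)
    next
      case 3
      then show ?thesis unfolding r ucf_upart ucf_diff q[of k] by (simp add: ucf_ufree[OF ufree_uev])
    qed
  qed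
  then show "f = uev i s f + (U i - X s) * ?g" by (simp add: algebra_simps)
qed

text \<open>With both factors divided by \<open>U i - X s\<close>, the product differs from the
  product of the remainders by a multiple of \<open>U i - X s\<close>, whose residue is 0.\<close>

lemma uev_mult:
  assumes f: "upos i f" and g: "upos i g"
  shows "uev i s (f * g) = uev i s f * uev i s g"
proof -
  obtain f' where f': "upos i f'" "f = uev i s f + (U i - X s) * f'" using uev_remainder[OF f] .
  obtain g' where g': "upos i g'" "g = uev i s g + (U i - X s) * g'" using uev_remainder[OF g] .
  let ?a = "uev i s f" and ?b = "uev i s g" and ?d = "U i - X s"
  have ab: "ufree i ?a" "ufree i ?b" by (rule ufree_uev)+
  have d: "upos i ?d" by (intro suppIn_diff upos_U ufree_upos ufree_X)
  let ?h = "?a * g' + f' * ?b + ?d * (f' * g')"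
  have h: "upos i ?h"
    by (intro suppIn_add submon_mult[OF submon_upos] ufree_upos ab f' g' d)
  have "f * g = (?a + ?d * f') * (?b + ?d * g')" using f'(2) g'(2) by simp
  also have "\<dots> = ?a * ?b + ?d * ?h" by (simp only: distrib_left distrib_right mult_ac add_ac)
  finally have "uev i s (f * g) = uev i s (?a * ?b)" by (simp add: uev_add uev_multiple[OF h])
  then show ?thesis by (simp add: uev_ufree submon_mult[OF submon_ufree ab])
qed

text \<open>Since x and u have the same weight, dividing by \<open>U i - X s\<close> costs one
  degree, and passing to the coefficient of exponent -1 regains it.\<close>

lemma uev_cont:
  assumes "odeg N d f"
  shows "odeg N d (uev i s f)"
proof -
  have 1: "odeg N (d + (- 1)) (f * uinv i (X s))"
    using assms odeg_uinv[OF small_X[OF s] ubelow_X i] by (rule odeg_mult)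
  show ?thesis
    unfolding suppIn_def uev_def
  proof (intro allI impI)
    fix \<alpha> e assume "coeff (ucf i (- 1) (f * uinv i (X s))) \<alpha> e \<noteq> 0"
    then have "e i = 0" "coeff (f * uinv i (X s)) \<alpha> (e(i := - 1)) \<noteq> 0"
      by (auto simp: coeff_ucf split: if_splits)
    then show "d \<le> deg N \<alpha> e" using suppInD[OF 1, of \<alpha> "e(i := - 1)"] by (simp add: deg_upd[OF i])
  qed
qed

lemma chom_uev: "chom N (\<lambda>\<alpha> e. 0 \<le> e i) (uev i s)"
  unfolding chom_def
  by (intro conjI allI impI submon_upos uev_diff uev_mult uev_cont uev_ufree suppIn_hconst) simp_all

lemma uev_U: "uev i s (U i) = X s"
proof -
  have "uev i s ((U i - X s) * 1) = 0" by (intro uev_multiple submon_1[OF submon_upos])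
  then show ?thesis by (simp add: uev_diff uev_ufree[OF ufree_X])
qed

lemma ucf_mult_uinv:
  assumes f: "upos i f" and k: "0 < k"
  shows "ucf i (- int k) (f * uinv i (X s)) = uev i s f * X s ^ (k - 1)"
proof -
  obtain g where g: "upos i g" "f = uev i s f + (U i - X s) * g" using uev_remainder[OF f] .
  have "f * uinv i (X s) = (uev i s f + (U i - X s) * g) * uinv i (X s)" using g(2) by simp
  also have "\<dots> = uev i s f * uinv i (X s) + ((U i - X s) * uinv i (X s)) * g" by (simp only: distrib_left distrib_right mult_ac)
  finally have "f * uinv i (X s) = uev i s f * uinv i (X s) + g" by (simp add: uinv_X)
  then have "ucf i (- int k) (f * uinv i (X s)) = uev i s f * ucf i (- int k) (uinv i (X s)) + ucf i (- int k) g"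
    by (metis ucf_add ucf_mult[OF ufree_uev])
  moreover have "nat (- 1 - - int k) = k - 1" using k by simp
  ultimately show ?thesis using g(1) k by (simp add: ucf_uinv_X ucf_upos)
qed

end

subsection \<open>Partial fractions\<close>

lemma prod_cancel:
  fixes y :: "'i \<Rightarrow> 'b::comm_ring_1"
  assumes "finite S" "\<And>l f. l \<in> S \<Longrightarrow> y l * f = 0 \<Longrightarrow> f = 0" "(\<Prod>l\<in>S. y l) * f = 0"
  shows "f = 0"
  using assms
proof (induction S rule: finite_induct)
  case (insert l S)
  have "y l * ((\<Prod>l\<in>S. y l) * f) = 0" using insert by (simp add: mult.assoc)
  then have "(\<Prod>l\<in>S. y l) * f = 0" using insert.prems(1)[of l] by blast
  then show ?case using insert.IH insert.prems(1) by blast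
qed simp

text \<open>Lagrange interpolation of the constant \<open>d\<close> at the points
  \<open>x j\<close>, with \<open>c j\<close> in the role of \<open>d\<close> divided by the product
  of differences. The differences are merely required to be cancellable.\<close>

lemma partial_fractions:
  fixes x :: "'i \<Rightarrow> 'b::comm_ring_1"
  assumes "finite S" "S \<noteq> {}"
    and "\<And>p q f. p \<in> S \<Longrightarrow> q \<in> S \<Longrightarrow> p \<noteq> q \<Longrightarrow> (x p - x q) * f = 0 \<Longrightarrow> f = 0"
    and "\<And>j. j \<in> S \<Longrightarrow> c j * (\<Prod>l\<in>S - {j}. x j - x l) = d"
  shows "(\<Sum>j\<in>S. c j * (\<Prod>l\<in>S - {j}. u - x l)) = d"
  using assms
proof (induction S arbitrary: c u rule: finite_ne_induct)
  case (insert s S)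
  have diff: "insert s S - {s} = S" "\<And>j. j \<in> S \<Longrightarrow> insert s S - {j} = insert s (S - {j})"
    using insert.hyps by auto
  define T where "T = (\<Sum>j\<in>S. c j)"
  have main: "d = (v - x s) * (\<Sum>j\<in>S. c j * (\<Prod>l\<in>S - {j}. v - x l)) - T * (\<Prod>l\<in>S. v - x l)" for v
  proof -
    \<comment> \<open>The induction hypothesis is used with the coefficients
      \<open>c j * (x j - x s)\<close>; writing \<open>x j - x s\<close> as
      \<open>(v - x s) - (v - x j)\<close> then separates two sums.\<close>
    have "(\<Sum>j\<in>S. c j * (x j - x s) * (\<Prod>l\<in>S - {j}. v - x l)) = d"
    proof (rule insert.IH)
      fix j assume j: "j \<in> S"
      have "c j * (\<Prod>l\<in>insert s S - {j}. x j - x l) = d" using insert.prems(2) j by blast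
      then show "c j * (x j - x s) * (\<Prod>l\<in>S - {j}. x j - x l) = d"
        using insert.hyps j by (simp add: diff(2) mult.assoc)
    qed (use insert.prems(1) in blast)
    also have "(\<Sum>j\<in>S. c j * (x j - x s) * (\<Prod>l\<in>S - {j}. v - x l)) =
      (\<Sum>j\<in>S. (v - x s) * (c j * (\<Prod>l\<in>S - {j}. v - x l)) - c j * (\<Prod>l\<in>S. v - x l))"
    proof (rule sum.cong[OF refl])
      fix j assume j: "j \<in> S"
      have eq: "(\<Prod>l\<in>S. v - x l) = (v - x j) * (\<Prod>l\<in>S - {j}. v - x l)"
        using insert.hyps j by (simp add: prod.remove)
      show "c j * (x j - x s) * (\<Prod>l\<in>S - {j}. v - x l) =
        (v - x s) * (c j * (\<Prod>l\<in>S - {j}. v - x l)) - c j * (\<Prod>l\<in>S. v - x l)"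
        unfolding eq by (simp add: algebra_simps)
    qed
    finally show ?thesis by (simp add: sum_subtractf sum_distrib_left sum_distrib_right T_def)
  qed
  have "c s * (\<Prod>l\<in>S. x s - x l) = d" using insert.prems(2)[of s] by (simp add: diff(1))
  \<comment> \<open>At \<open>v = x s\<close> the first sum drops out. Cancelling the differences
    determines the new coefficient as \<open>- T\<close>.\<close>
  then have "(\<Prod>l\<in>S. x s - x l) * (c s + T) = 0" using main[of "x s"] by (simp add: algebra_simps)
  then have "c s + T = 0"
    by (rule prod_cancel[OF insert.hyps(1), rotated]) (use insert.prems(1)[of s] insert.hyps in blast)
  then have cs: "c s = - T" by (simp add: eq_neg_iff_add_eq_0)
  have "(\<Sum>j\<in>insert s S. c j * (\<Prod>l\<in>insert s S - {j}. u - x l)) =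
    c s * (\<Prod>l\<in>S. u - x l) + (\<Sum>j\<in>S. c j * ((u - x s) * (\<Prod>l\<in>S - {j}. u - x l)))"
    using insert.hyps by (simp add: diff)
  also have "\<dots> = d"
    using main[of u] by (simp add: cs sum_distrib_left mult.left_commute)
  finally show ?case .
qed simp

subsection \<open>The residue in one variable\<close>

definition off :: "nat set \<Rightarrow> (nat \<times> nat) set" where
  "off S = {(p, q). p \<in> S \<and> q \<in> S \<and> p \<noteq> q}"

lemma finite_off: "finite S \<Longrightarrow> finite (off S)"
  by (rule finite_subset[of _ "S \<times> S"]) (auto simp: off_def)

lemma prod_off_split:
  assumes "finite S" "s \<in> S"
  shows "(\<Prod>(p, q)\<in>off S. f p q) = (\<Prod>(p, q)\<in>{(p, q) \<in> off S. p \<noteq> s}. f p q) * (\<Prod>q\<in>S - {s}. f s q)"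
proof -
  have "off S = {(p, q) \<in> off S. p \<noteq> s} \<union> Pair s ` (S - {s})" using assms(2) by (auto simp: off_def)
  then have "(\<Prod>(p, q)\<in>off S. f p q) = (\<Prod>(p, q)\<in>{(p, q) \<in> off S. p \<noteq> s} \<union> Pair s ` (S - {s}). f p q)" by simp
  also have "\<dots> = (\<Prod>(p, q)\<in>{(p, q) \<in> off S. p \<noteq> s}. f p q) * (\<Prod>(p, q)\<in>Pair s ` (S - {s}). f p q)"
    by (rule prod.union_disjoint) (use assms finite_off[OF assms(1)] in \<open>auto intro: finite_subset[of _ "off S"]\<close>)
  also have "(\<Prod>(p, q)\<in>Pair s ` (S - {s}). f p q) = (\<Prod>q\<in>S - {s}. f s q)"
    by (subst prod.reindex) (auto simp: inj_on_def)
  finally show ?thesis .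
qed

context fgl
begin

text \<open>\<open>gam A B\<close> is \<open>(A - B) / (A +\<^sub>L B')\<close>, where \<open>B'\<close> is the inverse of \<open>B\<close>.\<close>
definition gam :: "'a hser \<Rightarrow> 'a hser \<Rightarrow> 'a hser" where "gam A B = beta B (F A (inv B))"

definition Pinv :: "'a hser \<Rightarrow> 'a hser" where "Pinv A = hinv (beta A 0)"

text \<open>\<open>R i p\<close> and \<open>V j i\<close> are the expansions of \<open>1 / (u\<^sub>i +\<^sub>L x\<^sub>p')\<close> and, for \<open>i < j\<close>,
  of \<open>1 / (u\<^sub>j +\<^sub>L u\<^sub>i)\<close>, a prime denoting the inverse in the group law.\<close>
definition R :: "nat \<Rightarrow> nat \<Rightarrow> 'a hser" where "R i p = gam (U i) (X p) * uinv i (X p)"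

definition V :: "nat \<Rightarrow> nat \<Rightarrow> 'a hser" where "V j i = beta (inv (U i)) (F (U j) (U i)) * uinv j (inv (U i))"

text \<open>What is left of the generating function once \<open>m\<close> variables u have been
  processed and the x's outside \<open>S\<close> used up. \<open>G 0 r {..<n}\<close> is the whole
  of it, and \<open>G r r S = 1\<close>.\<close>

definition G :: "nat \<Rightarrow> nat \<Rightarrow> nat set \<Rightarrow> 'a hser" where
  "G m r S = (\<Prod>i\<in>{m..<r}. Pinv (U i) * (\<Prod>j\<in>S. F (U i) (X j) * R i j)) *
     (\<Prod>i\<in>{m..<r}. \<Prod>j\<in>{i<..<r}. F (U j) (inv (U i)) * V j i)"

definition D :: "nat set \<Rightarrow> 'a hser" where
  "D S = (\<Prod>(p, q)\<in>off S. F (X p) (inv (X q)))"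

lemma hinv_beta:
  assumes "smallN A" "smallN B"
  shows "beta A B * hinv (beta A B) = 1"
    and "submon Q \<Longrightarrow> suppIn Q A \<Longrightarrow> suppIn Q B \<Longrightarrow> suppIn Q (hinv (beta A B))"
proof -
  obtain g where "beta A B * g = 1" using beta_unit[OF assms submon_upow] assms small_upow by blast
  then show "beta A B * hinv (beta A B) = 1" by (simp add: hinv_eqI)
  assume Q: "submon Q" "suppIn Q A" "suppIn Q B"
  obtain h where "suppIn Q h" "beta A B * h = 1" using beta_unit[OF assms Q] by blast
  then show "suppIn Q (hinv (beta A B))" by (simp add: hinv_eqI)
qed

lemma suppIn_inv: "submon Q \<Longrightarrow> smallN A \<Longrightarrow> suppIn Q A \<Longrightarrow> suppIn Q (inv A)"
  unfolding inv_def by (rule suppIn_S1)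

lemma suppIn_gam: "submon Q \<Longrightarrow> smallN A \<Longrightarrow> smallN B \<Longrightarrow> suppIn Q A \<Longrightarrow> suppIn Q B \<Longrightarrow> suppIn Q (gam A B)"
  unfolding gam_def by (intro suppIn_bet suppIn_FF small_FF small_inv suppIn_inv)

lemma suppIn_Pinv: "submon Q \<Longrightarrow> smallN A \<Longrightarrow> suppIn Q A \<Longrightarrow> suppIn Q (Pinv A)"
  unfolding Pinv_def by (intro hinv_beta(2)) simp_all

lemma diff_eq_gam: "smallN A \<Longrightarrow> smallN B \<Longrightarrow> A - B = F A (inv B) * gam A B"
  unfolding gam_def by (intro diff_eq_F_mult small_inv F_inv)

lemma gam_unit: "smallN A \<Longrightarrow> smallN B \<Longrightarrow> gam A B * hinv (gam A B) = 1"
  unfolding gam_def by (intro hinv_beta small_FF small_inv)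

lemma suppIn_hinv_gam: "submon Q \<Longrightarrow> smallN A \<Longrightarrow> smallN B \<Longrightarrow> suppIn Q A \<Longrightarrow> suppIn Q B \<Longrightarrow> suppIn Q (hinv (gam A B))"
  unfolding gam_def by (intro hinv_beta(2) suppIn_FF small_FF small_inv suppIn_inv)

lemma gam_self_Pinv: "smallN A \<Longrightarrow> gam A A * Pinv A = 1"
  unfolding gam_def Pinv_def by (simp add: F_inv hinv_beta)

lemma F_R:
  assumes "i < N" "p < N"
  shows "F (U i) (inv (X p)) * R i p = 1"
proof -
  have "F (U i) (inv (X p)) * R i p = (U i - X p) * uinv i (X p)"
    unfolding diff_eq_gam[OF small_U[OF assms(1)] small_X[OF assms(2)]] R_def by (simp only: mult.assoc)
  then show ?thesis by (simp add: uinv[OF small_X[OF assms(2)] ubelow_X])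
qed

lemma ubelow_inv_U: "i < j \<Longrightarrow> i < N \<Longrightarrow> ubelow j (inv (U i))"
  by (intro suppIn_inv submon_ubelow small_U suppIn_U) (simp_all add: unit_at_def)

text \<open>The inverse of \<open>inv (U i)\<close> is \<open>U i\<close>, so
  \<open>diff_eq_F_mult\<close> relates \<open>F (U j) (U i)\<close> to
  \<open>U j - inv (U i)\<close>. The geometric series for the latter is legitimate because
  \<open>inv (U i)\<close> involves only a more significant variable.\<close>

lemma F_V:
  assumes "i < j" "j < N"
  shows "F (U j) (U i) * V j i = 1"
proof -
  have i: "i < N" using assms by simp
  note S = small_U[OF assms(2)] small_U[OF i]
  have "F (inv (U i)) (U i) = 0" by (simp add: F_commute small_inv S F_inv)
  then have "U j - inv (U i) = F (U j) (U i) * beta (inv (U i)) (F (U j) (U i))"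
    by (intro diff_eq_F_mult small_inv S)
  moreover have "(U j - inv (U i)) * uinv j (inv (U i)) = 1"
    by (rule uinv[OF small_inv[OF S(2)] ubelow_inv_U[OF assms(1) i]])
  ultimately show ?thesis by (simp add: V_def mult.assoc)
qed

lemma ufree_R: "i < N \<Longrightarrow> p < N \<Longrightarrow> m \<noteq> i \<Longrightarrow> ufree m (R i p)"
  unfolding R_def
  by (intro submon_mult submon_ufree suppIn_gam small_U small_X ufree_U ufree_X
      suppIn_uinv[OF small_X ubelow_X submon_ufree[of m]]) simp_all

lemma ufree_V: "i < j \<Longrightarrow> j < N \<Longrightarrow> m \<noteq> i \<Longrightarrow> m \<noteq> j \<Longrightarrow> ufree m (V j i)"
  unfolding V_def
  by (intro submon_mult submon_ufree suppIn_bet suppIn_inv suppIn_FF small_FF small_inv small_U ufree_U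
      suppIn_uinv[OF small_inv[OF small_U] ubelow_inv_U submon_ufree[of m]]) simp_all

text \<open>Negative powers in the expansion occur only at the less significant variable
  \<open>U j\<close>. This is what permits evaluating \<open>V j i\<close> at
  \<open>U i = X s\<close>.\<close>

lemma upos_V: "i < j \<Longrightarrow> j < N \<Longrightarrow> upos i (V j i)"
  unfolding V_def
  by (intro submon_mult submon_upos suppIn_bet suppIn_inv suppIn_FF small_FF small_inv small_U upos_U
      suppIn_uinv[OF small_inv[OF small_U] ubelow_inv_U submon_upos[of i]]) simp_all

lemma ufree_G:
  assumes "k \<notin> {m..<r}" "r \<le> N" "S \<subseteq> {..<N}"
  shows "ufree k (G m r S)"
proof -
  have 1: "ufree k (Pinv (U i) * (\<Prod>j\<in>S. F (U i) (X j) * R i j))" if "i \<in> {m..<r}" for i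
    using that assms
    by (intro submon_mult submon_prod submon_ufree suppIn_Pinv suppIn_FF small_U small_X ufree_U ufree_X ufree_R) auto
  have 2: "ufree k (F (U j) (inv (U i)) * V j i)" if "i \<in> {m..<r}" "j \<in> {i<..<r}" for i j
    using that assms
    by (intro submon_mult submon_ufree suppIn_FF suppIn_inv small_U small_inv ufree_U ufree_V) auto
  show ?thesis
    unfolding G_def by (intro 1 2 submon_mult[OF submon_ufree] submon_prod[OF submon_ufree])
qed

lemma ufree_D: "S \<subseteq> {..<N} \<Longrightarrow> ufree k (D S)"
  unfolding D_def
  by (intro submon_prod submon_ufree) (auto simp: off_def intro!: suppIn_FF suppIn_inv submon_ufree small_X small_inv ufree_X)

lemma atLeastLessThan_insert: "m < r \<Longrightarrow> {m..<r} = insert m {Suc m..<r}" for m r :: nat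
  by auto

lemma greaterThanLessThan_Suc: "{m<..<r} = {Suc m..<r}" for m r :: nat
  by auto

text \<open>Clearing denominators by \<open>D S\<close> keeps the formula inside the ring: the pairs
  with first index \<open>s\<close> are consumed by the denominators of the new factor, and the
  remaining pairs are passed on.\<close>

lemma residue_step:
  assumes m: "m < r" and r: "r \<le> N" and S: "finite S" "S \<noteq> {}" "S \<subseteq> {..<N}" and \<nu>: "0 < \<nu>"
  shows "ucf m (- int \<nu>) (G m r S) * D S =
    (\<Sum>s\<in>S. F (X s) (X s) * X s ^ (\<nu> - 1) * (\<Prod>j\<in>S - {s}. F (X s) (X j)) *
       (\<Prod>(p, q)\<in>{(p, q) \<in> off S. p \<noteq> s}. F (X p) (inv (X q))) * G (Suc m) r (S - {s}))"
proof -
  have mN: "m < N" using m r by simp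
  have SN: "s < N" if "s \<in> S" for s using that S by auto
  note sU = small_U[OF mN]
  have jN: "j < N" "m < j" "j \<noteq> m" if "j \<in> {Suc m..<r}" for j using that r by auto
  \<comment> \<open>All factors containing \<open>U m\<close> except the simple poles
    \<open>uinv m (X j)\<close>; none has negative powers of \<open>U m\<close>.\<close>
  define Nf where "Nf = Pinv (U m) * (\<Prod>j\<in>S. F (U m) (X j) * gam (U m) (X j)) *
    (\<Prod>j\<in>{Suc m..<r}. F (U j) (inv (U m)) * V j m)"
  let ?G = "G (Suc m) r S"
  let ?E = "\<lambda>s. \<Prod>(p, q)\<in>{(p, q) \<in> off S. p \<noteq> s}. F (X p) (inv (X q))"
  have G: "G m r S = Nf * (\<Prod>j\<in>S. uinv m (X j)) * ?G"
    unfolding G_def Nf_def atLeastLessThan_insert[OF m] greaterThanLessThan_Suc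
    by (simp add: R_def prod.distrib mult_ac)
  \<comment> \<open>The partial fraction coefficient should be \<open>D S\<close> divided by the
    product of the \<open>X s - X l\<close>. Each such difference is
    \<open>F (X s) (inv (X l))\<close> times the unit \<open>gam\<close>, so the factors of
    \<open>D S\<close> with first index \<open>s\<close> cancel and this remains.\<close>
  define c where "c s = ?E s * (\<Prod>l\<in>S - {s}. hinv (gam (X s) (X l)))" for s
  have D: "D S = ?E s * (\<Prod>q\<in>S - {s}. F (X s) (inv (X q)))" if "s \<in> S" for s
    unfolding D_def by (rule prod_off_split[OF S(1) that])
  have cD: "c s * (\<Prod>l\<in>S - {s}. X s - X l) = D S" if s: "s \<in> S" for s
  proof -
    let ?H = "\<Prod>l\<in>S - {s}. hinv (gam (X s) (X l))" and ?g = "\<Prod>l\<in>S - {s}. gam (X s) (X l)"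
      and ?f = "\<Prod>q\<in>S - {s}. F (X s) (inv (X q))"
    have 1: "(\<Prod>l\<in>S - {s}. X s - X l) = (\<Prod>l\<in>S - {s}. F (X s) (inv (X l)) * gam (X s) (X l))"
      by (rule prod.cong[OF refl]) (use s SN in \<open>auto intro!: diff_eq_gam small_X\<close>)
    have 2: "?H * ?g = 1"
      unfolding prod.distrib[symmetric]
      by (rule prod.neutral) (use s SN in \<open>auto simp: mult.commute[of "hinv _"] intro!: gam_unit small_X\<close>)
    have "c s * (\<Prod>l\<in>S - {s}. X s - X l) = ?E s * ?f * (?H * ?g)"
      unfolding 1 prod.distrib c_def by (simp only: mult_ac)
    then show ?thesis unfolding 2 D[OF s] by simp
  qed
  have pf: "D S = (\<Sum>s\<in>S. c s * (\<Prod>l\<in>S - {s}. U m - X l))"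
    by (rule partial_fractions[symmetric, OF S(1,2) _ cD]) (rule X_diff_cancel)
  \<comment> \<open>Multiplying by all the poles removes every linear factor of the
    \<open>s\<close>-th summand and leaves the single pole at \<open>X s\<close>.\<close>
  have pf': "D S * (\<Prod>j\<in>S. uinv m (X j)) = (\<Sum>s\<in>S. c s * uinv m (X s))"
    unfolding pf sum_distrib_right
  proof (rule sum.cong[OF refl])
    fix s assume s: "s \<in> S"
    have 1: "(\<Prod>l\<in>S - {s}. U m - X l) * (\<Prod>l\<in>S - {s}. uinv m (X l)) = 1"
      unfolding prod.distrib[symmetric] by (rule prod.neutral) (use SN in \<open>auto intro!: uinv_X[OF mN]\<close>)
    have 2: "(\<Prod>j\<in>S. uinv m (X j)) = uinv m (X s) * (\<Prod>l\<in>S - {s}. uinv m (X l))"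
      using S(1) s by (simp add: prod.remove)
    have "c s * (\<Prod>l\<in>S - {s}. U m - X l) * (\<Prod>j\<in>S. uinv m (X j)) =
      c s * uinv m (X s) * ((\<Prod>l\<in>S - {s}. U m - X l) * (\<Prod>l\<in>S - {s}. uinv m (X l)))"
      unfolding 2 by (simp only: mult_ac)
    then show "c s * (\<Prod>l\<in>S - {s}. U m - X l) * (\<Prod>j\<in>S. uinv m (X j)) = c s * uinv m (X s)"
      unfolding 1 by simp
  qed
  have fr: "ufree m ?G" "ufree m (D S)" using r S by (auto intro: ufree_G ufree_D)
  have frc: "ufree m (c s)" if "s \<in> S" for s
    unfolding c_def using that SN
    by (intro submon_mult submon_prod submon_ufree suppIn_hinv_gam)
       (auto simp: off_def intro!: suppIn_FF suppIn_inv submon_ufree small_X small_inv ufree_X)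
  have posN: "upos m (Pinv (U m))" "\<And>j. j \<in> S \<Longrightarrow> upos m (F (U m) (X j))" "\<And>j. j \<in> S \<Longrightarrow> upos m (gam (U m) (X j))"
    "\<And>j. j \<in> {Suc m..<r} \<Longrightarrow> upos m (F (U j) (inv (U m)))" "\<And>j. j \<in> {Suc m..<r} \<Longrightarrow> upos m (V j m)"
    using SN jN mN by (auto intro!: suppIn_Pinv suppIn_FF suppIn_gam suppIn_inv submon_upos upos_V upos_U
        small_U small_X small_inv ufree_upos[OF ufree_X])
  have pos: "upos m Nf"
    unfolding Nf_def by (intro submon_mult submon_prod submon_upos posN)
  have "ucf m (- int \<nu>) (G m r S) * D S = ucf m (- int \<nu>) (D S * G m r S)"
    by (simp add: ucf_mult[OF fr(2)] mult.commute)
  also have "D S * G m r S = (\<Sum>s\<in>S. (c s * ?G) * (Nf * uinv m (X s)))"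
  proof -
    have "D S * G m r S = (D S * (\<Prod>j\<in>S. uinv m (X j))) * (Nf * ?G)" unfolding G by (simp only: mult_ac)
    also have "\<dots> = (\<Sum>s\<in>S. (c s * ?G) * (Nf * uinv m (X s)))" unfolding pf' sum_distrib_right by (simp only: mult_ac)
    finally show ?thesis .
  qed
  also have "ucf m (- int \<nu>) \<dots> = (\<Sum>s\<in>S. c s * ?G * (uev m s Nf * X s ^ (\<nu> - 1)))"
    unfolding ucf_sum
  proof (rule sum.cong[OF refl])
    fix s assume s: "s \<in> S"
    show "ucf m (- int \<nu>) (c s * ?G * (Nf * uinv m (X s))) = c s * ?G * (uev m s Nf * X s ^ (\<nu> - 1))"
      by (subst ucf_mult[OF submon_mult[OF submon_ufree frc[OF s] fr(1)]])
         (simp add: ucf_mult_uinv[OF mN SN[OF s] pos \<nu>])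
  qed
  also have "\<dots> = (\<Sum>s\<in>S. F (X s) (X s) * X s ^ (\<nu> - 1) * (\<Prod>j\<in>S - {s}. F (X s) (X j)) * ?E s * G (Suc m) r (S - {s}))"
  proof (rule sum.cong[OF refl])
    fix s assume s: "s \<in> S"
    note sN = SN[OF s]
    note sX = small_X[OF sN]
    note ch = chom_uev[OF mN sN]
    have evX: "uev m s (X j) = X j" for j by (rule uev_ufree[OF mN sN ufree_X])
    have evU: "uev m s (U j) = U j" if "j \<in> {Suc m..<r}" for j using jN[OF that] by (intro uev_ufree[OF mN sN] ufree_U) auto
    note evUm = uev_U[OF mN sN]
    have ev_inv: "uev m s (inv (U m)) = inv (X s)"
      unfolding inv_def by (subst chom_S1[OF ch sU upos_U]) (simp_all only: evUm sX)
    have ev_invX: "uev m s (inv (X j)) = inv (X j)" if "j \<in> S" for j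
      by (intro uev_ufree[OF mN sN] suppIn_inv submon_ufree ufree_X small_X SN that)
    have evF: "uev m s (F (U m) (X j)) = F (X s) (X j)" if "j \<in> S" for j
      by (subst chom_FF[OF ch]) (simp_all only: evUm evX sU sX upos_U small_X[OF SN[OF that]] ufree_upos[OF ufree_X])
    have evFi: "uev m s (F (U m) (inv (X j))) = F (X s) (inv (X j))" if "j \<in> S" for j
      by (subst chom_FF[OF ch])
         (simp_all only: evUm ev_invX[OF that] sU sX upos_U small_inv small_X[OF SN[OF that]]
           suppIn_inv[OF submon_upos] ufree_upos[OF ufree_X])
    have evg: "uev m s (gam (U m) (X j)) = gam (X s) (X j)" if "j \<in> S" for j
      unfolding gam_def
      by (subst chom_bet[OF ch])
         (simp_all only: evFi[OF that] evX sU sX upos_U small_inv small_FF small_X[OF SN[OF that]]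
           suppIn_FF[OF submon_upos] suppIn_inv[OF submon_upos] ufree_upos[OF ufree_X])
    \<comment> \<open>\<open>Pinv\<close> is defined as an inverse rather than by substitution; as
      evaluation is multiplicative, its value is the inverse of the value of
      \<open>beta (U m) 0\<close>.\<close>
    have evP: "uev m s (Pinv (U m)) = Pinv (X s)"
    proof -
      have "uev m s (beta (U m) 0 * Pinv (U m)) = uev m s (beta (U m) 0) * uev m s (Pinv (U m))"
        by (intro chom_mult[OF ch] suppIn_bet submon_upos sU small_0 upos_U suppIn_0 posN)
      moreover have "uev m s (beta (U m) 0) = beta (X s) 0"
        by (subst chom_bet[OF ch]) (simp_all only: evUm chom_0[OF ch] sU sX upos_U small_0 suppIn_0)
      ultimately have "beta (X s) 0 * uev m s (Pinv (U m)) = uev m s (beta (U m) 0 * Pinv (U m))" by simp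
      also have "\<dots> = 1" unfolding Pinv_def hinv_beta(1)[OF sU small_0] by (rule chom_1[OF ch])
      finally show ?thesis unfolding Pinv_def[of "X s"] by (rule hinv_eqI[symmetric])
    qed
    \<comment> \<open>The evaluated \<open>V j m\<close> is characterised only as an inverse of
      \<open>F (U j) (X s)\<close>, which suffices for the cancellation in
      \<open>GW\<close>.\<close>
    define W where "W j = uev m s (V j m)" for j
    have W: "F (U j) (X s) * W j = 1" if j: "j \<in> {Suc m..<r}" for j
    proof -
      note sj = small_U[OF jN(1)[OF j]]
      have "uev m s (F (U j) (U m) * V j m) = uev m s (F (U j) (U m)) * W j"
        unfolding W_def by (intro chom_mult[OF ch] suppIn_FF submon_upos sU sj upos_U posN j)
      moreover have "uev m s (F (U j) (U m)) = F (U j) (X s)"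
        by (subst chom_FF[OF ch]) (simp_all only: evUm evU[OF j] sU sX sj upos_U)
      ultimately have "F (U j) (X s) * W j = uev m s (F (U j) (U m) * V j m)" by simp
      also have "\<dots> = 1" unfolding F_V[OF jN(2)[OF j] jN(1)[OF j]] by (rule chom_1[OF ch])
      finally show ?thesis .
    qed
    have evV: "uev m s (F (U j) (inv (U m)) * V j m) = F (U j) (inv (X s)) * W j" if j: "j \<in> {Suc m..<r}" for j
    proof -
      note sj = small_U[OF jN(1)[OF j]]
      have "uev m s (F (U j) (inv (U m))) = F (U j) (inv (X s))"
        by (subst chom_FF[OF ch])
           (simp_all only: ev_inv evU[OF j] sU sX sj upos_U small_inv suppIn_inv[OF submon_upos])
      then show ?thesis unfolding W_def using posN j by (simp add: chom_mult[OF ch])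
    qed
    have "uev m s Nf = Pinv (X s) * (\<Prod>j\<in>S. F (X s) (X j) * gam (X s) (X j)) *
      (\<Prod>j\<in>{Suc m..<r}. F (U j) (inv (X s)) * W j)"
    proof -
      have pS: "upos m (F (U m) (X j) * gam (U m) (X j))" if "j \<in> S" for j
        by (intro submon_mult[OF submon_upos] posN that)
      have pR: "upos m (F (U j) (inv (U m)) * V j m)" if "j \<in> {Suc m..<r}" for j
        by (intro submon_mult[OF submon_upos] posN that)
      have "uev m s (\<Prod>j\<in>S. F (U m) (X j) * gam (U m) (X j)) = (\<Prod>j\<in>S. uev m s (F (U m) (X j) * gam (U m) (X j)))"
        by (rule chom_prod[OF ch]) (rule pS)
      also have "\<dots> = (\<Prod>j\<in>S. F (X s) (X j) * gam (X s) (X j))"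
        by (rule prod.cong[OF refl]) (simp only: chom_mult[OF ch posN(2) posN(3)] evF evg)
      finally have "uev m s (\<Prod>j\<in>S. F (U m) (X j) * gam (U m) (X j)) = (\<Prod>j\<in>S. F (X s) (X j) * gam (X s) (X j))" .
      moreover have "uev m s (\<Prod>j\<in>{Suc m..<r}. F (U j) (inv (U m)) * V j m) =
        (\<Prod>j\<in>{Suc m..<r}. F (U j) (inv (X s)) * W j)"
      proof -
        have "uev m s (\<Prod>j\<in>{Suc m..<r}. F (U j) (inv (U m)) * V j m) =
          (\<Prod>j\<in>{Suc m..<r}. uev m s (F (U j) (inv (U m)) * V j m))"
          by (rule chom_prod[OF ch]) (rule pR)
        also have "\<dots> = (\<Prod>j\<in>{Suc m..<r}. F (U j) (inv (X s)) * W j)" by (rule prod.cong[OF refl evV])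
        finally show ?thesis .
      qed
      moreover have "uev m s Nf = uev m s (Pinv (U m)) * uev m s (\<Prod>j\<in>S. F (U m) (X j) * gam (U m) (X j)) *
        uev m s (\<Prod>j\<in>{Suc m..<r}. F (U j) (inv (U m)) * V j m)"
      proof -
        have "upos m (\<Prod>j\<in>S. F (U m) (X j) * gam (U m) (X j))" by (rule submon_prod[OF submon_upos pS])
        moreover have "upos m (\<Prod>j\<in>{Suc m..<r}. F (U j) (inv (U m)) * V j m)" by (rule submon_prod[OF submon_upos pR])
        ultimately show ?thesis
          unfolding Nf_def by (simp only: chom_mult[OF ch] submon_mult[OF submon_upos] posN(1))
      qed
      ultimately show ?thesis by (simp only: evP)
    qed
    also have "(\<Prod>j\<in>S. F (X s) (X j) * gam (X s) (X j)) =
      F (X s) (X s) * gam (X s) (X s) * (\<Prod>j\<in>S - {s}. F (X s) (X j) * gam (X s) (X j))"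
      using S(1) s by (simp add: prod.remove)
    finally have "uev m s Nf = (gam (X s) (X s) * Pinv (X s)) * F (X s) (X s) *
      (\<Prod>j\<in>S - {s}. F (X s) (X j)) * (\<Prod>j\<in>S - {s}. gam (X s) (X j)) *
      (\<Prod>j\<in>{Suc m..<r}. F (U j) (inv (X s)) * W j)"
      unfolding prod.distrib by (simp only: mult_ac)
    then have evN: "uev m s Nf = F (X s) (X s) *
      (\<Prod>j\<in>S - {s}. F (X s) (X j)) * (\<Prod>j\<in>S - {s}. gam (X s) (X j)) *
      (\<Prod>j\<in>{Suc m..<r}. F (U j) (inv (X s)) * W j)"
      by (simp add: gam_self_Pinv[OF sX])
    \<comment> \<open>The \<open>gam\<close> factors of the numerator at \<open>U m = X s\<close>
      cancel the inverses built into \<open>c s\<close>.\<close>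
    have cg: "c s * (\<Prod>j\<in>S - {s}. gam (X s) (X j)) = ?E s"
    proof -
      have "(\<Prod>l\<in>S - {s}. hinv (gam (X s) (X l))) * (\<Prod>l\<in>S - {s}. gam (X s) (X l)) = 1"
        unfolding prod.distrib[symmetric]
        by (rule prod.neutral) (use s SN in \<open>auto simp: mult.commute[of "hinv _"] intro!: gam_unit small_X\<close>)
      then show ?thesis unfolding c_def by (simp add: mult.assoc)
    qed
    have GW: "?G * (\<Prod>j\<in>{Suc m..<r}. F (U j) (inv (X s)) * W j) = G (Suc m) r (S - {s})"
    proof -
      \<comment> \<open>Variable by variable, \<open>F (U i) (inv (X s))\<close> cancels
        \<open>R i s\<close> and \<open>W i\<close> cancels \<open>F (U i) (X s)\<close>, which
        removes \<open>X s\<close> from the product.\<close>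
      have "(\<Prod>i\<in>{Suc m..<r}. Pinv (U i) * (\<Prod>j\<in>S. F (U i) (X j) * R i j)) *
        (\<Prod>j\<in>{Suc m..<r}. F (U j) (inv (X s)) * W j) =
        (\<Prod>i\<in>{Suc m..<r}. Pinv (U i) * (\<Prod>j\<in>S - {s}. F (U i) (X j) * R i j))"
        unfolding prod.distrib[of _ _ "{Suc m..<r}", symmetric]
      proof (rule prod.cong[OF refl])
        fix i assume i: "i \<in> {Suc m..<r}"
        have "(\<Prod>j\<in>S. F (U i) (X j) * R i j) = F (U i) (X s) * R i s * (\<Prod>j\<in>S - {s}. F (U i) (X j) * R i j)"
          using S(1) s by (simp add: prod.remove)
        then have "Pinv (U i) * (\<Prod>j\<in>S. F (U i) (X j) * R i j) * (F (U i) (inv (X s)) * W i) =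
          (F (U i) (inv (X s)) * R i s) * (F (U i) (X s) * W i) * (Pinv (U i) * (\<Prod>j\<in>S - {s}. F (U i) (X j) * R i j))"
          by (simp only: mult_ac)
        then show "Pinv (U i) * (\<Prod>j\<in>S. F (U i) (X j) * R i j) * (F (U i) (inv (X s)) * W i) =
          Pinv (U i) * (\<Prod>j\<in>S - {s}. F (U i) (X j) * R i j)"
          using F_R[OF jN(1)[OF i] sN] W[OF i] by simp
      qed
      moreover have "?G * (\<Prod>j\<in>{Suc m..<r}. F (U j) (inv (X s)) * W j) =
        ((\<Prod>i\<in>{Suc m..<r}. Pinv (U i) * (\<Prod>j\<in>S. F (U i) (X j) * R i j)) *
        (\<Prod>j\<in>{Suc m..<r}. F (U j) (inv (X s)) * W j)) *
        (\<Prod>i\<in>{Suc m..<r}. \<Prod>j\<in>{i<..<r}. F (U j) (inv (U i)) * V j i)"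
        unfolding G_def by (simp only: mult_ac)
      ultimately show ?thesis by (simp only: G_def)
    qed
    have "c s * ?G * (uev m s Nf * X s ^ (\<nu> - 1)) = F (X s) (X s) * X s ^ (\<nu> - 1) * (\<Prod>j\<in>S - {s}. F (X s) (X j)) *
      (c s * (\<Prod>j\<in>S - {s}. gam (X s) (X j))) * (?G * (\<Prod>j\<in>{Suc m..<r}. F (U j) (inv (X s)) * W j))"
      unfolding evN by (simp only: mult_ac)
    then show "c s * ?G * (uev m s Nf * X s ^ (\<nu> - 1)) =
      F (X s) (X s) * X s ^ (\<nu> - 1) * (\<Prod>j\<in>S - {s}. F (X s) (X j)) * ?E s * G (Suc m) r (S - {s})"
      by (simp only: cg GW)
  qed
  finally show ?thesis .
qed

end

subsection \<open>Summation over injections\<close>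

lemma injs_0: "injs n 0 = {\<lambda>_. 0}"
  by (auto simp: injs_def)

lemma injs_Suc:
  "injs n (Suc m) = (\<lambda>(\<sigma>, s). \<sigma>(m := s)) ` (SIGMA \<sigma>:injs n m. {..<n} - \<sigma> ` {..<m})"
proof (intro equalityI subsetI)
  fix \<tau> assume \<tau>: "\<tau> \<in> injs n (Suc m)"
  \<comment> \<open>Position \<open>m\<close> is reset to the default 0 that \<open>injs\<close>
    prescribes beyond its domain; this default also makes the extension map injective.\<close>
  define \<sigma> where "\<sigma> = \<tau>(m := 0)"
  have im: "\<sigma> ` {..<m} = \<tau> ` {..<m}" by (auto simp: \<sigma>_def)
  have inj: "inj_on \<tau> {..<Suc m}" using \<tau> by (simp add: injs_def)
  have "inj_on \<sigma> {..<m}" using inj by (auto simp: inj_on_def \<sigma>_def)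
  moreover have "\<tau> ` {..<m} \<subseteq> {..<n}" using \<tau> by (auto simp: injs_def image_subset_iff)
  moreover have "\<forall>i\<ge>m. \<sigma> i = 0" using \<tau> by (auto simp: injs_def \<sigma>_def)
  ultimately have "\<sigma> \<in> injs n m" unfolding injs_def mem_Collect_eq im by simp
  moreover have "\<tau> m \<in> {..<n} - \<sigma> ` {..<m}"
  proof -
    have "\<tau> m \<noteq> \<tau> x" if "x < m" for x using inj_onD[OF inj, of m x] that by auto
    moreover have "\<tau> m < n" using \<tau> by (auto simp: injs_def image_subset_iff)
    ultimately show ?thesis unfolding im by auto
  qed
  moreover have "\<tau> = \<sigma>(m := \<tau> m)" by (simp add: \<sigma>_def)
  ultimately show "\<tau> \<in> (\<lambda>(\<sigma>, s). \<sigma>(m := s)) ` (SIGMA \<sigma>:injs n m. {..<n} - \<sigma> ` {..<m})"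
    by (intro image_eqI[of _ _ "(\<sigma>, \<tau> m)"]) auto
next
  fix \<tau> assume "\<tau> \<in> (\<lambda>(\<sigma>, s). \<sigma>(m := s)) ` (SIGMA \<sigma>:injs n m. {..<n} - \<sigma> ` {..<m})"
  then obtain \<sigma> s where *: "\<tau> = \<sigma>(m := s)" "\<sigma> \<in> injs n m" "s < n" "s \<notin> \<sigma> ` {..<m}" by auto
  have "inj_on (\<sigma>(m := s)) (insert m {..<m})"
    using * by (auto simp: injs_def inj_on_def)
  then show "\<tau> \<in> injs n (Suc m)"
    using * by (auto simp: injs_def lessThan_Suc)
qed

lemma inj_on_injs_Suc:
  "inj_on (\<lambda>(\<sigma>, s). \<sigma>(m := s)) (SIGMA \<sigma>:injs n m. {..<n} - \<sigma> ` {..<m})"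
proof (rule inj_onI, clarify)
  fix \<sigma> s \<tau> t assume a: "\<sigma> \<in> injs n m" "\<tau> \<in> injs n m" "\<sigma>(m := s) = \<tau>(m := t)"
  have "s = t" using fun_cong[OF a(3), of m] by simp
  moreover have "\<sigma> = \<tau>"
  proof
    fix i show "\<sigma> i = \<tau> i" using fun_cong[OF a(3), of i] a(1,2) by (cases "i = m") (auto simp: injs_def)
  qed
  ultimately show "\<sigma> = \<tau> \<and> s = t" by simp
qed

lemma finite_injs: "finite (injs n m)"
  by (induction m) (auto simp: injs_0 injs_Suc)

lemma sum_injs_Suc:
  "(\<Sum>\<tau>\<in>injs n (Suc m). f \<tau>) = (\<Sum>\<sigma>\<in>injs n m. \<Sum>s\<in>{..<n} - \<sigma> ` {..<m}. f (\<sigma>(m := s)))"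
  unfolding injs_Suc
  by (subst sum.reindex[OF inj_on_injs_Suc], subst sum.Sigma)
     (auto simp: finite_injs case_prod_beta intro!: sum.cong)

lemma off_minus_dset:
  assumes \<sigma>: "\<sigma> \<in> injs n m" and S: "S = {..<n} - \<sigma> ` {..<m}"
  shows "off S \<subseteq> off {..<n} - dset n m \<sigma>"
    and "s \<in> S \<Longrightarrow> off {..<n} - dset n (Suc m) (\<sigma>(m := s)) =
      ((off {..<n} - dset n m \<sigma>) - off S) \<union> {(p, q) \<in> off S. p \<noteq> s}"
proof -
  show sub: "off S \<subseteq> off {..<n} - dset n m \<sigma>"
    unfolding S off_def dset_def by auto
  assume s: "s \<in> S"
  have im: "(\<sigma>(m := s)) ` {..i} = \<sigma> ` {..i}" if "i < m" for i using that by auto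
  have imm: "(\<sigma>(m := s)) ` {..m} = insert s (\<sigma> ` {..<m})"
    by (auto simp: atMost_Suc lessThan_Suc_atMost[symmetric] lessThan_Suc)
  have "dset n (Suc m) (\<sigma>(m := s)) = dset n m \<sigma> \<union> Pair s ` (S - {s})"
  proof (intro equalityI subsetI)
    fix x assume "x \<in> dset n (Suc m) (\<sigma>(m := s))"
    then obtain i j where x: "x = ((\<sigma>(m := s)) i, j)" "i < Suc m" "j < n" "j \<notin> (\<sigma>(m := s)) ` {..i}"
      by (auto simp: dset_def)
    show "x \<in> dset n m \<sigma> \<union> Pair s ` (S - {s})"
    proof (cases "i = m")
      case True
      have "x = (s, j)" using x(1) True by simp
      moreover have "j \<notin> insert s (\<sigma> ` {..<m})" using x(4) unfolding True imm .
      ultimately show ?thesis using x(3) unfolding S by blast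
    next
      case False
      then have i: "i < m" using x by simp
      have "x = (\<sigma> i, j)" using x i by simp
      moreover have "j \<notin> \<sigma> ` {..i}" using x(4) unfolding im[OF i] .
      ultimately show ?thesis using i x(3) unfolding dset_def by blast
    qed
  next
    fix x assume "x \<in> dset n m \<sigma> \<union> Pair s ` (S - {s})"
    then consider i j where "x = (\<sigma> i, j)" "i < m" "j < n" "j \<notin> \<sigma> ` {..i}" | j where "x = (s, j)" "j \<in> S" "j \<noteq> s"
      by (auto simp: dset_def)
    then show "x \<in> dset n (Suc m) (\<sigma>(m := s))"
    proof cases
      case (1 i j)
      have "x = ((\<sigma>(m := s)) i, j)" "j \<notin> (\<sigma>(m := s)) ` {..i}" "i < Suc m"
        using 1(1,2,4) unfolding im[OF 1(2)] by simp_all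
      then show ?thesis using 1(3) unfolding dset_def by blast
    next
      case (2 j)
      have "x = ((\<sigma>(m := s)) m, j)" "j \<notin> (\<sigma>(m := s)) ` {..m}" "j < n"
        using 2 unfolding imm S by auto
      then show ?thesis unfolding dset_def by blast
    qed
  qed
  moreover have "Pair s ` (S - {s}) = {(p, q) \<in> off S. p = s}" using s by (auto simp: off_def)
  ultimately show "off {..<n} - dset n (Suc m) (\<sigma>(m := s)) =
      ((off {..<n} - dset n m \<sigma>) - off S) \<union> {(p, q) \<in> off S. p \<noteq> s}"
    using sub by auto
qed

text \<open>Extraction starts with index 0, the most significant variable, as the expansion
  convention requires.\<close>

primrec ucfs :: "nat list \<Rightarrow> nat \<Rightarrow> 'a::comm_ring_1 hser \<Rightarrow> 'a hser" where
  "ucfs \<nu> 0 f = f"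
| "ucfs \<nu> (Suc m) f = ucf m (- int (\<nu> ! m)) (ucfs \<nu> m f)"

lemma coeff_ucfs:
  "coeff (ucfs \<nu> m f) \<alpha> e =
    (if \<forall>i<m. e i = 0 then coeff f \<alpha> (\<lambda>i. if i < m then - int (\<nu> ! i) else e i) else 0)"
proof (induction m arbitrary: e)
  case (Suc m)
  have "(\<lambda>i. if i < m then - int (\<nu> ! i) else (e(m := - int (\<nu> ! m))) i) = (\<lambda>i. if i < Suc m then - int (\<nu> ! i) else e i)"
    by (auto simp: fun_eq_iff less_Suc_eq)
  moreover have "(\<forall>i<m. (e(m := - int (\<nu> ! m))) i = 0) \<longleftrightarrow> (\<forall>i<m. e i = 0)" by auto
  ultimately show ?case by (auto simp: coeff_ucf Suc.IH less_Suc_eq simp del: fun_upd_apply)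
qed simp

lemma ufree_ucfs: "ufree k f \<Longrightarrow> ufree k (ucfs \<nu> m f)"
  by (induction m) (auto intro: ufree_ucf_other)

section \<open>Iterated residues as a sum over injections\<close>

context fgl
begin

definition fac :: "nat \<Rightarrow> nat list \<Rightarrow> (nat \<Rightarrow> nat) \<Rightarrow> nat \<Rightarrow> 'a hser" where
  "fac n \<nu> \<sigma> i = F (X (\<sigma> i)) (X (\<sigma> i)) * X (\<sigma> i) ^ (\<nu> ! i - 1) *
     (\<Prod>j\<in>{..<n} - \<sigma> ` {..i}. F (X (\<sigma> i)) (X j))"

text \<open>The numerator after only the first \<open>m\<close> values have been chosen; with
  \<open>m = length \<nu>\<close> it is \<open>qnum\<close>.\<close>

definition num :: "nat \<Rightarrow> nat list \<Rightarrow> nat \<Rightarrow> (nat \<Rightarrow> nat) \<Rightarrow> 'a hser" where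
  "num n \<nu> m \<sigma> = (\<Prod>i<m. fac n \<nu> \<sigma> i) *
     (\<Prod>(p, q)\<in>off {..<n} - dset n m \<sigma>. F (X p) (inv (X q)))"

lemma ufree_FX: "p < N \<Longrightarrow> q < N \<Longrightarrow> ufree k (F (X p) (X q))"
  by (intro suppIn_FF submon_ufree small_X ufree_X)

lemma ufree_FXi: "p < N \<Longrightarrow> q < N \<Longrightarrow> ufree k (F (X p) (inv (X q)))"
  by (intro suppIn_FF suppIn_inv small_inv submon_ufree small_X ufree_X)

lemma injs_less: "\<sigma> \<in> injs n m \<Longrightarrow> i < m \<Longrightarrow> \<sigma> i < n"
  by (auto simp: injs_def)

lemma ufree_fac: "\<sigma> i < n \<Longrightarrow> n \<le> N \<Longrightarrow> ufree k (fac n \<nu> \<sigma> i)"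
  unfolding fac_def
  by (intro submon_mult submon_prod submon_power submon_ufree ufree_FX ufree_X) auto

text \<open>The interpolation between the two sides of the theorem: \<open>m = 0\<close> is the
  generating function times the denominator, and at \<open>m = r\<close> only numerators of terms of
  Q are left.\<close>

lemma residue_sum:
  assumes r: "r \<le> n" "n \<le> N" and \<nu>: "\<And>i. i < r \<Longrightarrow> 0 < \<nu> ! i" and m: "m \<le> r"
  shows "ucfs \<nu> m (G 0 r {..<n}) * D {..<n} =
    (\<Sum>\<sigma>\<in>injs n m. num n \<nu> m \<sigma> * G m r ({..<n} - \<sigma> ` {..<m}))"
  using m
proof (induction m)
  case 0
  have "dset n 0 \<sigma> = {}" for \<sigma> by (auto simp: dset_def)
  then show ?case by (simp add: injs_0 num_def D_def)
next
  case (Suc m)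
  have nN: "{..<n} \<subseteq> {..<N}" using r by auto
  have m: "m < r" using Suc.prems by simp
  let ?\<nu> = "\<nu> ! m"
  have "ucfs \<nu> (Suc m) (G 0 r {..<n}) * D {..<n} = ucf m (- int ?\<nu>) (D {..<n} * ucfs \<nu> m (G 0 r {..<n}))"
    by (simp add: ucf_mult[OF ufree_D[OF nN]] mult.commute)
  also have "D {..<n} * ucfs \<nu> m (G 0 r {..<n}) = (\<Sum>\<sigma>\<in>injs n m. num n \<nu> m \<sigma> * G m r ({..<n} - \<sigma> ` {..<m}))"
    using Suc.IH m by (simp add: mult.commute)
  also have "ucf m (- int ?\<nu>) \<dots> = (\<Sum>\<sigma>\<in>injs n m. \<Sum>s\<in>{..<n} - \<sigma> ` {..<m}.
      num n \<nu> (Suc m) (\<sigma>(m := s)) * G (Suc m) r ({..<n} - (\<sigma>(m := s)) ` {..<Suc m}))"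
    unfolding ucf_sum
  proof (rule sum.cong[OF refl])
    fix \<sigma> assume \<sigma>: "\<sigma> \<in> injs n m"
    define S where "S = {..<n} - \<sigma> ` {..<m}"
    have S: "finite S" "S \<subseteq> {..<N}" using r by (auto simp: S_def)
    have "card (\<sigma> ` {..<m}) < card {..<n}"
      using card_image_le[of "{..<m}" \<sigma>] m r by simp
    then have S0: "S \<noteq> {}" unfolding S_def
      by (metis Diff_eq_empty_iff card_mono finite_imageI finite_lessThan not_le)
    note off = off_minus_dset[OF \<sigma> S_def]
    let ?B = "(off {..<n} - dset n m \<sigma>) - off S"
    \<comment> \<open>\<open>num\<close> still contains all of \<open>D S\<close>. Splitting it off
      leaves a factor free of \<open>U m\<close> and supplies the denominator that
      \<open>residue_step\<close> clears.\<close>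
    define H where "H = (\<Prod>i<m. fac n \<nu> \<sigma> i) * (\<Prod>(p, q)\<in>?B. F (X p) (inv (X q)))"
    have fin: "finite (off {..<n})" by (rule finite_off) simp
    have num: "num n \<nu> m \<sigma> = H * D S"
    proof -
      have "(\<Prod>(p, q)\<in>off {..<n} - dset n m \<sigma>. F (X p) (inv (X q))) =
        (\<Prod>(p, q)\<in>?B. F (X p) (inv (X q))) * D S"
        unfolding D_def by (rule prod.subset_diff[OF off(1)]) (use fin in simp)
      then show ?thesis by (simp add: num_def H_def mult.assoc)
    qed
    have H: "ufree m H"
      unfolding H_def using r injs_less[OF \<sigma>]
      by (intro submon_mult submon_prod submon_ufree ufree_fac) (auto simp: off_def intro!: ufree_FXi)
    have "ucf m (- int ?\<nu>) (num n \<nu> m \<sigma> * G m r S) = H * (ucf m (- int ?\<nu>) (G m r S) * D S)"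
    proof -
      have "ucf m (- int ?\<nu>) (num n \<nu> m \<sigma> * G m r S) = H * D S * ucf m (- int ?\<nu>) (G m r S)"
        unfolding num by (rule ucf_mult[OF submon_mult[OF submon_ufree H ufree_D[OF S(2)]]])
      then show ?thesis by (simp only: mult_ac)
    qed
    also have "\<dots> = (\<Sum>s\<in>S. num n \<nu> (Suc m) (\<sigma>(m := s)) * G (Suc m) r ({..<n} - (\<sigma>(m := s)) ` {..<Suc m}))"
      unfolding residue_step[OF m order.trans[OF r] S(1) S0 S(2) \<nu>[OF m]] sum_distrib_left
    proof (rule sum.cong[OF refl])
      fix s assume s: "s \<in> S"
      let ?\<sigma> = "\<sigma>(m := s)"
      have im: "?\<sigma> ` {..i} = \<sigma> ` {..i}" if "i < m" for i using that by auto
      have imm: "?\<sigma> ` {..<Suc m} = insert s (\<sigma> ` {..<m})" by (auto simp: lessThan_Suc)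
      have S': "{..<n} - ?\<sigma> ` {..<Suc m} = S - {s}" unfolding imm by (auto simp: S_def)
      have 1: "(\<Prod>i<m. fac n \<nu> ?\<sigma> i) = (\<Prod>i<m. fac n \<nu> \<sigma> i)"
        by (rule prod.cong[OF refl]) (simp add: fac_def im del: fun_upd_image)
      have 2: "fac n \<nu> ?\<sigma> m = F (X s) (X s) * X s ^ (?\<nu> - 1) * (\<Prod>j\<in>S - {s}. F (X s) (X j))"
        using S' by (simp add: fac_def lessThan_Suc_atMost del: fun_upd_image)
      have 3: "(\<Prod>(p, q)\<in>off {..<n} - dset n (Suc m) ?\<sigma>. F (X p) (inv (X q))) =
        (\<Prod>(p, q)\<in>?B. F (X p) (inv (X q))) * (\<Prod>(p, q)\<in>{(p, q) \<in> off S. p \<noteq> s}. F (X p) (inv (X q)))"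
        unfolding off(2)[OF s]
        by (rule prod.union_disjoint) (use fin finite_off[OF S(1)] in \<open>auto intro: finite_subset[of _ "off S"]\<close>)
      show "H * (F (X s) (X s) * X s ^ (?\<nu> - 1) * (\<Prod>j\<in>S - {s}. F (X s) (X j)) *
         (\<Prod>(p, q)\<in>{(p, q) \<in> off S. p \<noteq> s}. F (X p) (inv (X q))) * G (Suc m) r (S - {s})) =
        num n \<nu> (Suc m) ?\<sigma> * G (Suc m) r ({..<n} - ?\<sigma> ` {..<Suc m})"
        unfolding num_def S' 3 prod.lessThan_Suc 1 2 H_def by (simp only: mult_ac)
    qed
    finally show "ucf m (- int ?\<nu>) (num n \<nu> m \<sigma> * G m r ({..<n} - \<sigma> ` {..<m})) =
      (\<Sum>s\<in>{..<n} - \<sigma> ` {..<m}. num n \<nu> (Suc m) (\<sigma>(m := s)) * G (Suc m) r ({..<n} - (\<sigma>(m := s)) ` {..<Suc m}))"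
      by (simp only: S_def)
  qed
  finally show ?case by (simp only: sum_injs_Suc)
qed

text \<open>Every factor of \<open>D S\<close> divides some \<open>X p - X q\<close> with
  \<open>p \<noteq> q\<close>, which is not a zero divisor.\<close>

lemma D_cancel:
  assumes "finite S" "S \<subseteq> {..<N}" "D S * f = 0"
  shows "f = 0"
proof (rule prod_cancel[OF finite_off[OF assms(1)] _ assms(3)[unfolded D_def]])
  fix l g assume l: "l \<in> off S" and eq: "(case l of (p, q) \<Rightarrow> F (X p) (inv (X q))) * g = 0"
  obtain p q where pq: "l = (p, q)" "p < N" "q < N" "p \<noteq> q" using l assms(2) by (auto simp: off_def)
  have "(X p - X q) * g = gam (X p) (X q) * (F (X p) (inv (X q)) * g)"
    using pq by (simp add: diff_eq_gam small_X mult_ac)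
  then show "g = 0" using eq pq X_diff_cancel by simp
qed

subsection \<open>Transfer from the ring to the series\<close>

lemma xbar_coeff: "j < N \<Longrightarrow> xbar a j = coeff (inv (X j))"
  by (simp add: xbar_def inv_def coeff_X[symmetric] subst1_coeff[OF small_X])

lemma ubar_coeff: "j < N \<Longrightarrow> ubar a j = coeff (inv (U j))"
  by (simp add: ubar_def inv_def coeff_U[symmetric] subst1_coeff[OF small_U])

lemma Pser_coeff: "smallN A \<Longrightarrow> Pser a (coeff A) = coeff (beta A 0)"
  by (simp only: Pser_def subst1_coeff bet_0_right)

lemma sprod_set_coeff:
  assumes "finite A" "\<And>i. i \<in> A \<Longrightarrow> f i = coeff (g i)"
  shows "sprod_set f A = coeff (\<Prod>i\<in>A. g i)"
proof -
  have "map f (sorted_list_of_set A) = map (\<lambda>i. coeff (g i)) (sorted_list_of_set A)"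
    using assms by (intro map_cong refl) simp
  then show ?thesis by (simp only: coeff_prod[OF assms(1)] sprod_set_def)
qed

lemma genfun_coeff:
  assumes "r \<le> n" "n \<le> N"
  shows "genfun a n r = coeff (G 0 r {..<n})"
proof -
  have N: "i < N" if "i < n" for i using that assms by simp
  have rN: "i < N" if "i < r" for i using that assms by simp
  have 1: "smult (Fsub a (uvar i) (xvar j)) (sinv (Fsub a (uvar i) (xbar a j))) = coeff (F (U i) (X j) * R i j)"
    if "i < r" "j < n" for i j
  proof -
    note S = small_U[OF rN[OF that(1)]] small_X[OF N[OF that(2)]]
    show ?thesis
      unfolding coeff_U[symmetric] coeff_X[symmetric] xbar_coeff[OF N[OF that(2)]] Fsub_coeff[OF S]
        Fsub_coeff[OF S(1) small_inv[OF S(2)]] sinv_coeff[OF F_R[OF rN[OF that(1)] N[OF that(2)]]] coeff_times ..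
  qed
  have 2: "sinv (Pser a (uvar i)) = coeff (Pinv (U i))" if "i < r" for i
  proof -
    note S = small_U[OF rN[OF that]]
    have "beta (U i) 0 * Pinv (U i) = 1" unfolding Pinv_def by (intro hinv_beta S small_0)
    then show ?thesis unfolding coeff_U[symmetric] Pser_coeff[OF S] by (rule sinv_coeff)
  qed
  have 3: "smult (Fsub a (uvar j) (ubar a i)) (sinv (Fsub a (uvar j) (uvar i))) = coeff (F (U j) (inv (U i)) * V j i)"
    if "i < j" "j < r" for i j
  proof -
    have "i < r" using that by simp
    note S = small_U[OF rN[OF that(2)]] small_U[OF rN[OF this]]
    show ?thesis
      unfolding coeff_U[symmetric] ubar_coeff[OF rN[OF \<open>i < r\<close>]] Fsub_coeff[OF S]
        Fsub_coeff[OF S(1) small_inv[OF S(2)]] sinv_coeff[OF F_V[OF that(1) rN[OF that(2)]]] coeff_times ..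
  qed
  have "sprod_set (\<lambda>i. smult (sinv (Pser a (uvar i))) (sprod_set (\<lambda>j. smult (Fsub a (uvar i) (xvar j)) (sinv (Fsub a (uvar i) (xbar a j)))) {..<n})) {..<r}
      = coeff (\<Prod>i<r. Pinv (U i) * (\<Prod>j<n. F (U i) (X j) * R i j))"
  proof (rule sprod_set_coeff[OF finite_lessThan])
    fix i assume i: "i \<in> {..<r}"
    show "smult (sinv (Pser a (uvar i))) (sprod_set (\<lambda>j. smult (Fsub a (uvar i) (xvar j)) (sinv (Fsub a (uvar i) (xbar a j)))) {..<n})
      = coeff (Pinv (U i) * (\<Prod>j<n. F (U i) (X j) * R i j))"
      unfolding coeff_times[of "Pinv (U i)"]
      by (intro arg_cong2[where f = smult] sprod_set_coeff finite_lessThan 1 2) (use i in auto)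
  qed
  moreover have "sprod_set (\<lambda>i. sprod_set (\<lambda>j. smult (Fsub a (uvar j) (ubar a i)) (sinv (Fsub a (uvar j) (uvar i)))) {i<..<r}) {..<r}
      = coeff (\<Prod>i<r. \<Prod>j\<in>{i<..<r}. F (U j) (inv (U i)) * V j i)"
  proof (rule sprod_set_coeff[OF finite_lessThan])
    fix i assume i: "i \<in> {..<r}"
    show "sprod_set (\<lambda>j. smult (Fsub a (uvar j) (ubar a i)) (sinv (Fsub a (uvar j) (uvar i)))) {i<..<r}
      = coeff (\<Prod>j\<in>{i<..<r}. F (U j) (inv (U i)) * V j i)"
      by (intro sprod_set_coeff 3) auto
  qed
  ultimately show ?thesis
    by (simp only: genfun_def G_def coeff_times atLeast0LessThan)
qed

lemma pairprod_coeff: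
  assumes "T \<subseteq> {..<n} \<times> {..<n}" "n \<le> N"
  shows "pairprod (\<lambda>p q. Fsub a (xvar p) (xbar a q)) n T = coeff (\<Prod>(p, q)\<in>T. F (X p) (inv (X q)))"
proof -
  let ?f = "\<lambda>p q. F (X p) (inv (X q))"
  have "Fsub a (xvar p) (xbar a q) = coeff (?f p q)" if "p < n" "q < n" for p q
    using that assms(2) by (simp add: coeff_X[symmetric] xbar_coeff Fsub_coeff[of N] small_X small_inv)
  then have "pairprod (\<lambda>p q. Fsub a (xvar p) (xbar a q)) n T = coeff (\<Prod>p<n. \<Prod>q<n. if (p, q) \<in> T then ?f p q else 1)"
    unfolding pairprod_def by (intro sprod_set_coeff) (auto simp: coeff_one)
  also have "(\<Prod>p<n. \<Prod>q<n. if (p, q) \<in> T then ?f p q else 1) = (\<Prod>(p, q)\<in>T. ?f p q)"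
  proof -
    have "(\<Prod>p<n. \<Prod>q<n. if (p, q) \<in> T then ?f p q else 1) = (\<Prod>x\<in>{..<n} \<times> {..<n}. if x \<in> T then ?f (fst x) (snd x) else 1)"
      by (subst prod.cartesian_product) (auto intro!: prod.cong)
    also have "\<dots> = (\<Prod>x\<in>{x \<in> {..<n} \<times> {..<n}. x \<in> T}. ?f (fst x) (snd x))"
      by (rule prod.inter_filter[symmetric]) simp
    also have "{x \<in> {..<n} \<times> {..<n}. x \<in> T} = T" using assms(1) by auto
    finally show ?thesis by (simp add: case_prod_beta)
  qed
  finally show ?thesis .
qed

lemma offdiag_off: "offdiag n = off {..<n}"
  by (auto simp: offdiag_def off_def)

lemma qden_coeff: "n \<le> N \<Longrightarrow> qden a n = coeff (D {..<n})"
  unfolding qden_def D_def offdiag_off by (rule pairprod_coeff) (auto simp: off_def)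

lemma qnum_coeff:
  assumes \<sigma>: "\<sigma> \<in> injs n (length \<nu>)" and n: "n \<le> N"
  shows "qnum a n \<nu> \<sigma> = coeff (num n \<nu> (length \<nu>) \<sigma>)"
  unfolding qnum_def num_def coeff_times offdiag_off
proof (intro arg_cong2[where f = smult] sprod_set_coeff finite_lessThan pairprod_coeff n)
  fix i assume i: "i \<in> {..<length \<nu>}"
  then have "\<sigma> i < N" using injs_less[OF \<sigma>, of i] n by simp
  note S = small_X[OF this]
  show "smult (bracket a (xvar (\<sigma> i)) (\<nu> ! i)) (sprod_set (\<lambda>j. Fsub a (xvar (\<sigma> i)) (xvar j)) ({..<n} - \<sigma> ` {..i}))
    = coeff (fac n \<nu> \<sigma> i)"
    unfolding fac_def coeff_times[of _ "\<Prod>j\<in>_. _ j"]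
  proof (intro arg_cong2[where f = smult] sprod_set_coeff)
    show "bracket a (xvar (\<sigma> i)) (\<nu> ! i) = coeff (F (X (\<sigma> i)) (X (\<sigma> i)) * X (\<sigma> i) ^ (\<nu> ! i - 1))"
      unfolding bracket_def coeff_X[symmetric] Fsub_coeff[OF S S] coeff_power[symmetric] coeff_times ..
    fix j assume "j \<in> {..<n} - \<sigma> ` {..i}"
    then have "j < N" using n by simp
    from Fsub_coeff[OF S small_X[OF this]] show "Fsub a (xvar (\<sigma> i)) (xvar j) = coeff (F (X (\<sigma> i)) (X j))"
      by (simp only: coeff_X)
  qed simp
qed (auto simp: off_def)

lemma fold_sadd_coeff:
  assumes "finite I" "\<And>i. i \<in> I \<Longrightarrow> f i = coeff (g i)"
  shows "Finite_Set.fold (\<lambda>i acc. sadd (f i) acc) szero I = coeff (\<Sum>i\<in>I. g i)"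
proof -
  interpret comp_fun_commute "\<lambda>i acc. sadd (f i) acc"
    by standard (auto simp: sadd_def fun_eq_iff algebra_simps)
  show ?thesis
    using assms by (induction I rule: finite_induct) (simp_all add: coeff_zero' coeff_plus)
qed

text \<open>\<open>residue_sum\<close> at \<open>m = r\<close> shows that the iterated coefficient
  solves the equation in \<open>QL\<close>; \<open>D_cancel\<close> makes the solution
  unique.\<close>

lemma QL_coeff:
  assumes \<nu>: "strict_partition \<nu>" and n: "length \<nu> \<le> n" "n \<le> N"
  shows "QL a n \<nu> = coeff (ucfs \<nu> (length \<nu>) (G 0 (length \<nu>) {..<n}))"
proof -
  let ?r = "length \<nu>"
  let ?q = "ucfs \<nu> ?r (G 0 ?r {..<n})"
  have nN: "{..<n} \<subseteq> {..<N}" using n by auto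
  have pos: "0 < \<nu> ! i" if "i < ?r" for i using \<nu> that by (auto simp: strict_partition_def)
  have G1: "G ?r ?r S = 1" for S by (simp add: G_def)
  have eq: "?q * D {..<n} = (\<Sum>\<sigma>\<in>injs n ?r. num n \<nu> ?r \<sigma>)"
    using residue_sum[OF n pos order.refl] by (simp add: G1)
  have rhs: "Finite_Set.fold (\<lambda>\<sigma> acc. sadd (qnum a n \<nu> \<sigma>) acc) szero (injs n ?r) = coeff (?q * D {..<n})"
    unfolding eq by (rule fold_sadd_coeff[OF finite_injs qnum_coeff[OF _ n(2)]])
  show ?thesis
    unfolding QL_def rhs qden_coeff[OF n(2)]
  proof (rule the_equality)
    \<comment> \<open>No u is left: those below \<open>?r\<close> have been extracted, and the
      others never occur in \<open>G\<close>.\<close>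
    have "coeff ?q \<alpha> e = 0" if "e \<noteq> (\<lambda>_. 0)" for \<alpha> e
    proof -
      obtain k where k: "e k \<noteq> 0" using \<open>e \<noteq> (\<lambda>_. 0)\<close> by auto
      show ?thesis
      proof (cases "k < ?r")
        case True
        then show ?thesis using k by (auto simp: coeff_ucfs)
      next
        case False
        have "ufree k ?q" using False n nN by (intro ufree_ucfs ufree_G) auto
        then show ?thesis using k unfolding suppIn_def by blast
      qed
    qed
    then show "wf_ser (coeff ?q) \<and> (\<forall>\<alpha> e. e \<noteq> (\<lambda>_. 0) \<longrightarrow> coeff ?q \<alpha> e = 0) \<and>
      smult (coeff ?q) (coeff (D {..<n})) = coeff (?q * D {..<n})"
      by (simp add: coeff_times)
    fix q assume q: "wf_ser q \<and> (\<forall>\<alpha> e. e \<noteq> (\<lambda>_. 0) \<longrightarrow> q \<alpha> e = 0) \<and>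
      smult q (coeff (D {..<n})) = coeff (?q * D {..<n})"
    then have "coeff (Abs_hser q * D {..<n}) = coeff (?q * D {..<n})"
      by (simp add: coeff_times coeff_Abs)
    then have "Abs_hser q * D {..<n} = ?q * D {..<n}" by (simp only: coeff_inject)
    then have "D {..<n} * (Abs_hser q - ?q) = 0" by (simp add: algebra_simps)
    then have "Abs_hser q - ?q = 0" by (rule D_cancel[OF finite_lessThan nN])
    then have "Abs_hser q = ?q" by simp
    then have "coeff (Abs_hser q) = coeff ?q" by (rule arg_cong)
    then show "q = coeff ?q" using q by (simp add: coeff_Abs)
  qed
qed

end

theorem mainTheorem7:
  fixes a :: "nat \<Rightarrow> nat \<Rightarrow> 'a::idom" and n :: nat and \<nu> :: "nat list"
  assumes "is_fgl a" and "strict_partition \<nu>" and "length \<nu> \<le> n"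
  shows "(\<lambda>\<alpha>. QL a n \<nu> \<alpha> (\<lambda>_. 0)) =
         (\<lambda>\<alpha>. genfun a n (length \<nu>) \<alpha> (\<lambda>i. if i < length \<nu> then - int (\<nu> ! i) else 0))"
proof -
  \<comment> \<open>The bound must exceed the indices of the x's and u's, all below
    \<open>n\<close>, and be at least 3 for the three variables of the associative law.\<close>
  interpret fgl a "n + 3" using assms(1) by unfold_locales simp_all
  have n: "n \<le> n + 3" by simp
  show ?thesis
    unfolding QL_coeff[OF assms(2,3) n] genfun_coeff[OF assms(3) n] by (simp add: coeff_ucfs)
qed

end
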